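(* Consider the standard projective action of $\mathrm{PSL}(2,\mathbb{C})$ on the sphere $S^2=\mathbb{C}P^1$, and let $G_1,G_2$ be countable dense subgroups of $\mathrm{PSL}(2,\mathbb{C})$. Then: (1) If $d>0$ and $\mu$ is a $d$-quasiconformal probability measure for $G_1$ on $S^2$, then $\mu$ is absolutely continuous (with respect to Lebesgue measure on $S^2$) and, in particular, $d=2$. (2) If $h:S^2\to S^2$ is a topological orbit equivalence between the actions of $G_1$ and $G_2$, then $h$ is equivariant and it coincides with an element of $\mathrm{PSL}(2,\mathbb{C})$.
   Context: A probability measure $\mu$ on $S^2$ is $d$-quasiconformal for a group $G\subset \mathrm{PSL}(2,\mathbb{C})$ if there is a constant $C\ge 1$ such that for every $g\in G$ and every Borel set $B\subset S^2$, $\frac1C\int_B \|D_xg\|^d\,d\mu(x)\le \mu(g(B))\le C\int_B \|D_xg\|^d\,d\mu(x)$, where $\|D_xg\|$ is the norm of the (conformal) derivative for the round metric. A topological (continuous) orbit equivalence between the actions of $G_1$ and $G_2$ on $S^2$ is a homeomorphism $h$ of $S^2$ taking each $G_1$-orbit onto a $G_2$-orbit. It is equivariant if there is a group isomorphism $\sigma:G_1\to G_2$ with $h(g\cdot x)=\sigma(g)\cdot h(x)$ for all $g\in G_1$, $x\in S^2$ (i.e. $h$ conjugates the two actions).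
   Formalization: In (2), h coincides with an element of PSL(2,C) only if h preserves orientation; otherwise h is an element of PSL(2,C) composed with complex conjugation. As stated (2) fails: take G_1=G_2=PSL(2,Q(i)), h complex conjugation. Equivariance is kept for all h. *)

theory Defs
  imports "HOL-Probability.Probability_Measure" "HOL-Homology.Homology" "HOL-Algebra.Group_Action"
begin

section \<open>The round sphere and its identification with the complex projective line\<close>

text \<open>Euclidean 3-space is \<^typ>\<open>complex \<times> real\<close>, which carries the Euclidean norm.\<close>

abbreviation S2 :: "(complex \<times> real) set"
  where "S2 \<equiv> sphere 0 1"

text \<open>
  The Hopf map from the nonzero vectors of complex 2-space to the sphere. Its fibres are the complex
  lines (lemmas \<open>hopf_eq_iff\<close> and \<open>hopf_surj\<close>), so it identifies the projective
  line with the sphere; in the affine coordinate $z = v_1 / v_2$ it is the inverse stereographic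
  projection $z \mapsto (2z, |z|^2 - 1) / (|z|^2 + 1)$.
\<close>

definition hopf :: "complex^2 \<Rightarrow> complex \<times> real"
  where "hopf v = (2 * v$1 * cnj (v$2) / complex_of_real ((norm v)\<^sup>2),
                   ((cmod (v$1))\<^sup>2 - (cmod (v$2))\<^sup>2) / (norm v)\<^sup>2)"

lemma norm_vec2_sq: "(norm (v :: complex^2))\<^sup>2 = (cmod (v$1))\<^sup>2 + (cmod (v$2))\<^sup>2"
  by (simp add: norm_vec_def L2_set_def sum_2 real_sqrt_pow2)

lemma hopf_in_S2:
  assumes "v \<noteq> 0" shows "hopf v \<in> S2"
proof -
  have n: "norm v > 0" using assms by simp
  have e: "(norm (hopf v))\<^sup>2 = (cmod (fst (hopf v)))\<^sup>2 + (snd (hopf v))\<^sup>2"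
    by (simp add: norm_prod_def)
  have "(cmod (fst (hopf v)))\<^sup>2 = 4 * (cmod (v$1))\<^sup>2 * (cmod (v$2))\<^sup>2 / ((norm v)\<^sup>2)\<^sup>2"
    by (simp add: hopf_def norm_divide norm_mult power_divide power_mult_distrib norm_power)
  moreover have "(snd (hopf v))\<^sup>2 = ((cmod (v$1))\<^sup>2 - (cmod (v$2))\<^sup>2)\<^sup>2 / ((norm v)\<^sup>2)\<^sup>2"
    by (simp add: hopf_def power_divide)
  ultimately have "(norm (hopf v))\<^sup>2 =
      (4 * (cmod (v$1))\<^sup>2 * (cmod (v$2))\<^sup>2 + ((cmod (v$1))\<^sup>2 - (cmod (v$2))\<^sup>2)\<^sup>2) / ((norm v)\<^sup>2)\<^sup>2"
    using e by (simp add: add_divide_distrib)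
  also have "4 * (cmod (v$1))\<^sup>2 * (cmod (v$2))\<^sup>2 + ((cmod (v$1))\<^sup>2 - (cmod (v$2))\<^sup>2)\<^sup>2 = ((norm v)\<^sup>2)\<^sup>2"
    unfolding norm_vec2_sq by (simp add: power2_eq_square algebra_simps)
  finally have "(norm (hopf v))\<^sup>2 = 1" using n by simp
  then have "norm (hopf v) = 1" by (simp add: power2_eq_1_iff) (smt (verit) norm_ge_zero)
  then show ?thesis by simp
qed

lemma hopf_scale:
  assumes "c \<noteq> 0" shows "hopf (c *s v) = hopf v"
proof -
  have n: "(norm (c *s v))\<^sup>2 = (cmod c)\<^sup>2 * (norm v)\<^sup>2"
    by (simp add: norm_vec2_sq norm_mult power_mult_distrib algebra_simps)
  have c: "complex_of_real ((cmod c)\<^sup>2) = c * cnj c"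
    by (rule complex_norm_square)
  have "2 * (c *s v)$1 * cnj ((c *s v)$2) / complex_of_real ((norm (c *s v))\<^sup>2)
      = ((c * cnj c) * (2 * v$1 * cnj (v$2))) / ((c * cnj c) * complex_of_real ((norm v)\<^sup>2))"
    unfolding n of_real_mult c by (simp add: algebra_simps)
  also have "\<dots> = 2 * v$1 * cnj (v$2) / complex_of_real ((norm v)\<^sup>2)"
    using assms by simp
  finally have 1: "2 * (c *s v)$1 * cnj ((c *s v)$2) / complex_of_real ((norm (c *s v))\<^sup>2)
      = 2 * v$1 * cnj (v$2) / complex_of_real ((norm v)\<^sup>2)" .
  have "((cmod ((c *s v)$1))\<^sup>2 - (cmod ((c *s v)$2))\<^sup>2) / (norm (c *s v))\<^sup>2
      = ((cmod c)\<^sup>2 * ((cmod (v$1))\<^sup>2 - (cmod (v$2))\<^sup>2)) / ((cmod c)\<^sup>2 * (norm v)\<^sup>2)"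
    unfolding n by (simp add: norm_mult power_mult_distrib right_diff_distrib)
  also have "\<dots> = ((cmod (v$1))\<^sup>2 - (cmod (v$2))\<^sup>2) / (norm v)\<^sup>2"
    using assms by simp
  finally show ?thesis using 1 by (simp add: hopf_def)
qed

lemma hopf_eq_iff:
  assumes "v \<noteq> 0" "w \<noteq> 0"
  shows "hopf v = hopf w \<longleftrightarrow> (\<exists>c. w = c *s v)"
proof
  assume h: "hopf v = hopf w"
  define P where "P u = complex_of_real ((norm u)\<^sup>2)" for u :: "complex^2"
  have P0: "P v \<noteq> 0" "P w \<noteq> 0" using assms by (auto simp: P_def)
  have P1: "P u = u$1 * cnj (u$1) + u$2 * cnj (u$2)" for u
    unfolding P_def norm_vec2_sq by (simp only: of_real_add complex_norm_square)
  have t: "complex_of_real (snd (hopf u)) = (u$1 * cnj (u$1) - u$2 * cnj (u$2)) / P u" for u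
    unfolding hopf_def P_def by (simp only: snd_conv of_real_divide of_real_diff complex_norm_square)
  have f: "fst (hopf u) = 2 * (u$1 * cnj (u$2)) / P u" for u
    unfolding hopf_def P_def by simp
  have A: "u$1 * cnj (u$1) / P u = (1 + complex_of_real (snd (hopf u))) / 2" if "P u \<noteq> 0" for u
  proof -
    have "1 + complex_of_real (snd (hopf u)) = (P u + (u$1 * cnj (u$1) - u$2 * cnj (u$2))) / P u"
      unfolding t add_divide_distrib using that by simp
    also have "\<dots> = 2 * (u$1 * cnj (u$1) / P u)"
      unfolding P1[of u] by simp
    finally show ?thesis by simp
  qed
  have B: "u$2 * cnj (u$2) / P u = (1 - complex_of_real (snd (hopf u))) / 2" if "P u \<noteq> 0" for u
  proof -
    have "1 - complex_of_real (snd (hopf u)) = (P u - (u$1 * cnj (u$1) - u$2 * cnj (u$2))) / P u"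
      unfolding t diff_divide_distrib using that by simp
    also have "\<dots> = 2 * (u$2 * cnj (u$2) / P u)"
      unfolding P1[of u] by simp
    finally show ?thesis by simp
  qed
  have Cc: "u$1 * cnj (u$2) / P u = fst (hopf u) / 2" for u
    using f[of u] by simp
  have Pr: "cnj (P u) = P u" for u by (simp add: P_def)
  have D: "u$2 * cnj (u$1) / P u = cnj (fst (hopf u)) / 2" for u
    using arg_cong[OF Cc[of u], of cnj] by (simp add: Pr mult.commute)
  have a: "v$1 * cnj (v$1) / P v = w$1 * cnj (w$1) / P w" by (simp only: A[OF P0(1)] A[OF P0(2)] h)
  have b: "v$2 * cnj (v$2) / P v = w$2 * cnj (w$2) / P w" by (simp only: B[OF P0(1)] B[OF P0(2)] h)
  have c: "v$1 * cnj (v$2) / P v = w$1 * cnj (w$2) / P w" by (simp only: Cc h)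
  have d: "v$2 * cnj (v$1) / P v = w$2 * cnj (w$1) / P w" by (simp only: D h)
  define k where "k = (cnj (v$1) * w$1 + cnj (v$2) * w$2) / P v"
  have "k * v$1 = v$1 * cnj (v$1) / P v * w$1 + v$1 * cnj (v$2) / P v * w$2"
    by (simp add: k_def add_divide_distrib algebra_simps)
  also have "\<dots> = w$1 * P w / P w" unfolding a c P1[of w] by (simp add: add_divide_distrib algebra_simps)
  finally have k1: "k * v$1 = w$1" using P0 by simp
  have "k * v$2 = v$2 * cnj (v$1) / P v * w$1 + v$2 * cnj (v$2) / P v * w$2"
    by (simp add: k_def add_divide_distrib algebra_simps)
  also have "\<dots> = w$2 * P w / P w" unfolding b d P1[of w] by (simp add: add_divide_distrib algebra_simps)
  finally have k2: "k * v$2 = w$2" using P0 by simp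
  have "w = k *s v" using k1 k2 by (simp add: vec_eq_iff forall_2)
  then show "\<exists>c. w = c *s v" ..
next
  assume "\<exists>c. w = c *s v"
  then obtain c where c: "w = c *s v" by blast
  with assms have "c \<noteq> 0" by auto
  with c show "hopf v = hopf w" by (simp add: hopf_scale)
qed

lemma hopf_surj:
  assumes "x \<in> S2" shows "\<exists>v. v \<noteq> 0 \<and> hopf v = x"
proof -
  obtain z t where x: "x = (z, t)" by force
  have "(norm x)\<^sup>2 = 1" using assms by simp
  then have zt: "(cmod z)\<^sup>2 + t\<^sup>2 = 1" by (simp add: x norm_prod_def)
  show ?thesis
  proof (cases "t = 1")
    case True
    with zt have "z = 0" by simp
    define v :: "complex^2" where "v = vector [1, 0]"
    have v: "v$1 = 1" "v$2 = 0" by (simp_all add: v_def)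
    have "hopf v = (0, 1)" by (simp add: hopf_def norm_vec2_sq v)
    moreover have "v \<noteq> 0" using v by auto
    ultimately show ?thesis using True \<open>z = 0\<close> x by blast
  next
    case False
    define v :: "complex^2" where "v = vector [z, complex_of_real (1 - t)]"
    have v: "v$1 = z" "v$2 = complex_of_real (1 - t)" by (simp_all add: v_def)
    have c: "(cmod (complex_of_real (1 - t)))\<^sup>2 = (1 - t)\<^sup>2" by (simp only: norm_of_real power2_abs)
    have n: "(norm v)\<^sup>2 = 2 * (1 - t)"
      unfolding norm_vec2_sq v c using zt by (simp add: power2_eq_square algebra_simps)
    have z: "(cmod z)\<^sup>2 - (1 - t)\<^sup>2 = t * (2 * (1 - t))"
      using zt by (simp add: power2_eq_square algebra_simps)
    have s: "complex_of_real (1 - t) \<noteq> 0" using False by (simp only: of_real_eq_0_iff)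
    have "hopf v = (2 * z * complex_of_real (1 - t) / (2 * complex_of_real (1 - t)),
                    t * (2 * (1 - t)) / (2 * (1 - t)))"
      unfolding hopf_def n v c z by (simp only: complex_cnj_complex_of_real of_real_mult of_real_numeral)
    also have "\<dots> = (z, t)" using s False by (simp del: of_real_diff)
    finally have "hopf v = x" using x by simp
    moreover have "v \<noteq> 0" using v s by (metis zero_index)
    ultimately show ?thesis by blast
  qed
qed

text \<open>
  Lebesgue measure on the sphere: the area of a Borel set is three times the volume of the part of
  the unit ball radially above it.
\<close>

definition sphere_area :: "(complex \<times> real) measure"
  where "sphere_area = scale_measure 3
           (distr (restrict_space lborel (ball 0 1 - {0})) (restrict_space borel S2) sgn)"

section \<open>The group PSL(2,C) and its action on the sphere\<close>

definition SL2C :: "(complex^2^2) monoid"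
  where "SL2C = \<lparr>carrier = {A. det A = 1}, mult = (**), one = mat 1\<rparr>"

definition PSL2C :: "(complex^2^2) set monoid"
  where "PSL2C = SL2C Mod {mat 1, - mat 1}"

lemma mat2_minus_mult:
  fixes A B :: "complex^2^2"
  shows "(- A) ** B = - (A ** B)" "A ** (- B) = - (A ** B)"
  by (simp_all add: matrix_matrix_mult_def vec_eq_iff sum_negf)

lemma det2_minus: "det (- A :: complex^2^2) = det A"
  by (simp add: det_2)

lemma group_SL2C: "group SL2C"
proof (rule groupI)
  fix A assume A: "A \<in> carrier SL2C"
  then have "det A = 1" by (simp add: SL2C_def)
  then have "invertible A" by (simp add: invertible_det_nz)
  then obtain B where B: "B ** A = mat 1" by (auto simp: invertible_def)
  then have "det B * det A = 1" by (metis det_I det_mul)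
  with \<open>det A = 1\<close> B show "\<exists>B\<in>carrier SL2C. B \<otimes>\<^bsub>SL2C\<^esub> A = \<one>\<^bsub>SL2C\<^esub>"
    by (auto simp: SL2C_def)
qed (auto simp: SL2C_def det_mul matrix_mul_assoc)

lemma normal_centre_SL2C: "{mat 1, - mat 1} \<lhd> SL2C"
proof -
  interpret group SL2C by (rule group_SL2C)
  have o: "\<one>\<^bsub>SL2C\<^esub> = mat 1" by (simp add: SL2C_def)
  have i: "inv\<^bsub>SL2C\<^esub> (- mat 1) = - mat 1"
    by (rule inv_equality) (auto simp: SL2C_def mat2_minus_mult det2_minus)
  have i1: "inv\<^bsub>SL2C\<^esub> (mat 1) = mat 1"
    using inv_one unfolding o .
  have "subgroup {mat 1, - mat 1} SL2C"
  proof (rule subgroupI)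
    show "{mat 1, - mat 1} \<subseteq> carrier SL2C"
      by (auto simp: SL2C_def det2_minus)
    show "inv\<^bsub>SL2C\<^esub> a \<in> {mat 1, - mat 1}" if "a \<in> {mat 1, - mat 1}" for a
      using that i i1 by auto
    show "a \<otimes>\<^bsub>SL2C\<^esub> b \<in> {mat 1, - mat 1}"
      if "a \<in> {mat 1, - mat 1}" "b \<in> {mat 1, - mat 1}" for a b
      using that by (auto simp: SL2C_def mat2_minus_mult)
  qed simp
  then show ?thesis
    by (rule normalI) (auto simp: r_coset_def l_coset_def SL2C_def mat2_minus_mult)
qed

lemma group_PSL2C: "group PSL2C"
  unfolding PSL2C_def by (rule normal.factorgroup_is_group[OF normal_centre_SL2C])

lemma carrier_PSL2C: "carrier PSL2C = {{A, - A} |A. det A = 1}"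
  by (auto simp: PSL2C_def FactGroup_def RCOSETS_def r_coset_def SL2C_def mat2_minus_mult)

text \<open>The quotient topology.\<close>

definition PSL2C_topology :: "(complex^2^2) set topology"
  where "PSL2C_topology = topology (\<lambda>U. U \<subseteq> carrier PSL2C \<and>
           openin (top_of_set (carrier SL2C)) {A \<in> carrier SL2C. {mat 1, - mat 1} #>\<^bsub>SL2C\<^esub> A \<in> U})"

lemma openin_PSL2C_topology:
  "openin PSL2C_topology U \<longleftrightarrow> U \<subseteq> carrier PSL2C \<and>
     openin (top_of_set (carrier SL2C)) {A \<in> carrier SL2C. {mat 1, - mat 1} #>\<^bsub>SL2C\<^esub> A \<in> U}"
proof -
  let ?q = "\<lambda>A. {mat 1, - mat 1} #>\<^bsub>SL2C\<^esub> A"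
  let ?P = "\<lambda>U. {A \<in> carrier SL2C. ?q A \<in> U}"
  have 1: "?P (U \<inter> V) = ?P U \<inter> ?P V" for U V by blast
  have 2: "?P (\<Union>K) = \<Union>(?P ` K)" for K by blast
  have "istopology (\<lambda>U. U \<subseteq> carrier PSL2C \<and> openin (top_of_set (carrier SL2C)) (?P U))"
    unfolding istopology_def 1 2 by (auto intro!: openin_Int openin_Union)
  then show ?thesis by (simp add: PSL2C_topology_def topology_inverse')
qed

lemma topspace_PSL2C_topology: "topspace PSL2C_topology = carrier PSL2C"
proof -
  have "openin PSL2C_topology (carrier PSL2C)"
  proof -
    have "{A \<in> carrier SL2C. {mat 1, - mat 1} #>\<^bsub>SL2C\<^esub> A \<in> carrier PSL2C} = carrier SL2C"
      by (auto simp: PSL2C_def FactGroup_def RCOSETS_def)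
    then show ?thesis by (simp add: openin_PSL2C_topology)
  qed
  then show ?thesis
    by (metis openin_PSL2C_topology openin_subset openin_topspace subset_antisym)
qed

definition dense_subgroup :: "(complex^2^2) set set \<Rightarrow> bool"
  where "dense_subgroup G \<longleftrightarrow>
           subgroup G PSL2C \<and> Abstract_Topology.closure_of PSL2C_topology G = carrier PSL2C"

definition SL_act :: "complex^2^2 \<Rightarrow> complex \<times> real \<Rightarrow> complex \<times> real"
  where "SL_act A x = hopf (A *v (SOME v. v \<noteq> 0 \<and> hopf v = x))"

lemma SL_act_hopf:
  assumes "det A = 1" "v \<noteq> 0" shows "SL_act A (hopf v) = hopf (A *v v)"
proof -
  define w where "w = (SOME w. w \<noteq> 0 \<and> hopf w = hopf v)"
  have w: "w \<noteq> 0 \<and> hopf w = hopf v"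
    unfolding w_def by (rule someI[of _ v]) (use assms in simp)
  then obtain c where c: "v = c *s w" using hopf_eq_iff assms by metis
  with assms have "c \<noteq> 0" by auto
  have "A *v v = c *s (A *v w)" by (simp add: c vector_scalar_commute)
  then show ?thesis using \<open>c \<noteq> 0\<close> by (simp add: SL_act_def w_def[symmetric] hopf_scale)
qed

text \<open>An element of PSL(2,C) acts through either of its two representing matrices.\<close>

definition PSL_act :: "(complex^2^2) set \<Rightarrow> complex \<times> real \<Rightarrow> complex \<times> real"
  where "PSL_act g x = the_elem ((\<lambda>A. SL_act A x) ` g)"

lemma PSL_act_eq:
  assumes "det A = 1" "x \<in> S2" shows "PSL_act {A, - A} x = SL_act A x"
proof -
  obtain v where v: "v \<noteq> 0" "hopf v = x" using hopf_surj assms by blast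
  have "(- A) *v v = (- 1) *s (A *v v)"
    by (simp add: matrix_vector_mult_def vec_eq_iff sum_negf)
  then have "SL_act (- A) x = SL_act A x"
    using SL_act_hopf[of A v] SL_act_hopf[of "- A" v] v assms hopf_scale[of "-1" "A *v v"]
    by (simp add: det2_minus)
  then show ?thesis by (simp add: PSL_act_def)
qed

section \<open>Quasiconformal measures\<close>

text \<open>
  The operator norm of the differential of a self-map of the sphere, on the tangent plane
  $x^\perp$. The map is differentiated within the sphere only; this determines
  the differential on the tangent plane, hence the norm.
\<close>

definition deriv_norm :: "(complex \<times> real \<Rightarrow> complex \<times> real) \<Rightarrow> complex \<times> real \<Rightarrow> real"
  where "deriv_norm f x =
           (SUP v\<in>{v. v \<bullet> x = 0 \<and> norm v = 1}. norm (frechet_derivative f (at x within S2) v))"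

definition quasiconformal_measure ::
    "real \<Rightarrow> (complex^2^2) set set \<Rightarrow> (complex \<times> real) measure \<Rightarrow> bool"
  where "quasiconformal_measure d G \<mu> \<longleftrightarrow>
           prob_space \<mu> \<and> sets \<mu> = sets (restrict_space borel S2) \<and>
           (\<exists>C\<ge>1. \<forall>g\<in>G. \<forall>B\<in>sets \<mu>.
              ennreal (1 / C) * (\<integral>\<^sup>+x\<in>B. ennreal (deriv_norm (PSL_act g) x powr d) \<partial>\<mu>)
                \<le> emeasure \<mu> (PSL_act g ` B) \<and>
              emeasure \<mu> (PSL_act g ` B)
                \<le> ennreal C * (\<integral>\<^sup>+x\<in>B. ennreal (deriv_norm (PSL_act g) x powr d) \<partial>\<mu>))"

section \<open>Orbit equivalences\<close>

definition orbit_equivalence ::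
    "(complex^2^2) set set \<Rightarrow> (complex^2^2) set set \<Rightarrow> (complex \<times> real \<Rightarrow> complex \<times> real) \<Rightarrow> bool"
  where "orbit_equivalence G H h \<longleftrightarrow>
           homeomorphic_map (top_of_set S2) (top_of_set S2) h \<and>
           (\<forall>X \<in> orbits (PSL2C\<lparr>carrier := G\<rparr>) S2 PSL_act.
              h ` X \<in> orbits (PSL2C\<lparr>carrier := H\<rparr>) S2 PSL_act)"

definition equivariant ::
    "(complex^2^2) set set \<Rightarrow> (complex^2^2) set set \<Rightarrow> (complex \<times> real \<Rightarrow> complex \<times> real) \<Rightarrow> bool"
  where "equivariant G H h \<longleftrightarrow>
           (\<exists>\<sigma> \<in> iso (PSL2C\<lparr>carrier := G\<rparr>) (PSL2C\<lparr>carrier := H\<rparr>).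
              \<forall>g\<in>G. \<forall>x\<in>S2. h (PSL_act g x) = PSL_act (\<sigma> g) (h x))"

text \<open>
  Orientation preserving means of Brouwer degree 1. The library defines the degree for self-maps of
  the sphere \<^term>\<open>nsphere 2\<close> of coordinate sequences.
\<close>

definition to_nsphere :: "complex \<times> real \<Rightarrow> nat \<Rightarrow> real"
  where "to_nsphere x = (\<lambda>i. if i = 0 then Re (fst x) else if i = 1 then Im (fst x)
                              else if i = 2 then snd x else 0)"

definition of_nsphere :: "(nat \<Rightarrow> real) \<Rightarrow> complex \<times> real"
  where "of_nsphere s = (Complex (s 0) (s 1), s 2)"

definition orientation_preserving :: "(complex \<times> real \<Rightarrow> complex \<times> real) \<Rightarrow> bool"
  where "orientation_preserving h \<longleftrightarrow> Brouwer_degree2 2 (to_nsphere \<circ> h \<circ> of_nsphere) = 1"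

text \<open>
  Complex conjugation of the projective line. It reverses orientation, and it is an equivariant orbit
  equivalence between any subgroup $G$ and $\overline{G}$ that does not lie in PSL(2,C); so an orbit
  equivalence can belong to PSL(2,C) only up to composition with it.
\<close>

definition conj_S2 :: "complex \<times> real \<Rightarrow> complex \<times> real"
  where "conj_S2 x = (cnj (fst x), snd x)"

end

theory Submission
  imports Defs
begin

text \<open>
  Everything rests on one formula: in the chordal metric a matrix of determinant 1 scales distances
  by $1/\sqrt{s(x)s(y)}$, where $s$ is the function \<open>stretch\<close> (lemma \<open>dist_moebius\<close>). So its
  derivative at $x$ is a similarity with factor $1/s(x)$, and elements of a dense subgroup control
  the stretching of all of SL(2,C) up to constants.

  Measures. Some element of the dense group is close to an isometry that moves the pole to a given
  point, and it distorts chordal distances and the measure by bounded factors. Hence caps of radius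
  $r$ have comparable measures at all centres, up to a fixed factor in the radius. Integrating
  $\mu(B(y,r))$ over $y$ with respect to area and exchanging the integrals turns this into
  $\mu(B(x,r)) \asymp r^2$ (\<open>cap_upper\<close>, \<open>cap_lower\<close>); the same exchange, localised to a
  closed set, bounds $\mu$ by a multiple of area (\<open>domination_closed\<close>), which is absolute
  continuity. An element that is close to the dilation of ratio $L$ maps a fixed cap onto a set that
  contains a cap and lies in a cap, both of radius $\asymp 1/L$, so the measure of the image is
  $\asymp L^{-2}$; by quasiconformality it is $\asymp L^{-d}$. Hence $d = 2$ (\<open>dimension\<close>).

  Orbit equivalences. For a fixed $g$ in the first group, the sphere is the union over $k$ in the
  second of the closed sets where $h \circ g = k \circ h$, and two of these sets meet in at most two
  points because distinct Moebius transformations agree at no more. A countable closed cover of the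
  sphere with finite overlaps has the whole sphere as one of its members
  (\<open>countable_closed_cover_finite_overlap\<close>, a variant of Sierpinski's theorem on continua). So
  every $g$ is conjugated into the second group, and $h$ is equivariant. By density $h$ normalises
  all of PSL(2,C), since an injective limit of Moebius transformations is one (\<open>moebius_limit\<close>).
  After normalising, $h$ fixes $\infty$, 0 and 1; translations and dilations go to such, so in the
  affine coordinate $h$ is a continuous field automorphism of the complex numbers: the identity or
  conjugation. The degree tells which of the two occurs, because Moebius transformations are
  homotopic to the identity and conjugation is a reflection up to a rotation.
\<close>

section \<open>Moebius transformations of the round sphere\<close>

text \<open>
  The numbers $(1 \pm t)/2$ and $z/2$ are the entries of the orthogonal projection onto the complex
  line that corresponds to $(z, t)$. Both formulas are rational in $(M, x)$; this makes joint
  continuity and differentiability evident, without local sections of the Hopf map.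
\<close>

definition stretch :: "complex^2^2 \<Rightarrow> complex \<times> real \<Rightarrow> real"
  where "stretch M x =
    ((cmod (M$1$1))\<^sup>2 + (cmod (M$2$1))\<^sup>2) * ((1 + snd x) / 2)
    + ((cmod (M$1$2))\<^sup>2 + (cmod (M$2$2))\<^sup>2) * ((1 - snd x) / 2)
    + Re ((M$1$1 * cnj (M$1$2) + M$2$1 * cnj (M$2$2)) * fst x)"

definition moebius_act :: "complex^2^2 \<Rightarrow> complex \<times> real \<Rightarrow> complex \<times> real"
  where "moebius_act M x =
    ((M$1$1 * cnj (M$2$1) * complex_of_real (1 + snd x) + M$1$2 * cnj (M$2$2) * complex_of_real (1 - snd x)
       + M$1$1 * cnj (M$2$2) * fst x + M$1$2 * cnj (M$2$1) * cnj (fst x)) / complex_of_real (stretch M x),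
     (((cmod (M$1$1))\<^sup>2 - (cmod (M$2$1))\<^sup>2) * ((1 + snd x) / 2)
       + ((cmod (M$1$2))\<^sup>2 - (cmod (M$2$2))\<^sup>2) * ((1 - snd x) / 2)
       + Re ((M$1$1 * cnj (M$1$2) - M$2$1 * cnj (M$2$2)) * fst x)) / stretch M x)"

lemma matvec2:
  fixes M :: "complex^2^2"
  shows "(M *v v)$1 = M$1$1 * v$1 + M$1$2 * v$2" "(M *v v)$2 = M$2$1 * v$1 + M$2$2 * v$2"
  by (simp_all add: matrix_vector_mult_def sum_2)

lemma hopf_coords:
  assumes "v \<noteq> 0"
  shows "(1 + snd (hopf v)) / 2 = (cmod (v$1))\<^sup>2 / (norm v)\<^sup>2"
    and "(1 - snd (hopf v)) / 2 = (cmod (v$2))\<^sup>2 / (norm v)\<^sup>2"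
    and "fst (hopf v) = 2 * (v$1 * cnj (v$2)) / complex_of_real ((norm v)\<^sup>2)"
proof -
  have n: "(norm v)\<^sup>2 > 0" using assms by simp
  then have "1 + snd (hopf v) = ((norm v)\<^sup>2 + ((cmod (v$1))\<^sup>2 - (cmod (v$2))\<^sup>2)) / (norm v)\<^sup>2"
       "1 - snd (hopf v) = ((norm v)\<^sup>2 - ((cmod (v$1))\<^sup>2 - (cmod (v$2))\<^sup>2)) / (norm v)\<^sup>2"
    by (simp_all add: hopf_def add_divide_distrib diff_divide_distrib)
  moreover have "(norm v)\<^sup>2 + ((cmod (v$1))\<^sup>2 - (cmod (v$2))\<^sup>2) = 2 * (cmod (v$1))\<^sup>2"
    "(norm v)\<^sup>2 - ((cmod (v$1))\<^sup>2 - (cmod (v$2))\<^sup>2) = 2 * (cmod (v$2))\<^sup>2"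
    by (simp_all add: norm_vec2_sq)
  ultimately show "(1 + snd (hopf v)) / 2 = (cmod (v$1))\<^sup>2 / (norm v)\<^sup>2"
    "(1 - snd (hopf v)) / 2 = (cmod (v$2))\<^sup>2 / (norm v)\<^sup>2"
    by simp_all
qed (simp add: hopf_def)

lemma cmod_add_sq: "(cmod (a + b))\<^sup>2 = (cmod a)\<^sup>2 + (cmod b)\<^sup>2 + 2 * Re (a * cnj b)"
  by (simp add: cmod_power2) (simp add: power2_eq_square algebra_simps)

lemma stretch_hopf:
  assumes "v \<noteq> 0"
  shows "stretch M (hopf v) = (norm (M *v v))\<^sup>2 / (norm v)\<^sup>2"
proof -
  have "Re ((M$1$1 * cnj (M$1$2) + M$2$1 * cnj (M$2$2)) * fst (hopf v))
     = 2 * Re ((M$1$1 * cnj (M$1$2) + M$2$1 * cnj (M$2$2)) * (v$1 * cnj (v$2))) / (norm v)\<^sup>2"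
    unfolding hopf_coords(3)[OF assms] times_divide_eq_right Re_divide_of_real by (simp add: algebra_simps)
  then have "stretch M (hopf v) = (((cmod (M$1$1))\<^sup>2 + (cmod (M$2$1))\<^sup>2) * (cmod (v$1))\<^sup>2
     + ((cmod (M$1$2))\<^sup>2 + (cmod (M$2$2))\<^sup>2) * (cmod (v$2))\<^sup>2
     + 2 * Re ((M$1$1 * cnj (M$1$2) + M$2$1 * cnj (M$2$2)) * (v$1 * cnj (v$2)))) / (norm v)\<^sup>2"
    unfolding stretch_def hopf_coords(1,2)[OF assms] by (simp add: add_divide_distrib)
  also have "\<dots> = (norm (M *v v))\<^sup>2 / (norm v)\<^sup>2"
    unfolding norm_vec2_sq[of "M *v v"] matvec2 cmod_add_sq
    by (simp add: norm_mult power_mult_distrib algebra_simps)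
  finally show ?thesis .
qed

lemma moebius_hopf:
  assumes "v \<noteq> 0" "M *v v \<noteq> 0"
  shows "moebius_act M (hopf v) = hopf (M *v v)"
proof -
  let ?n = "(norm v)\<^sup>2" and ?m = "(norm (M *v v))\<^sup>2"
  have n: "?n \<noteq> 0" "?m \<noteq> 0" "complex_of_real ?n \<noteq> 0" "complex_of_real ?m \<noteq> 0" using assms by auto
  have c1: "complex_of_real (1 + snd (hopf v)) = 2 * (v$1 * cnj (v$1)) / complex_of_real ?n"
    and c2: "complex_of_real (1 - snd (hopf v)) = 2 * (v$2 * cnj (v$2)) / complex_of_real ?n"
  proof -
    have "1 + snd (hopf v) = 2 * (cmod (v$1))\<^sup>2 / ?n" "1 - snd (hopf v) = 2 * (cmod (v$2))\<^sup>2 / ?n"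
      using hopf_coords(1,2)[OF assms(1)] by simp_all
    then show "complex_of_real (1 + snd (hopf v)) = 2 * (v$1 * cnj (v$1)) / complex_of_real ?n"
      "complex_of_real (1 - snd (hopf v)) = 2 * (v$2 * cnj (v$2)) / complex_of_real ?n"
      by (simp_all only: of_real_divide of_real_mult complex_norm_square of_real_numeral)
  qed
  have c4: "cnj (fst (hopf v)) = 2 * (v$2 * cnj (v$1)) / complex_of_real ?n"
    unfolding hopf_coords(3)[OF assms(1)] by (simp add: mult.commute)
  have "fst (moebius_act M (hopf v)) = (2 * (M *v v)$1 * cnj ((M *v v)$2) / complex_of_real ?n) / complex_of_real (?m / ?n)"
    unfolding moebius_act_def stretch_hopf[OF assms(1)] c1 c2 c4 fst_conv hopf_coords(3)[OF assms(1)] matvec2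
    by (simp add: add_divide_distrib algebra_simps)
  also have "\<dots> = fst (hopf (M *v v))"
    unfolding hopf_def fst_conv using n by simp
  finally have 1: "fst (moebius_act M (hopf v)) = fst (hopf (M *v v))" .
  have "Re ((M$1$1 * cnj (M$1$2) - M$2$1 * cnj (M$2$2)) * fst (hopf v))
     = 2 * Re ((M$1$1 * cnj (M$1$2) - M$2$1 * cnj (M$2$2)) * (v$1 * cnj (v$2))) / ?n"
    unfolding hopf_coords(3)[OF assms(1)] times_divide_eq_right Re_divide_of_real by (simp add: algebra_simps)
  then have "snd (moebius_act M (hopf v)) = ((((cmod (M$1$1))\<^sup>2 - (cmod (M$2$1))\<^sup>2) * (cmod (v$1))\<^sup>2
     + ((cmod (M$1$2))\<^sup>2 - (cmod (M$2$2))\<^sup>2) * (cmod (v$2))\<^sup>2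
     + 2 * Re ((M$1$1 * cnj (M$1$2) - M$2$1 * cnj (M$2$2)) * (v$1 * cnj (v$2)))) / ?n) / (?m / ?n)"
    unfolding moebius_act_def snd_conv stretch_hopf[OF assms(1)] hopf_coords(1,2)[OF assms(1)]
    by (simp add: add_divide_distrib)
  also have "\<dots> = (((cmod ((M *v v)$1))\<^sup>2 - (cmod ((M *v v)$2))\<^sup>2) / ?n) / (?m / ?n)"
    unfolding matvec2 cmod_add_sq
    by (simp add: norm_mult power_mult_distrib algebra_simps)
  also have "\<dots> = snd (hopf (M *v v))" using n by (simp add: hopf_def)
  finally show ?thesis using 1 by (simp add: prod_eq_iff)
qed

lemma det_nz_vec:
  fixes M :: "complex^2^2"
  assumes "det M \<noteq> 0" "v \<noteq> 0" shows "M *v v \<noteq> 0"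
proof
  assume "M *v v = 0"
  obtain B where "B ** M = mat 1" using assms(1) by (auto simp: invertible_det_nz[symmetric] invertible_def)
  then have "B *v (M *v v) = v" by (simp add: matrix_vector_mul_assoc)
  with \<open>M *v v = 0\<close> assms(2) show False by simp
qed

lemma stretch_pos:
  assumes "det M \<noteq> 0" "x \<in> S2" shows "0 < stretch M x"
proof -
  obtain v where "v \<noteq> 0" "hopf v = x" using hopf_surj assms by blast
  then show ?thesis using det_nz_vec[OF assms(1), of v] by (auto simp: stretch_hopf simp flip: zero_less_norm_iff)
qed

lemma moebius_in_S2:
  assumes "det M \<noteq> 0" "x \<in> S2" shows "moebius_act M x \<in> S2"
proof -
  obtain v where "v \<noteq> 0" "hopf v = x" using hopf_surj assms by blast
  then show ?thesis using det_nz_vec[OF assms(1), of v] hopf_in_S2 moebius_hopf by metis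
qed

lemma moebius_mult:
  assumes "det M \<noteq> 0" "det L \<noteq> 0" "x \<in> S2"
  shows "moebius_act (L ** M) x = moebius_act L (moebius_act M x)"
proof -
  obtain v where v: "v \<noteq> 0" "hopf v = x" using hopf_surj assms by blast
  have nz: "M *v v \<noteq> 0" "L *v (M *v v) \<noteq> 0"
    using v assms det_nz_vec by blast+
  then have "moebius_act (L ** M) (hopf v) = hopf (L *v (M *v v))"
    using v by (subst moebius_hopf) (simp_all add: matrix_vector_mul_assoc[symmetric])
  then show ?thesis
    using v nz by (auto simp: moebius_hopf)
qed

lemma moebius_one: "x \<in> S2 \<Longrightarrow> moebius_act (mat 1) x = x"
  using hopf_surj[of x] moebius_hopf[of _ "mat 1"] by (auto simp: matrix_vector_mul_lid)

lemma PSL_act_moebius: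
  assumes "det A = 1" "x \<in> S2" shows "PSL_act {A, - A} x = moebius_act A x"
proof -
  obtain v where v: "v \<noteq> 0" "hopf v = x" using hopf_surj assms by blast
  then show ?thesis
    using PSL_act_eq[OF assms] SL_act_hopf[OF assms(1) v(1)] moebius_hopf[OF v(1), of A] det_nz_vec[of A v] assms
    by simp
qed

definition area2 :: "complex^2 \<Rightarrow> complex^2 \<Rightarrow> complex"
  where "area2 v w = v$1 * w$2 - v$2 * w$1"

text \<open>
  The determinant of two vectors is what the linear action preserves, and \<open>dist_hopf\<close> below
  identifies it with the chordal distance up to the lengths of the vectors.
\<close>

lemma area2_matvec: "area2 (M *v v) (M *v w) = det M * area2 v w"
  by (simp add: area2_def matvec2 det_2 algebra_simps)

lemma dist_hopf:
  assumes "v \<noteq> 0" "w \<noteq> 0"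
  shows "(dist (hopf v) (hopf w))\<^sup>2 = 4 * (cmod (area2 v w))\<^sup>2 / ((norm v)\<^sup>2 * (norm w)\<^sup>2)"
proof -
  let ?n = "(norm v)\<^sup>2" and ?m = "(norm w)\<^sup>2"
  have n: "?n \<noteq> 0" "?m \<noteq> 0" using assms by auto
  have "hopf v \<bullet> hopf v = 1" "hopf w \<bullet> hopf w = 1"
    using hopf_in_S2[OF assms(1)] hopf_in_S2[OF assms(2)] by (simp_all add: norm_eq_sqrt_inner)
  then have d: "(dist (hopf v) (hopf w))\<^sup>2 = 2 - 2 * (hopf v \<bullet> hopf w)"
    by (simp add: dist_norm power2_norm_eq_inner inner_diff inner_commute)
  have "fst (hopf v) \<bullet> fst (hopf w) = (2 * (v$1 * cnj (v$2))) \<bullet> (2 * (w$1 * cnj (w$2))) / (?n * ?m)"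
  proof -
    have e: "z / complex_of_real r = z /\<^sub>R r" for z r by (simp add: scaleR_conv_of_real field_simps)
    show ?thesis
      unfolding hopf_coords(3)[OF assms(1)] hopf_coords(3)[OF assms(2)] e inner_scaleR_left inner_scaleR_right
      by (simp add: field_simps)
  qed
  moreover have "snd (hopf v) \<bullet> snd (hopf w) = ((cmod (v$1))\<^sup>2 - (cmod (v$2))\<^sup>2) * ((cmod (w$1))\<^sup>2 - (cmod (w$2))\<^sup>2) / (?n * ?m)"
    by (simp add: hopf_def)
  ultimately have ip: "hopf v \<bullet> hopf w = ((2 * (v$1 * cnj (v$2))) \<bullet> (2 * (w$1 * cnj (w$2))) 
      + ((cmod (v$1))\<^sup>2 - (cmod (v$2))\<^sup>2) * ((cmod (w$1))\<^sup>2 - (cmod (w$2))\<^sup>2)) / (?n * ?m)"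
    by (simp add: inner_prod_def add_divide_distrib)
  have "2 - 2 * (hopf v \<bullet> hopf w) = (2 * (?n * ?m) - 2 * ((2 * (v$1 * cnj (v$2))) \<bullet> (2 * (w$1 * cnj (w$2))) 
      + ((cmod (v$1))\<^sup>2 - (cmod (v$2))\<^sup>2) * ((cmod (w$1))\<^sup>2 - (cmod (w$2))\<^sup>2))) / (?n * ?m)"
    unfolding ip using n by (simp add: diff_divide_distrib)
  also have "2 * (?n * ?m) - 2 * ((2 * (v$1 * cnj (v$2))) \<bullet> (2 * (w$1 * cnj (w$2))) 
      + ((cmod (v$1))\<^sup>2 - (cmod (v$2))\<^sup>2) * ((cmod (w$1))\<^sup>2 - (cmod (w$2))\<^sup>2)) = 4 * (cmod (area2 v w))\<^sup>2"
    unfolding norm_vec2_sq area2_def inner_complex_def cmod_power2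
    by (simp add: power2_eq_square) (simp add: algebra_simps)
  finally show ?thesis using d by simp
qed

text \<open>
  The numerator in \<open>dist_hopf\<close> is invariant, and the two lengths change by the square roots of
  the stretches.
\<close>

lemma dist_moebius:
  assumes "det M = 1" "x \<in> S2" "y \<in> S2"
  shows "dist (moebius_act M x) (moebius_act M y) = dist x y / sqrt (stretch M x * stretch M y)"
proof -
  obtain v w where v: "v \<noteq> 0" "hopf v = x" "w \<noteq> 0" "hopf w = y" using hopf_surj assms by meson
  then have nz: "M *v v \<noteq> 0" "M *v w \<noteq> 0" using det_nz_vec[of M] assms by auto
  have "(dist (moebius_act M (hopf v)) (moebius_act M (hopf w)))\<^sup>2
      = (dist (hopf v) (hopf w))\<^sup>2 / (stretch M (hopf v) * stretch M (hopf w))"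
    using nz v(1,3) assms(1) by (simp add: moebius_hopf dist_hopf area2_matvec stretch_hopf)
  then have "sqrt ((dist (moebius_act M x) (moebius_act M y))\<^sup>2) = sqrt ((dist x y)\<^sup>2 / (stretch M x * stretch M y))"
    using v by simp
  then show ?thesis by (simp add: real_sqrt_divide)
qed

lemma continuous_stretch [continuous_intros]:
  assumes "continuous_on S f" "continuous_on S g"
  shows "continuous_on S (\<lambda>x. stretch (f x) (g x))"
  unfolding stretch_def using assms by (intro continuous_intros) auto

lemma continuous_moebius [continuous_intros]:
  assumes "continuous_on S f" "continuous_on S g" "\<And>x. x \<in> S \<Longrightarrow> stretch (f x) (g x) \<noteq> 0"
  shows "continuous_on S (\<lambda>x. moebius_act (f x) (g x))"
proof -
  have s: "continuous_on S (\<lambda>x. stretch (f x) (g x))" using assms by (intro continuous_intros)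
  show ?thesis
  unfolding moebius_act_def using assms s by (intro continuous_intros) auto
qed

lemma continuous_on_moebius_S2: "det M \<noteq> 0 \<Longrightarrow> continuous_on S2 (moebius_act M)"
  using continuous_moebius[of S2 "\<lambda>_. M" "\<lambda>x. x"] stretch_pos[of M]
  by (force intro: continuous_intros)

section \<open>The conformal derivative\<close>

text \<open>
  This lets the norm of a derivative be read off from distances alone.
\<close>

lemma has_vector_derivative_norm_quotient:
  assumes "(F has_vector_derivative D) (at 0)"
  shows "((\<lambda>h. norm (F h - F 0) / \<bar>h\<bar>) \<longlongrightarrow> norm D) (at 0)"
proof -
  have "((\<lambda>h. norm (F (0 + h) - F 0 - h *\<^sub>R D) / norm h) \<longlongrightarrow> 0) (at 0)"
    using assms unfolding has_vector_derivative_def has_derivative_at by blast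
  then have "((\<lambda>h. norm (F h - F 0) / \<bar>h\<bar> - norm D) \<longlongrightarrow> 0) (at 0)"
  proof (rule Lim_null_comparison[rotated])
    have "norm (norm (F h - F 0) / \<bar>h\<bar> - norm D) \<le> norm (F (0 + h) - F 0 - h *\<^sub>R D) / norm h"
      if "h \<noteq> 0" for h
    proof -
      have "norm (F h - F 0) / \<bar>h\<bar> - norm D = (norm (F h - F 0) - norm (h *\<^sub>R D)) / \<bar>h\<bar>"
        using that by (simp add: field_simps)
      then show ?thesis
        using norm_triangle_ineq3[of "F h - F 0" "h *\<^sub>R D"] that by (simp add: divide_right_mono)
    qed
    then show "\<forall>\<^sub>F h in at 0. norm (norm (F h - F 0) / \<bar>h\<bar> - norm D)
        \<le> norm (F (0 + h) - F 0 - h *\<^sub>R D) / norm h"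
      by (auto simp: eventually_at_filter)
  qed
  then show ?thesis by (simp add: LIM_zero_iff)
qed

lemma stretch_differentiable: "\<exists>s'. (stretch M has_derivative s') (at x)"
proof -
  have "(stretch M has_derivative (\<lambda>h.
    ((cmod (M$1$1))\<^sup>2 + (cmod (M$2$1))\<^sup>2) * (snd h / 2)
    + ((cmod (M$1$2))\<^sup>2 + (cmod (M$2$2))\<^sup>2) * (- snd h / 2)
    + Re ((M$1$1 * cnj (M$1$2) + M$2$1 * cnj (M$2$2)) * fst h))) (at x)"
    unfolding stretch_def[abs_def] by (auto intro!: derivative_eq_intros simp: mult.commute)
  then show ?thesis by blast
qed

lemma moebius_differentiable:
  assumes "stretch M x \<noteq> 0"
  shows "\<exists>s'. (moebius_act M has_derivative s') (at x)"
proof -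
  obtain s' where s: "(stretch M has_derivative s') (at x)" using stretch_differentiable by blast
  have c: "complex_of_real (stretch M x) \<noteq> 0" using assms by simp
  show ?thesis
    unfolding moebius_act_def[abs_def] by (rule exI) (rule derivative_intros s assms c numeral_neq_zero)+
qed

text \<open>
  A derivative within the sphere is determined only on tangent vectors. Along the great circle in
  direction $v$ the exact distance formula gives the difference quotients, whatever derivative the
  choice operator returns; differentiability of the rational formula guarantees that it returns one.
\<close>

lemma deriv_norm_PSL_act:
  assumes "det A = 1" "x \<in> S2"
  shows "deriv_norm (PSL_act {A, - A}) x = 1 / stretch A x"
proof -
  let ?f = "PSL_act {A, - A}"
  define f' where "f' = frechet_derivative ?f (at x within S2)"
  have pos: "0 < stretch A y" if "y \<in> S2" for y using stretch_pos that assms by simp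
  obtain s' where "(moebius_act A has_derivative s') (at x)"
    using moebius_differentiable pos[OF assms(2)] by (metis less_irrefl)
  then have "(moebius_act A has_derivative s') (at x within S2)" by (rule has_derivative_at_withinI)
  then have "(?f has_derivative s') (at x within S2)"
    by (rule has_derivative_transform[OF assms(2), rotated]) (simp add: PSL_act_moebius[OF assms(1)])
  then have f': "(?f has_derivative f') (at x within S2)"
    unfolding f'_def using frechet_derivative_works differentiable_def by blast
  have *: "norm (f' v) = 1 / stretch A x" if v: "v \<bullet> x = 0" "norm v = 1" for v
  proof -
    define c where "c s = cos s *\<^sub>R x + sin s *\<^sub>R v" for s :: real
    have x1: "x \<bullet> x = 1" "v \<bullet> v = 1" using assms(2) v by (simp_all add: norm_eq_1)
    have "c s \<bullet> c s = (cos s)\<^sup>2 + (sin s)\<^sup>2" for s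
      using v x1 by (simp add: c_def inner_add inner_commute power2_eq_square)
    then have cS: "c s \<in> S2" for s by (simp add: norm_eq_1)
    have c0: "c 0 = x" by (simp add: c_def)
    have dc: "(c has_vector_derivative v) (at 0)"
      unfolding c_def[abs_def] by (auto intro!: derivative_eq_intros simp: has_vector_derivative_def)
    have "(?f has_derivative f') (at (c 0) within c ` UNIV)"
      using f' cS c0 by (metis has_derivative_subset image_subsetI)
    then have "((?f \<circ> c) has_derivative (f' \<circ> (\<lambda>s. s *\<^sub>R v))) (at 0)"
      using dc unfolding has_vector_derivative_def by (rule diff_chain_within[rotated])
    moreover have "f' \<circ> (\<lambda>s. s *\<^sub>R v) = (\<lambda>s. s *\<^sub>R f' v)"
      using has_derivative_linear[OF f'] by (auto simp: linear_scale)
    ultimately have "((?f \<circ> c) has_vector_derivative f' v) (at 0)"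
      by (simp add: has_vector_derivative_def)
    from has_vector_derivative_norm_quotient[OF this]
    have 1: "((\<lambda>h. norm (?f (c h) - ?f x) / \<bar>h\<bar>) \<longlongrightarrow> norm (f' v)) (at 0)"
      by (simp add: c0)
    have e: "norm (?f (c h) - ?f x) / \<bar>h\<bar> = norm (c h - c 0) / \<bar>h\<bar> / sqrt (stretch A (c h) * stretch A x)" for h
      using dist_moebius[OF assms(1) cS[of h] assms(2)]
      unfolding PSL_act_moebius[OF assms(1) cS[of h]] PSL_act_moebius[OF assms] dist_norm c0 by simp
    have "isCont c 0" using dc by (metis has_vector_derivative_continuous)
    moreover have "continuous_on UNIV (stretch A)" by (intro continuous_intros)
    ultimately have "((\<lambda>h. stretch A (c h)) \<longlongrightarrow> stretch A x) (at 0)"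
      by (metis UNIV_I c0 continuous_on_eq_continuous_at isContD isCont_tendsto_compose open_UNIV)
    then have "((\<lambda>h. norm (?f (c h) - ?f x) / \<bar>h\<bar>) \<longlongrightarrow> norm v / sqrt (stretch A x * stretch A x)) (at 0)"
      unfolding e using pos[OF assms(2)]
      by (intro tendsto_intros has_vector_derivative_norm_quotient dc) auto
    from tendsto_unique[OF _ 1 this] show ?thesis using v pos[OF assms(2)] by simp
  qed
  have "\<exists>v. norm v = 1 \<and> v \<bullet> x = 0"
  proof -
    obtain y where y: "y \<noteq> 0" "orthogonal x y"
      using orthogonal_to_vector_exists[of x] by auto
    then have "norm (sgn y) = 1" "sgn y \<bullet> x = 0"
      by (simp_all add: norm_sgn sgn_div_norm orthogonal_def inner_commute)
    then show ?thesis by blast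
  qed
  then have "{v. v \<bullet> x = 0 \<and> norm v = 1} \<noteq> {}" by blast
  then have "(SUP v\<in>{v. v \<bullet> x = 0 \<and> norm v = 1}. norm (f' v)) = 1 / stretch A x"
    using * by (subst SUP_cong[OF refl, where D = "\<lambda>_. 1 / stretch A x"]) auto
  then show ?thesis by (simp add: deriv_norm_def f'_def)
qed

section \<open>Approximation by a dense subgroup\<close>

lemma dense_subgroup_meets_open:
  assumes G: "dense_subgroup G" and "open W" "A \<in> W" "det A = 1"
  shows "\<exists>B\<in>W. det B = 1 \<and> {B, - B} \<in> G"
proof -
  define U where "U = {{B, - B} |B. B \<in> W \<and> det B = 1}"
  have q: "{mat 1, - mat 1} #>\<^bsub>SL2C\<^esub> B = {B, - B}" for B
    by (auto simp: r_coset_def SL2C_def mat2_minus_mult)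
  have "{B \<in> carrier SL2C. {mat 1, - mat 1} #>\<^bsub>SL2C\<^esub> B \<in> U} = carrier SL2C \<inter> (W \<union> uminus ` W)"
    unfolding q by (auto simp: U_def SL2C_def doubleton_eq_iff det2_minus)
  moreover have "open (W \<union> uminus ` W)" using assms(2) by (intro open_Un open_negations)
  ultimately have "openin PSL2C_topology U"
    unfolding openin_PSL2C_topology
    by (auto simp: U_def carrier_PSL2C) 
  moreover have "{A, - A} \<in> U" using assms by (auto simp: U_def)
  moreover have "{A, - A} \<in> Abstract_Topology.closure_of PSL2C_topology G"
    using G assms(4) by (auto simp: dense_subgroup_def carrier_PSL2C)
  ultimately obtain g where "g \<in> G" "g \<in> U" by (auto simp: in_closure_of)
  then show ?thesis by (auto simp: U_def)
qed

text \<open>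
  By compactness (the tube lemma) strict bounds on the stretch are open conditions on the matrix.
\<close>

lemma dense_subgroup_approx:
  assumes G: "dense_subgroup G" and "det A = 1"
    and K: "compact K" "\<And>x. x \<in> K \<Longrightarrow> a < stretch A x"
    and b: "\<And>x. x \<in> S2 \<Longrightarrow> stretch A x < b"
    and p: "p \<in> S2" "0 < e"
  shows "\<exists>B. det B = 1 \<and> {B, - B} \<in> G \<and> (\<forall>x\<in>K. a < stretch B x) \<and> (\<forall>x\<in>S2. stretch B x < b)
     \<and> dist (moebius_act B p) (moebius_act A p) < e"
proof -
  have c: "continuous_on UNIV (\<lambda>z. stretch (fst z) (snd z))" by (intro continuous_intros)
  have o1: "open {z. a < stretch (fst z) (snd z)}" by (intro open_Collect_less c continuous_intros)
  have o2: "open {z. stretch (fst z) (snd z) < b}" by (intro open_Collect_less c continuous_intros)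
  have tube: "\<exists>W. open W \<and> A \<in> W \<and> W \<times> C \<subseteq> O'"
    if "open O'" "compact C" "{A} \<times> C \<subseteq> O'" for C and O' :: "((complex^2^2) \<times> (complex \<times> real)) set"
    using tube_lemma_right[of euclidean euclidean O' C A] that
    by (simp add: prod_topology_euclidean) (meson Sigma_mono order_refl order_trans)
  obtain W1 where W1: "open W1" "A \<in> W1" "W1 \<times> K \<subseteq> {z. a < stretch (fst z) (snd z)}"
  proof -
    have "{A} \<times> K \<subseteq> {z. a < stretch (fst z) (snd z)}" using K(2) by auto
    from tube[OF o1 K(1) this] show ?thesis using that by meson
  qed
  obtain W2 where W2: "open W2" "A \<in> W2" "W2 \<times> S2 \<subseteq> {z. stretch (fst z) (snd z) < b}"
  proof -
    have "{A} \<times> S2 \<subseteq> {z. stretch (fst z) (snd z) < b}" using b by auto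
    from tube[OF o2 compact_sphere this] show ?thesis using that by meson
  qed
  let ?P = "{M. 0 < stretch M p}"
  have oP: "open ?P" by (intro open_Collect_less continuous_intros)
  have "continuous_on ?P (\<lambda>M. dist (moebius_act M p) (moebius_act A p))"
    by (intro continuous_intros) auto
  then have o3: "open (?P \<inter> (\<lambda>M. dist (moebius_act M p) (moebius_act A p)) -` {..<e})" (is "open ?W3")
    using oP by (rule continuous_open_preimage) simp
  have "A \<in> ?W3" using p stretch_pos[of A p] assms(2) by simp
  with W1 W2 o3 have "open (W1 \<inter> W2 \<inter> ?W3)" "A \<in> W1 \<inter> W2 \<inter> ?W3" by auto
  from dense_subgroup_meets_open[OF G this assms(2)]
  obtain B where B: "B \<in> W1" "B \<in> W2" "B \<in> ?W3" "det B = 1" "{B, - B} \<in> G" by blast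
  have "(B, x) \<in> W1 \<times> K" if "x \<in> K" for x using that B by simp
  then have "\<forall>x\<in>K. a < stretch B x" using W1(3) by fastforce
  moreover have "(B, x) \<in> W2 \<times> S2" if "x \<in> S2" for x using that B by simp
  then have "\<forall>x\<in>S2. stretch B x < b" using W2(3) by fastforce
  ultimately show ?thesis using B by auto
qed

section \<open>Countable closed covers of the sphere\<close>

text \<open>
  By Baire's theorem, applied to the closed set \<open>F\<close> of points in no interior of a
  member, some \<open>E i\<close> contains a relatively open piece of \<open>F\<close>. Next to such a piece, a
  component of the complement of \<open>F\<close> belongs to a single \<open>E j\<close>, and its boundary lies in
  \<open>E i\<close> and \<open>E j\<close>. So either \<open>i = j\<close>, or that boundary is finite and cannot
  separate; in both cases a whole neighbourhood lies in one member, contrary to the choice of \<open>F\<close>.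
  The hypothesis \<open>loc\<close> holds in manifolds of dimension at least 2 and fails for curves.
\<close>

lemma countable_closed_cover_finite_overlap:
  fixes X :: "'a::euclidean_space set"
  assumes "closed X" "connected X" "X \<noteq> {}"
    and inf: "\<And>U. openin (top_of_set X) U \<Longrightarrow> U \<noteq> {} \<Longrightarrow> infinite U"
    and loc: "\<And>x e. x \<in> X \<Longrightarrow> 0 < e \<Longrightarrow>
      \<exists>V. openin (top_of_set X) V \<and> x \<in> V \<and> V \<subseteq> ball x e \<and> (\<forall>P. finite P \<longrightarrow> connected (V - P))"
    and I: "countable I" "\<And>i. i \<in> I \<Longrightarrow> closed (E i)" "\<And>i. i \<in> I \<Longrightarrow> E i \<subseteq> X" "X \<subseteq> (\<Union>i\<in>I. E i)"
    and fin: "\<And>i j. i \<in> I \<Longrightarrow> j \<in> I \<Longrightarrow> i \<noteq> j \<Longrightarrow> finite (E i \<inter> E j)"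
  shows "\<exists>i\<in>I. X = E i"
proof -
  define U where "U i = \<Union>{V. openin (top_of_set X) V \<and> V \<subseteq> E i}" for i
  have Uo: "openin (top_of_set X) (U i)" and UE: "U i \<subseteq> E i" for i
    unfolding U_def by auto
  have Umax: "V \<subseteq> U i" if "openin (top_of_set X) V" "V \<subseteq> E i" for V i
    unfolding U_def using that by auto
  have disj: "U i \<inter> U j = {}" if "i \<in> I" "j \<in> I" "i \<noteq> j" for i j
    using inf[OF openin_Int[OF Uo Uo], of i j] fin[OF that] UE[of i] UE[of j]
    by (meson Int_mono finite_subset)
  define F where "F = X - (\<Union>i\<in>I. U i)"
  have "openin (top_of_set X) (\<Union>i\<in>I. U i)" using Uo by blast
  then have clF: "closed F"
    unfolding F_def using \<open>closed X\<close> by (metis closedin_closed_trans closedin_diff closedin_topspace topspace_euclidean_subtopology)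
  have "F = {}"
  proof (rule ccontr)
    assume "F \<noteq> {}"
    have "\<exists>i\<in>I. \<not> F \<subseteq> closure (F - E i)"
    proof (rule ccontr)
      assume "\<not> ?thesis"
      then have a: "F \<subseteq> closure (F - E i)" if "i \<in> I" for i using that by blast
      have o: "openin (top_of_set F) (F - E i)" if "i \<in> I" for i
        using openin_open_Int[OF open_Compl[OF I(2)[OF that]], of F] by (simp add: Diff_eq)
      have c: "countable ((\<lambda>i. F - E i) ` I)" using I(1) by simp
      have d: "openin (top_of_set F) T \<and> F \<subseteq> closure T" if T: "T \<in> (\<lambda>i. F - E i) ` I" for T
        using T
      proof (rule imageE)
        fix i assume "T = F - E i" "i \<in> I"
        then show ?thesis using o[of i] a[of i] by simp
      qed
      have "F \<subseteq> closure (\<Inter> ((\<lambda>i. F - E i) ` I))"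
        by (rule Baire[OF clF c d])
      moreover have "\<Inter> ((\<lambda>i. F - E i) ` I) = {}"
      proof -
        have "x \<notin> \<Inter> ((\<lambda>i. F - E i) ` I)" for x
        proof (cases "x \<in> F")
          case True
          then obtain i where "i \<in> I" "x \<in> E i" using I(4) by (auto simp: F_def)
          then show ?thesis by blast
        next
          case False
          have "I \<noteq> {}" using I(4) assms(3) by auto
          then show ?thesis using False by blast
        qed
        then show ?thesis by blast
      qed
      ultimately show False using \<open>F \<noteq> {}\<close> by simp
    qed
    then obtain i x where i: "i \<in> I" "x \<in> F" "x \<notin> closure (F - E i)" by blast
    then obtain e where e: "e > 0" "ball x e \<inter> (F - E i) = {}"
    proof -
      have "open (- closure (F - E i))" "x \<in> - closure (F - E i)" using i by auto
      then obtain e where "e > 0" "ball x e \<subseteq> - closure (F - E i)" by (meson open_contains_ball)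
      then show ?thesis using that[of e] closure_subset[of "F - E i"] by blast
    qed
    have "x \<in> X" using i F_def by blast
    then obtain V where V: "openin (top_of_set X) V" "x \<in> V" "V \<subseteq> ball x e"
        and con: "\<And>P. finite P \<Longrightarrow> connected (V - P)"
      using loc e(1) by metis
    have VX: "V \<subseteq> X" using V(1) openin_imp_subset by blast
    have "V \<subseteq> E i"
    proof
      fix y assume y: "y \<in> V"
      show "y \<in> E i"
      proof (cases "y \<in> F")
        case True then show ?thesis using e V y by blast
      next
        case False
        then obtain j where j: "j \<in> I" "y \<in> U j" using y VX F_def by blast
        show ?thesis
        proof (cases "j = i")
          case True then show ?thesis using j UE by blast
        next
          case neq: False
          \<comment> \<open>the part of the neighbourhood that is known to lie in the other member, with its boundary in the neighbourhood\<close>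
          define W where "W = V \<inter> U j"
          define P where "P = V \<inter> closure W - W"
          have Wo: "openin (top_of_set X) W" unfolding W_def using V(1) Uo by blast
          have clE: "closure W \<subseteq> E j"
            using UE[of j] I(2)[OF j(1)] by (metis W_def closure_minimal inf.coboundedI2)
          have "P \<subseteq> E i \<inter> E j"
          proof
            fix p assume p: "p \<in> P"
            then have pj: "p \<in> E j" using clE P_def by blast
            moreover have "p \<in> F"
            proof (rule ccontr)
              assume "p \<notin> F"
              then obtain k where k: "k \<in> I" "p \<in> U k" using p P_def VX F_def by blast
              have "k \<noteq> j" using k p by (auto simp: P_def W_def)
              obtain T where T: "open T" "U k = X \<inter> T" using Uo openin_open by metis
              then have "T \<inter> W \<noteq> {}"
                using p k by (metis DiffD1 IntD2 P_def disjoint_iff open_Int_closure_eq_empty)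
              then have "U k \<inter> U j \<noteq> {}" using T VX W_def by blast
              then show False using disj k j \<open>k \<noteq> j\<close> by blast
            qed
            ultimately show "p \<in> E i \<inter> E j" using e V p P_def by blast
          qed
          then have fP: "finite P" using fin[OF i(1) j(1)] neq finite_subset by blast
          have "W \<subseteq> V - P" by (auto simp: W_def P_def)
          have 1: "openin (top_of_set (V - P)) W"
            by (rule openin_subset_trans[OF Wo \<open>W \<subseteq> V - P\<close>]) (use VX in blast)
          have 2: "closedin (top_of_set (V - P)) W"
          proof -
            have "W = (V - P) \<inter> closure W"
              using closure_subset[of W] by (auto simp: W_def P_def)
            then show ?thesis by (metis closed_closure closedin_closed_Int)
          qed
          have "W \<noteq> {}" using y j W_def by blast
          then have "W = V - P" using con[OF fP] 1 2 connected_clopen by blast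
          then have "V \<subseteq> E j" using clE closure_subset[of W] P_def by blast
          then have "x \<in> U j" using Umax V by blast
          then show ?thesis using i j F_def by blast
        qed
      qed
    qed
    then have "x \<in> U i" using Umax V by blast
    then show False using i F_def by blast
  qed
  then have XU: "X = (\<Union>i\<in>I. U i)" using Uo F_def openin_imp_subset by blast
  then obtain i where i: "i \<in> I" "U i \<noteq> {}" using assms(3) by blast
  have "X - U i = (\<Union>j\<in>I-{i}. U j)" using XU disj i by blast
  then have "openin (top_of_set X) (X - U i)" using Uo by auto
  then have "closedin (top_of_set X) (U i)"
    using Uo[of i] openin_imp_subset by (fastforce simp: closedin_def)
  then have "U i = X" using assms(2) Uo[of i] i connected_clopen by blast
  then show ?thesis using i UE I by blast
qed

lemma punctured_S2_homeomorphic_plane: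
  assumes "p \<in> S2" shows "(S2 - {p}) homeomorphic (UNIV :: complex set)"
proof -
  define T :: "(complex \<times> real) set" where "T = UNIV \<times> {0}"
  have "affine T" unfolding T_def affine_def by auto
  have "T = (\<lambda>z. (z, 0)) ` UNIV" by (auto simp: T_def)
  then have "aff_dim T = aff_dim (UNIV :: complex set)"
    using aff_dim_injective_linear_image[of "\<lambda>z. (z, 0) :: complex \<times> real" UNIV]
    by (simp add: linear_iff inj_def)
  then have d: "aff_dim T = 2" by simp
  have "(S2 - {p}) homeomorphic T"
    by (rule homeomorphic_punctured_sphere_affine) (use assms d \<open>affine T\<close> in auto)
  moreover have "T homeomorphic (UNIV :: complex set)"
    using homeomorphic_affine_sets[OF \<open>affine T\<close>, of "UNIV :: complex set"] d by simp
  ultimately show ?thesis using homeomorphic_trans by blast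
qed

lemma S2_local_connectedness:
  assumes "x \<in> S2" "0 < e"
  shows "\<exists>V. openin (top_of_set S2) V \<and> x \<in> V \<and> V \<subseteq> ball x e \<and> (\<forall>P. finite P \<longrightarrow> connected (V - P))"
proof -
  define p where "p = - x"
  have p: "p \<in> S2" "p \<noteq> x"
  proof -
    show "p \<in> S2" using assms by (simp add: p_def)
    show "p \<noteq> x"
    proof
      assume "p = x"
      then have "x + x = - x + x" by (simp add: p_def)
      then have "2 *\<^sub>R x = 0" by (simp add: scaleR_2)
      then show False using assms by simp
    qed
  qed
  obtain f g where fg: "homeomorphism (S2 - {p}) (UNIV :: complex set) f g"
    using punctured_S2_homeomorphic_plane[OF p(1)] by (auto simp: homeomorphic_def)
  have xp: "x \<in> S2 - {p}" using p assms by auto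
  have "continuous_on UNIV g" using fg by (simp add: homeomorphism_def)
  then have "open (g -` ball x e)" by (simp add: open_vimage)
  moreover have gf: "g (f x) = x" using fg xp by (simp add: homeomorphism_def)
  ultimately obtain d where d: "d > 0" "ball (f x) d \<subseteq> g -` ball x e"
    using assms by (metis centre_in_ball open_contains_ball vimage_eq)
  define V where "V = g ` ball (f x) d"
  have "openin (top_of_set (S2 - {p})) V"
    unfolding V_def
    by (rule homeomorphism_imp_open_map[OF homeomorphism_symD[OF fg]]) simp
  moreover have "openin (top_of_set S2) (S2 - {p})" by (auto simp: openin_open Diff_eq)
  ultimately have "openin (top_of_set S2) V" using openin_trans by blast
  moreover have "x \<in> V" unfolding V_def using d gf by (metis centre_in_ball imageI)
  moreover have "V \<subseteq> ball x e" using d V_def by auto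
  moreover have "connected (V - P)" if "finite P" for P
  proof -
    have "V - P = g ` (ball (f x) d - f ` (P \<inter> (S2 - {p})))"
    proof -
      have 1: "f (g u) = u" "g u \<in> S2 - {p}" for u
        using fg unfolding homeomorphism_def by (simp, blast)
      have 2: "g (f q) = q" if "q \<in> S2 - {p}" for q using fg that by (simp add: homeomorphism_def)
      have "g u \<in> P \<longleftrightarrow> u \<in> f ` (P \<inter> (S2 - {p}))" for u
      proof
        assume "g u \<in> P"
        then show "u \<in> f ` (P \<inter> (S2 - {p}))"
          by (intro image_eqI[of _ _ "g u"] IntI) (simp add: 1(1), assumption, rule 1(2))
      next
        assume "u \<in> f ` (P \<inter> (S2 - {p}))"
        then obtain q where "u = f q" "q \<in> P" "q \<in> S2 - {p}" by blast
        then show "g u \<in> P" using 2 by simp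
      qed
      then show ?thesis unfolding V_def by blast
    qed
    moreover have "connected (ball (f x) d - f ` (P \<inter> (S2 - {p})))"
      using that by (intro connected_open_diff_countable) (auto intro: countable_finite)
    ultimately show ?thesis
      using \<open>continuous_on UNIV g\<close> connected_continuous_image continuous_on_subset by (metis subset_UNIV)
  qed
  ultimately show ?thesis by blast
qed

lemma connected_S2: "connected S2"
  by (rule connected_sphere) simp

lemma openin_S2_infinite:
  assumes "openin (top_of_set S2) U" "U \<noteq> {}" shows "infinite U"
proof
  assume f: "finite U"
  obtain x where x: "x \<in> U" using assms by blast
  have xS: "x \<in> S2" using assms x openin_imp_subset by blast
  have "\<nexists>a. S2 = {a}"
  proof
    assume "\<exists>a. S2 = {a}"
    then obtain a where a: "S2 = {a}" by blast
    moreover have "(0, 1) \<in> S2" "(0, -1) \<in> S2" by (simp_all add: norm_prod_def)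
    ultimately have "((0::complex), 1::real) = (0, -1)" by (metis singletonD)
    then show False by simp
  qed
  then have "x islimpt S2" using connected_imp_perfect[OF connected_S2 xS] by blast
  moreover obtain T where T: "open T" "U = S2 \<inter> T" using assms(1) openin_open by metis
  ultimately have "infinite (S2 \<inter> T)"
    using x by (metis IntD2 Int_commute islimpt_eq_acc_point)
  then show False using f T by simp
qed

section \<open>The affine chart and coincidences of Moebius transformations\<close>

definition chart :: "complex \<Rightarrow> complex \<times> real"
  where "chart z = hopf (vector [z, 1])"

lemma vector2_nth [simp]: "(vector [a, b] :: complex^2) $ 1 = a" "(vector [a, b] :: complex^2) $ 2 = b"
  by simp_all

lemma vector2_nz: "b \<noteq> 0 \<Longrightarrow> (vector [a, b] :: complex^2) \<noteq> 0"
  "a \<noteq> 0 \<Longrightarrow> (vector [a, b] :: complex^2) \<noteq> 0"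
  by (metis vector2_nth(2) zero_index) (metis vector2_nth(1) zero_index)

lemma chart_in_S2: "chart z \<in> S2"
  unfolding chart_def by (rule hopf_in_S2) (simp add: vector2_nz)

lemma pole_in_S2: "(0, 1) \<in> S2"
  by (simp add: norm_prod_def)

lemma hopf_pole: "v $ 2 = 0 \<Longrightarrow> v \<noteq> 0 \<Longrightarrow> hopf v = (0, 1)"
  by (auto simp: hopf_def norm_vec2_sq vec_eq_iff forall_2)

lemma hopf_chart: "v $ 2 \<noteq> 0 \<Longrightarrow> hopf v = chart (v $ 1 / v $ 2)"
proof -
  assume v: "v $ 2 \<noteq> 0"
  then have "v = v $ 2 *s vector [v $ 1 / v $ 2, 1]"
    by (simp add: vec_eq_iff forall_2)
  then show ?thesis using hopf_scale[OF v] by (metis chart_def)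
qed

lemma chart_explicit:
  "chart z = (2 * z / complex_of_real ((cmod z)\<^sup>2 + 1), ((cmod z)\<^sup>2 - 1) / ((cmod z)\<^sup>2 + 1))"
  by (simp add: chart_def hopf_def norm_vec2_sq)

definition unchart :: "complex \<times> real \<Rightarrow> complex"
  where "unchart x = fst x / complex_of_real (1 - snd x)"

lemma unchart_chart [simp]: "unchart (chart z) = z"
proof -
  have n: "(cmod z)\<^sup>2 + 1 \<noteq> 0" by (metis add_nonneg_eq_0_iff zero_le_power2 zero_le_one zero_neq_one)
  then have c: "complex_of_real ((cmod z)\<^sup>2 + 1) \<noteq> 0" by (simp only: of_real_eq_0_iff not_False_eq_True)
  have "1 - snd (chart z) = 2 / ((cmod z)\<^sup>2 + 1)" using n by (simp add: chart_explicit field_simps)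
  then have "unchart (chart z) = (2 * z / complex_of_real ((cmod z)\<^sup>2 + 1)) / (2 / complex_of_real ((cmod z)\<^sup>2 + 1))"
    unfolding unchart_def by (simp only:) (simp add: chart_explicit)
  also have "\<dots> = z" using c by (simp del: of_real_add)
  finally show ?thesis .
qed

lemma inj_chart: "chart z = chart w \<longleftrightarrow> z = w"
  by (metis unchart_chart)

lemma chart_neq_pole: "chart z \<noteq> (0, 1)"
proof
  assume "chart z = (0, 1)"
  then have "(cmod z)\<^sup>2 - 1 = (cmod z)\<^sup>2 + 1"
    by (auto simp: chart_explicit divide_eq_eq split: if_splits)
  then show False by simp
qed

lemma S2_cases:
  assumes "x \<in> S2" obtains "x = (0, 1)" | z where "x = chart z"
proof -
  obtain v where "v \<noteq> 0" "hopf v = x" using hopf_surj assms by blast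
  then show thesis using that hopf_pole hopf_chart by metis
qed

lemma infinite_S2_chart:
  assumes "infinite X" "X \<subseteq> S2" shows "infinite {z. chart z \<in> X}"
proof
  assume "finite {z. chart z \<in> X}"
  moreover have "X \<subseteq> insert (0, 1) (chart ` {z. chart z \<in> X})"
    using assms(2) S2_cases by blast
  ultimately show False using assms(1) finite_subset by blast
qed

lemma infinite_S2: "infinite S2"
  by (rule openin_S2_infinite) (use chart_in_S2 in auto)

text \<open>
  In the affine coordinate the fixed points are the roots of a quadratic polynomial, which must
  vanish identically.
\<close>

lemma infinite_fixed_points:
  assumes "det C = 1" "infinite {x \<in> S2. moebius_act C x = x}"
  shows "C = mat 1 \<or> C = - mat 1"
proof -
  let ?a = "C$1$1" and ?b = "C$1$2" and ?c = "C$2$1" and ?d = "C$2$2"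
  define p where "p = [:?b, ?a - ?d, - ?c:]"
  have "poly p z = 0" if "moebius_act C (chart z) = chart z" for z
  proof -
    let ?w = "vector [z, 1] :: complex^2"
    have w: "?w \<noteq> 0" by (simp add: vector2_nz)
    then have cw: "C *v ?w \<noteq> 0" using assms(1) det_nz_vec by auto
    have "hopf ?w = hopf (C *v ?w)"
      using that moebius_hopf[OF w cw] by (simp add: chart_def)
    then obtain k where "C *v ?w = k *s ?w" using hopf_eq_iff[OF w cw] by blast
    then have "(C *v ?w)$1 = k * z" "(C *v ?w)$2 = k" by simp_all
    then have "?a * z + ?b = (?c * z + ?d) * z" by (simp add: matvec2)
    then show ?thesis by (simp add: p_def algebra_simps)
  qed
  then have "{z. chart z \<in> {x \<in> S2. moebius_act C x = x}} \<subseteq> {z. poly p z = 0}" by auto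
  moreover have "infinite {z. chart z \<in> {x \<in> S2. moebius_act C x = x}}"
    by (rule infinite_S2_chart[OF assms(2)]) blast
  ultimately have "infinite {z. poly p z = 0}" by (meson finite_subset)
  then have "p = 0" using poly_roots_finite by blast
  then have z: "?b = 0" "?a = ?d" "?c = 0" by (auto simp: p_def)
  then have "?a * ?a = 1" using assms(1) by (simp add: det_2)
  then have "?a = 1 \<or> ?a = -1" by (simp add: square_eq_1_iff)
  then show ?thesis using z by (auto simp: vec_eq_iff forall_2 mat_def)
qed

lemma det_one_inverse:
  fixes A :: "complex^2^2"
  assumes "det A = 1"
  obtains B where "det B = 1" "A ** B = mat 1" "B ** A = mat 1"
proof -
  have "invertible A" using assms by (simp add: invertible_det_nz)
  then obtain B where B: "A ** B = mat 1" "B ** A = mat 1" by (auto simp: invertible_def)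
  then have "det A * det B = 1" by (metis det_I det_mul)
  then show thesis using that B assms by simp
qed

lemma moebius_inverse:
  fixes A :: "complex^2^2"
  assumes "det A = 1"
  obtains B where "det B = 1" "\<And>x. x \<in> S2 \<Longrightarrow> moebius_act B (moebius_act A x) = x"
    "\<And>x. x \<in> S2 \<Longrightarrow> moebius_act A (moebius_act B x) = x"
proof -
  obtain B where B: "det B = 1" "A ** B = mat 1" "B ** A = mat 1" using det_one_inverse assms .
  then show thesis
    using that[of B] assms moebius_mult[of A B] moebius_mult[of B A] moebius_one by simp
qed

lemma moebius_inj_on_S2: "det A = 1 \<Longrightarrow> inj_on (moebius_act A) S2"
  by (metis moebius_inverse inj_on_inverseI)

lemma infinite_coincidence:
  assumes "det A = 1" "det B = 1" "infinite {x \<in> S2. moebius_act A x = moebius_act B x}"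
  shows "{A, - A} = {B, - B}"
proof -
  obtain L where L: "det L = 1" "B ** L = mat 1" "L ** B = mat 1" using det_one_inverse assms(2) .
  have "moebius_act (L ** A) x = x" if "x \<in> S2" "moebius_act A x = moebius_act B x" for x
    using that L assms moebius_mult[of A L x] moebius_mult[of B L x] by (simp add: moebius_one)
  then have "{x \<in> S2. moebius_act A x = moebius_act B x} \<subseteq> {x \<in> S2. moebius_act (L ** A) x = x}" by auto
  then have "infinite {x \<in> S2. moebius_act (L ** A) x = x}" using assms(3) finite_subset by blast
  then have "L ** A = mat 1 \<or> L ** A = - mat 1"
    using infinite_fixed_points[of "L ** A"] L assms by (simp add: det_mul)
  then have "B ** (L ** A) = B \<or> B ** (L ** A) = - B" by (auto simp: mat2_minus_mult)
  then have "A = B \<or> A = - B" using L by (simp add: matrix_mul_assoc)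
  then show ?thesis by auto
qed

lemma PSL_mult: "{A, - A} \<otimes>\<^bsub>PSL2C\<^esub> {B, - B} = {A ** B, - (A ** B)}"
  by (auto simp: PSL2C_def FactGroup_def set_mult_def SL2C_def mat2_minus_mult)

lemma PSL_elem:
  assumes "g \<in> carrier PSL2C" obtains A where "det A = 1" "g = {A, - A}"
  using assms by (auto simp: carrier_PSL2C)

lemma PSL_act_in_S2: "g \<in> carrier PSL2C \<Longrightarrow> x \<in> S2 \<Longrightarrow> PSL_act g x \<in> S2"
  by (metis PSL_elem PSL_act_moebius moebius_in_S2 zero_neq_one)

lemma PSL_act_mult:
  assumes "g \<in> carrier PSL2C" "k \<in> carrier PSL2C" "x \<in> S2"
  shows "PSL_act (g \<otimes>\<^bsub>PSL2C\<^esub> k) x = PSL_act g (PSL_act k x)"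
proof -
  obtain A B where "det A = 1" "g = {A, - A}" "det B = 1" "k = {B, - B}" using PSL_elem assms by metis
  then show ?thesis
    using assms(3) moebius_in_S2[of B x]
    by (simp only: PSL_mult) (simp add: PSL_act_moebius det_mul moebius_mult)
qed

lemma PSL_act_one: "x \<in> S2 \<Longrightarrow> PSL_act \<one>\<^bsub>PSL2C\<^esub> x = x"
  using PSL_act_moebius[of "mat 1" x] moebius_one[of x]
  by (simp add: PSL2C_def FactGroup_def)

lemma PSL_act_inv:
  assumes "g \<in> carrier PSL2C" "x \<in> S2"
  shows "PSL_act (inv\<^bsub>PSL2C\<^esub> g) (PSL_act g x) = x"
    and "PSL_act g (PSL_act (inv\<^bsub>PSL2C\<^esub> g) x) = x"
  using assms group_PSL2C
  by (simp_all add: PSL_act_mult[symmetric] PSL_act_one group.l_inv group.r_inv)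

lemma continuous_on_PSL_act: "g \<in> carrier PSL2C \<Longrightarrow> continuous_on S2 (PSL_act g)"
  by (metis (full_types) PSL_act_moebius PSL_elem continuous_on_cong continuous_on_moebius_S2 zero_neq_one)

lemma PSL_infinite_coincidence:
  assumes "g \<in> carrier PSL2C" "k \<in> carrier PSL2C" "infinite {x \<in> S2. PSL_act g x = PSL_act k x}"
  shows "g = k"
proof -
  obtain A B where AB: "det A = 1" "g = {A, - A}" "det B = 1" "k = {B, - B}" using PSL_elem assms by metis
  have "{x \<in> S2. PSL_act g x = PSL_act k x} = {x \<in> S2. moebius_act A x = moebius_act B x}"
    unfolding AB using AB by (auto simp: PSL_act_moebius)
  then show ?thesis using infinite_coincidence[of A B] AB assms by simp
qed

lemma PSL_act_faithful:
  assumes "g \<in> carrier PSL2C" "k \<in> carrier PSL2C" "\<And>x. x \<in> S2 \<Longrightarrow> PSL_act g x = PSL_act k x"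
  shows "g = k"
proof -
  have "{x \<in> S2. PSL_act g x = PSL_act k x} = S2" using assms by auto
  then show ?thesis using PSL_infinite_coincidence[OF assms(1,2)] infinite_S2 by simp
qed

section \<open>Orbit equivalences conjugate the actions\<close>

lemma orbit_PSL: "orbit (PSL2C\<lparr>carrier := G\<rparr>) PSL_act x = (\<lambda>g. PSL_act g x) ` G"
  by (auto simp: orbit_def)

lemma in_orbits_PSL:
  "Y \<in> orbits (PSL2C\<lparr>carrier := G\<rparr>) S2 PSL_act \<longleftrightarrow> (\<exists>x. x \<in> S2 \<and> Y = (\<lambda>g. PSL_act g x) ` G)"
  unfolding orbits_def orbit_PSL mem_Collect_eq by (rule iffI; elim exE conjE; intro exI conjI; assumption)

text \<open>
  The situation is symmetric in the two groups (lemma \<open>inverse_pair\<close>); this gives the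
  surjectivity of the isomorphism.
\<close>

locale orbit_equivalent_subgroups =
  fixes G H h
  assumes G: "subgroup G PSL2C" and H: "subgroup H PSL2C"
    and oe: "orbit_equivalence G H h"
begin

lemma carrier: "g \<in> G \<Longrightarrow> g \<in> carrier PSL2C" "g \<in> H \<Longrightarrow> g \<in> carrier PSL2C"
  using G H subgroup.mem_carrier by metis+

lemma h_cont: "continuous_on S2 h" and h_image: "h ` S2 = S2" and h_inj: "inj_on h S2"
  using oe unfolding orbit_equivalence_def homeomorphic_eq_everything_map by auto

lemma h_in: "x \<in> S2 \<Longrightarrow> h x \<in> S2"
  using h_image by blast

lemma h_onto:
  assumes "y \<in> S2" shows "\<exists>x\<in>S2. h x = y"
proof -
  have "y \<in> h ` S2" unfolding h_image by (rule assms)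
  then show ?thesis by (auto simp del: mem_sphere mem_sphere_0)
qed

lemma h_orbit:
  assumes "x \<in> S2"
  shows "h ` (\<lambda>g. PSL_act g x) ` G = (\<lambda>g. PSL_act g (h x)) ` H"
proof -
  have "(\<lambda>g. PSL_act g x) ` G \<in> orbits (PSL2C\<lparr>carrier := G\<rparr>) S2 PSL_act"
    unfolding in_orbits_PSL using assms by (intro exI[of _ x] conjI) auto
  then have "h ` (\<lambda>g. PSL_act g x) ` G \<in> orbits (PSL2C\<lparr>carrier := H\<rparr>) S2 PSL_act"
    using oe orbit_equivalence_def by blast
  then obtain y where y: "y \<in> S2" "h ` (\<lambda>g. PSL_act g x) ` G = (\<lambda>g. PSL_act g y) ` H"
    unfolding in_orbits_PSL by (elim exE conjE)
  have "\<one>\<^bsub>PSL2C\<^esub> \<in> G" using G subgroup.one_closed by blast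
  then have "PSL_act \<one>\<^bsub>PSL2C\<^esub> x \<in> (\<lambda>g. PSL_act g x) ` G" by blast
  then have "h x \<in> h ` (\<lambda>g. PSL_act g x) ` G" using PSL_act_one[OF assms] by (metis imageI)
  then obtain k where k: "k \<in> H" "h x = PSL_act k y" using y by auto
  have "(\<lambda>g. PSL_act g (h x)) ` H = (\<lambda>g. PSL_act g y) ` H"
  proof (intro equalityI subsetI)
    fix z assume "z \<in> (\<lambda>g. PSL_act g (h x)) ` H"
    then obtain g where g: "g \<in> H" "z = PSL_act g (h x)" by blast
    then have "z = PSL_act (g \<otimes>\<^bsub>PSL2C\<^esub> k) y" using k y carrier by (simp add: PSL_act_mult)
    then show "z \<in> (\<lambda>g. PSL_act g y) ` H" using g k H subgroup.m_closed by (metis imageI)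
  next
    fix z assume "z \<in> (\<lambda>g. PSL_act g y) ` H"
    then obtain g where g: "g \<in> H" "z = PSL_act g y" by blast
    have ik: "inv\<^bsub>PSL2C\<^esub> k \<in> H" using k H subgroup.m_inv_closed by metis
    have "PSL_act (g \<otimes>\<^bsub>PSL2C\<^esub> inv\<^bsub>PSL2C\<^esub> k) (h x) = PSL_act g (PSL_act (inv\<^bsub>PSL2C\<^esub> k) (h x))"
      using g ik carrier h_in assms by (intro PSL_act_mult) auto
    also have "PSL_act (inv\<^bsub>PSL2C\<^esub> k) (h x) = y" using k y carrier by (simp add: PSL_act_inv)
    finally have "z = PSL_act (g \<otimes>\<^bsub>PSL2C\<^esub> inv\<^bsub>PSL2C\<^esub> k) (h x)" using g by simp
    then show "z \<in> (\<lambda>g. PSL_act g (h x)) ` H" using g ik H subgroup.m_closed by (metis imageI)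
  qed
  then show ?thesis using y by simp
qed

text \<open>
  The element \<open>k\<close> may at first depend on the point; the covering theorem removes the dependence.
\<close>

lemma conjugates:
  assumes "countable H" "g \<in> G"
  shows "\<exists>k\<in>H. \<forall>x\<in>S2. h (PSL_act g x) = PSL_act k (h x)"
proof -
  define E where "E k = {x \<in> S2. h (PSL_act g x) = PSL_act k (h x)}" for k
  have gc: "g \<in> carrier PSL2C" using assms carrier by blast
  have c1: "continuous_on S2 (\<lambda>x. h (PSL_act g x))"
    by (rule continuous_on_compose2[OF h_cont continuous_on_PSL_act[OF gc]]) (use PSL_act_in_S2[OF gc] in blast)
  have c2: "continuous_on S2 (\<lambda>x. PSL_act k (h x))" if "k \<in> H" for k
    by (rule continuous_on_compose2[OF continuous_on_PSL_act h_cont]) (use that carrier h_in in blast)+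
  have cl: "closed (E k)" if "k \<in> H" for k
  proof -
    have "continuous_on S2 (\<lambda>x. h (PSL_act g x) - PSL_act k (h x))"
      using c1 c2[OF that] by (intro continuous_intros)
    then have "closed (S2 \<inter> (\<lambda>x. h (PSL_act g x) - PSL_act k (h x)) -` {0})"
      by (intro continuous_closed_preimage) auto
    moreover have "S2 \<inter> (\<lambda>x. h (PSL_act g x) - PSL_act k (h x)) -` {0} = E k"
      by (auto simp: E_def)
    ultimately show ?thesis by simp
  qed
  have cov: "S2 \<subseteq> (\<Union>k\<in>H. E k)"
  proof
    fix x assume x: "x \<in> S2"
    then have "h (PSL_act g x) \<in> (\<lambda>k. PSL_act k (h x)) ` H" using h_orbit assms(2) by blast
    then show "x \<in> (\<Union>k\<in>H. E k)" using x by (auto simp: E_def)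
  qed
  have fin: "finite (E k \<inter> E l)" if kl: "k \<in> H" "l \<in> H" "k \<noteq> l" for k l
  proof (rule ccontr)
    assume "infinite (E k \<inter> E l)"
    moreover have "inj_on h (E k \<inter> E l)" using h_inj by (rule inj_on_subset) (auto simp: E_def)
    ultimately have "infinite (h ` (E k \<inter> E l))" using finite_imageD by blast
    moreover have "h ` (E k \<inter> E l) \<subseteq> {x \<in> S2. PSL_act k x = PSL_act l x}"
      using h_in by (auto simp: E_def)
    ultimately have "infinite {x \<in> S2. PSL_act k x = PSL_act l x}" using finite_subset by blast
    then show False using PSL_infinite_coincidence kl carrier by blast
  qed
  have "\<exists>k\<in>H. S2 = E k"
  proof (rule countable_closed_cover_finite_overlap)
    show "closed S2" "connected S2" by (simp_all add: connected_S2)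
    show "S2 \<noteq> {}" using chart_in_S2 by blast
    show "E k \<subseteq> S2" for k by (auto simp: E_def)
  qed (fact openin_S2_infinite S2_local_connectedness assms(1) cl cov fin)+
  then show ?thesis unfolding E_def by blast
qed

lemma inverse_pair: "orbit_equivalent_subgroups H G (inv_into S2 h)"
proof (rule orbit_equivalent_subgroups.intro[OF H G])
  let ?k = "inv_into S2 h"
  have kh: "?k (h x) = x" if "x \<in> S2" for x using that h_inj by simp
  have "homeomorphic_map (top_of_set S2) (top_of_set S2) h" using oe orbit_equivalence_def by blast
  then obtain g where g: "homeomorphic_maps (top_of_set S2) (top_of_set S2) h g"
    using homeomorphic_map_maps by blast
  then have "homeomorphic_map (top_of_set S2) (top_of_set S2) g"
    using homeomorphic_maps_sym homeomorphic_maps_map by blast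
  moreover have "g x = ?k x" if "x \<in> S2" for x
    using g that h_image kh unfolding homeomorphic_maps_def
    by (metis (no_types, lifting) f_inv_into_f inv_into_into topspace_euclidean_subtopology)
  ultimately have hk: "homeomorphic_map (top_of_set S2) (top_of_set S2) ?k"
    by (rule homeomorphic_map_eq) simp
  have "?k ` Y \<in> orbits (PSL2C\<lparr>carrier := G\<rparr>) S2 PSL_act"
    if Y: "Y \<in> orbits (PSL2C\<lparr>carrier := H\<rparr>) S2 PSL_act" for Y
  proof -
    obtain y where y: "y \<in> S2" "Y = (\<lambda>g. PSL_act g y) ` H"
      using Y unfolding in_orbits_PSL by (elim exE conjE)
    then obtain x where x: "x \<in> S2" "h x = y" using h_onto[OF y(1)] by (elim bexE)
    then have "Y = h ` (\<lambda>g. PSL_act g x) ` G" using h_orbit y by simp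
    moreover have "(\<lambda>g. PSL_act g x) ` G \<subseteq> S2" using PSL_act_in_S2 carrier x by blast
    ultimately have "?k ` Y = (\<lambda>g. PSL_act g x) ` G" using h_inj by (simp add: inv_into_image_cancel)
    then show ?thesis unfolding in_orbits_PSL using x by (intro exI[of _ x] conjI)
  qed
  then show "orbit_equivalence H G ?k" using hk orbit_equivalence_def by blast
qed

lemma equivariant:
  assumes "countable G" "countable H"
  shows "equivariant G H h"
proof -
  define \<sigma> where "\<sigma> g = (SOME k. k \<in> H \<and> (\<forall>x\<in>S2. h (PSL_act g x) = PSL_act k (h x)))" for g
  have s: "\<sigma> g \<in> H" "\<And>x. x \<in> S2 \<Longrightarrow> h (PSL_act g x) = PSL_act (\<sigma> g) (h x)" if "g \<in> G" for g
  proof -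
    have "\<sigma> g \<in> H \<and> (\<forall>x\<in>S2. h (PSL_act g x) = PSL_act (\<sigma> g) (h x))"
      unfolding \<sigma>_def by (rule someI_ex) (use conjugates[OF assms(2) that] in blast)
    then show "\<sigma> g \<in> H" "\<And>x. x \<in> S2 \<Longrightarrow> h (PSL_act g x) = PSL_act (\<sigma> g) (h x)" by auto
  qed
  have uniq: "k = l" if kl: "k \<in> H" "l \<in> H" and eq: "\<And>x. x \<in> S2 \<Longrightarrow> PSL_act k (h x) = PSL_act l (h x)" for k l
  proof (rule PSL_act_faithful)
    show "PSL_act k y = PSL_act l y" if y: "y \<in> S2" for y
    proof -
      obtain x where "x \<in> S2" "h x = y" using h_onto[OF y] by (elim bexE)
      then show ?thesis using eq[of x] by simp
    qed
  qed (rule carrier(2)[OF kl(1)], rule carrier(2)[OF kl(2)])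
  interpret inv: orbit_equivalent_subgroups H G "inv_into S2 h" by (rule inverse_pair)
  have "\<sigma> \<in> iso (PSL2C\<lparr>carrier := G\<rparr>) (PSL2C\<lparr>carrier := H\<rparr>)"
  proof (rule isoI)
    show "\<sigma> \<in> hom (PSL2C\<lparr>carrier := G\<rparr>) (PSL2C\<lparr>carrier := H\<rparr>)"
    proof (rule homI)
      fix g k assume "g \<in> carrier (PSL2C\<lparr>carrier := G\<rparr>)" "k \<in> carrier (PSL2C\<lparr>carrier := G\<rparr>)"
      then have gk: "g \<in> G" "k \<in> G" by auto
      then have m: "g \<otimes>\<^bsub>PSL2C\<^esub> k \<in> G" using G subgroup.m_closed by metis
      have "\<sigma> (g \<otimes>\<^bsub>PSL2C\<^esub> k) = \<sigma> g \<otimes>\<^bsub>PSL2C\<^esub> \<sigma> k"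
      proof (rule uniq)
        show "\<sigma> (g \<otimes>\<^bsub>PSL2C\<^esub> k) \<in> H" "\<sigma> g \<otimes>\<^bsub>PSL2C\<^esub> \<sigma> k \<in> H"
          using s gk m H subgroup.m_closed by metis+
        fix x assume x: "x \<in> S2"
        have "PSL_act (\<sigma> (g \<otimes>\<^bsub>PSL2C\<^esub> k)) (h x) = h (PSL_act (g \<otimes>\<^bsub>PSL2C\<^esub> k) x)" using s m x by simp
        also have "\<dots> = h (PSL_act g (PSL_act k x))" using x gk carrier by (simp only: PSL_act_mult)
        also have "\<dots> = PSL_act (\<sigma> g) (PSL_act (\<sigma> k) (h x))"
          using s gk x PSL_act_in_S2 carrier by metis
        also have "\<dots> = PSL_act (\<sigma> g \<otimes>\<^bsub>PSL2C\<^esub> \<sigma> k) (h x)"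
          using s gk x h_in carrier by (metis PSL_act_mult)
        finally show "PSL_act (\<sigma> (g \<otimes>\<^bsub>PSL2C\<^esub> k)) (h x) = PSL_act (\<sigma> g \<otimes>\<^bsub>PSL2C\<^esub> \<sigma> k) (h x)" .
      qed
      then show "\<sigma> (g \<otimes>\<^bsub>PSL2C\<lparr>carrier := G\<rparr>\<^esub> k) = \<sigma> g \<otimes>\<^bsub>PSL2C\<lparr>carrier := H\<rparr>\<^esub> \<sigma> k" by simp
    qed (use s in auto)
    have "inj_on \<sigma> G"
    proof (rule inj_onI)
      fix g k assume gk: "g \<in> G" "k \<in> G" "\<sigma> g = \<sigma> k"
      have eq: "PSL_act g x = PSL_act k x" if x: "x \<in> S2" for x
      proof (rule inj_onD[OF h_inj])
        show "h (PSL_act g x) = h (PSL_act k x)" using s gk x by metis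
      qed (use gk x PSL_act_in_S2 carrier in auto)
      show "g = k" by (rule PSL_act_faithful[OF carrier(1)[OF gk(1)] carrier(1)[OF gk(2)] eq])
    qed
    moreover have "\<exists>g\<in>G. \<sigma> g = k" if k: "k \<in> H" for k
    proof -
      obtain g where g: "g \<in> G" "\<And>x. x \<in> S2 \<Longrightarrow> inv_into S2 h (PSL_act k x) = PSL_act g (inv_into S2 h x)"
        using inv.conjugates[OF assms(1) k] by (elim bexE) simp
      have "PSL_act k (h x) = h (PSL_act g x)" if x: "x \<in> S2" for x
      proof -
        have "inv_into S2 h (PSL_act k (h x)) = PSL_act g x"
          using g(2)[OF h_in[OF x]] x h_inj by simp
        moreover have "PSL_act k (h x) \<in> h ` S2" using h_image k x h_in carrier PSL_act_in_S2 by simp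
        ultimately show ?thesis by (metis f_inv_into_f)
      qed
      then have "\<sigma> g = k" using s g k by (intro uniq) auto
      then show ?thesis using g by blast
    qed
    ultimately show "bij_betw \<sigma> (carrier (PSL2C\<lparr>carrier := G\<rparr>)) (carrier (PSL2C\<lparr>carrier := H\<rparr>))"
      using s by (auto simp: bij_betw_def)
  qed
  then show ?thesis unfolding equivariant_def using s by blast
qed

end

section \<open>Limits and normal forms of Moebius transformations\<close>

lemma hopf_eq_area2:
  assumes "v \<noteq> 0" "w \<noteq> 0" shows "hopf v = hopf w \<longleftrightarrow> area2 v w = 0"
proof -
  have "(dist (hopf v) (hopf w))\<^sup>2 = 0 \<longleftrightarrow> area2 v w = 0"
    unfolding dist_hopf[OF assms] using assms by simp
  then show ?thesis by simp
qed

lemma moebius_scale: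
  assumes "c \<noteq> 0" "\<And>i j. L$i$j = c * M$i$j" "x \<in> S2" "stretch M x \<noteq> 0"
  shows "moebius_act L x = moebius_act M x"
proof -
  obtain v where v: "v \<noteq> 0" "hopf v = x" using hopf_surj assms(3) by blast
  have M: "M *v v \<noteq> 0" using assms(4) v by (auto simp: stretch_hopf)
  have L: "L *v v = c *s (M *v v)"
    by (simp add: vec_eq_iff forall_2 matvec2 assms(2) algebra_simps)
  then have "L *v v \<noteq> 0" using M assms(1) by simp
  then show ?thesis using v M L assms(1) moebius_hopf[of v L] moebius_hopf[of v M] by (simp add: hopf_scale)
qed

lemma moebius_normalise:
  assumes "det M \<noteq> 0"
  obtains B where "det B = 1" "\<And>x. x \<in> S2 \<Longrightarrow> moebius_act B x = moebius_act M x"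
proof -
  define s where "s = csqrt (det M)"
  have s: "s * s = det M" unfolding s_def by (metis power2_csqrt power2_eq_square)
  then have "s \<noteq> 0" using assms by auto
  define B :: "complex^2^2" where "B = (\<chi> i j. M$i$j / s)"
  have "det B = det M / (s * s)" by (simp add: det_2 B_def diff_divide_distrib)
  then have "det B = 1" using s assms by simp
  moreover have "moebius_act B x = moebius_act M x" if "x \<in> S2" for x
    by (rule moebius_scale[where c = "1 / s"])
      (use \<open>s \<noteq> 0\<close> that stretch_pos[OF assms that] in \<open>auto simp: B_def\<close>)
  ultimately show thesis using that by blast
qed

text \<open>
  All vectors outside the kernel have the same image line. This excludes degenerate limits below.
\<close>

lemma singular_moebius_collapses:
  assumes "det M = 0" "M \<noteq> 0"
  obtains x y where "x \<in> S2" "y \<in> S2" "x \<noteq> y" "stretch M x > 0" "stretch M y > 0" "moebius_act M x = moebius_act M y"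
proof -
  let ?e = "vector [1, 0] :: complex^2" and ?f = "vector [0, 1] :: complex^2"
  have "\<exists>v u. M *v v \<noteq> 0 \<and> area2 v u \<noteq> 0"
  proof (cases "M *v ?e = 0")
    case True
    have "M *v ?f \<noteq> 0"
    proof
      assume "M *v ?f = 0"
      with True have "(M *v ?e)$1 = 0" "(M *v ?e)$2 = 0" "(M *v ?f)$1 = 0" "(M *v ?f)$2 = 0" by auto
      then have "M = 0" by (simp add: matvec2 vec_eq_iff forall_2)
      then show False using assms by simp
    qed
    then show ?thesis by (intro exI[of _ ?f] exI[of _ ?e]) (simp add: area2_def)
  next
    case False
    then show ?thesis by (intro exI[of _ ?e] exI[of _ ?f]) (simp add: area2_def)
  qed
  then obtain v u where v: "M *v v \<noteq> 0" "area2 v u \<noteq> 0" by blast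
  have "\<exists>w. M *v w \<noteq> 0 \<and> area2 v w \<noteq> 0"
  proof (cases "M *v (v + u) = 0")
    case True
    then have "M *v (v - u) = 2 *s (M *v v)"
      by (simp add: matrix_vector_right_distrib matrix_vector_mult_diff_distrib vec_eq_iff forall_2 add_eq_0_iff)
    then have "M *v (v - u) \<noteq> 0" using v by simp
    moreover have "area2 v (v - u) \<noteq> 0" using v by (simp add: area2_def algebra_simps)
    ultimately show ?thesis by blast
  next
    case False
    moreover have "area2 v (v + u) \<noteq> 0" using v by (simp add: area2_def algebra_simps)
    ultimately show ?thesis by blast
  qed
  then obtain w where w: "M *v w \<noteq> 0" "area2 v w \<noteq> 0" by blast
  have nz: "v \<noteq> 0" "w \<noteq> 0" using v w by auto
  show thesis
  proof (rule that[of "hopf v" "hopf w"])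
    show "hopf v \<in> S2" "hopf w \<in> S2" using nz hopf_in_S2 by auto
    show "hopf v \<noteq> hopf w" using nz w hopf_eq_area2 by blast
    show "stretch M (hopf v) > 0" "stretch M (hopf w) > 0" using nz v w by (auto simp: stretch_hopf)
    show "moebius_act M (hopf v) = moebius_act M (hopf w)"
      using nz v w assms by (simp add: moebius_hopf hopf_eq_area2 area2_matvec)
  qed
qed

text \<open>
  The matrices may be unbounded, but divided by their norms they subconverge to a nonzero matrix,
  which induces the limit map off its kernel. If it were singular the limit would not be injective.
\<close>

lemma moebius_limit:
  fixes B :: "nat \<Rightarrow> complex^2^2"
  assumes B: "\<And>n. det (B n) = 1" and lim: "\<And>x. x \<in> S2 \<Longrightarrow> (\<lambda>n. moebius_act (B n) x) \<longlonglongrightarrow> f x"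
    and inj: "inj_on f S2"
  shows "\<exists>A. det A = 1 \<and> (\<forall>x\<in>S2. f x = moebius_act A x)"
proof -
  define M where "M n = B n /\<^sub>R norm (B n)" for n
  have Bnz: "B n \<noteq> 0" for n
  proof
    assume "B n = 0" then show False using B[of n] by (simp add: det_2)
  qed
  have MB: "moebius_act (M n) x = moebius_act (B n) x" if "x \<in> S2" for n x
  proof (rule moebius_scale[where c = "complex_of_real (inverse (norm (B n)))"])
    show "complex_of_real (inverse (norm (B n))) \<noteq> 0" using Bnz[of n] by simp
    show "stretch (B n) x \<noteq> 0" using stretch_pos[of "B n" x] B that by simp
    show "M n $ i $ j = complex_of_real (inverse (norm (B n))) * B n $ i $ j" for i j
      unfolding M_def vector_scaleR_component by (simp only: scaleR_conv_of_real)
  qed (rule that)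
  have "M n \<in> sphere 0 1" for n using Bnz by (simp add: M_def)
  then obtain L r where L: "L \<in> sphere 0 1" "strict_mono r" "(M \<circ> r) \<longlonglongrightarrow> L"
    using compact_sphere[of "0 :: complex^2^2" 1] unfolding compact_def by meson
  have fL: "f x = moebius_act L x" if x: "x \<in> S2" "stretch L x > 0" for x
  proof -
    let ?P = "{N. 0 < stretch N x}"
    have "open ?P" by (intro open_Collect_less continuous_intros)
    moreover have "continuous_on ?P (\<lambda>N. moebius_act N x)" by (intro continuous_intros) auto
    ultimately have "isCont (\<lambda>N. moebius_act N x) L" using x by (simp add: continuous_on_eq_continuous_at)
    then have "(\<lambda>n. moebius_act ((M \<circ> r) n) x) \<longlonglongrightarrow> moebius_act L x" using L isCont_tendsto_compose by blast
    moreover have "(\<lambda>n. moebius_act ((M \<circ> r) n) x) \<longlonglongrightarrow> f x"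
      using LIMSEQ_subseq_LIMSEQ[OF lim[OF x(1)] L(2)] MB[OF x(1)] by (simp add: o_def)
    ultimately show ?thesis using LIMSEQ_unique by blast
  qed
  have "det L \<noteq> 0"
  proof
    assume "det L = 0"
    moreover have "L \<noteq> 0" using L by auto
    ultimately obtain x y where "x \<in> S2" "y \<in> S2" "x \<noteq> y" "stretch L x > 0" "stretch L y > 0" "moebius_act L x = moebius_act L y"
      by (rule singular_moebius_collapses)
    then show False using fL inj inj_onD by metis
  qed
  then obtain A where "det A = 1" "\<And>x. x \<in> S2 \<Longrightarrow> moebius_act A x = moebius_act L x" using moebius_normalise by blast
  then show ?thesis using fL stretch_pos[OF \<open>det L \<noteq> 0\<close>] by metis
qed

text \<open>
  The columns are lifts of the first two points, rescaled so that their sum lifts the third.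
\<close>

lemma moebius_three_points:
  assumes p: "p \<in> S2" "q \<in> S2" "r \<in> S2" and d: "p \<noteq> q" "p \<noteq> r" "q \<noteq> r"
  shows "\<exists>A. det A = 1 \<and> moebius_act A (0, 1) = p \<and> moebius_act A (chart 0) = q \<and> moebius_act A (chart 1) = r"
proof -
  obtain u v w where u: "u \<noteq> 0" "hopf u = p" and v: "v \<noteq> 0" "hopf v = q" and w: "w \<noteq> 0" "hopf w = r"
    using hopf_surj p by meson
  have a: "area2 u v \<noteq> 0" "area2 u w \<noteq> 0" "area2 w v \<noteq> 0"
    using u v w d hopf_eq_area2[of u v] hopf_eq_area2[of u w] hopf_eq_area2[of w v] by auto
  define \<alpha> \<beta> where "\<alpha> = area2 w v / area2 u v" and "\<beta> = area2 u w / area2 u v"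
  have nz: "\<alpha> \<noteq> 0" "\<beta> \<noteq> 0" using a by (auto simp: \<alpha>_def \<beta>_def)
  have c: "\<alpha> * u$1 + \<beta> * v$1 = w$1" "\<alpha> * u$2 + \<beta> * v$2 = w$2"
    using a(1) unfolding \<alpha>_def \<beta>_def times_divide_eq_left add_divide_distrib[symmetric]
    by (simp_all add: divide_eq_eq) (simp_all add: area2_def algebra_simps)
  define M :: "complex^2^2" where "M = (\<chi> i j. if j = 1 then \<alpha> * u$i else \<beta> * v$i)"
  have M: "M$i$1 = \<alpha> * u$i" "M$i$2 = \<beta> * v$i" for i by (simp_all add: M_def)
  have "det M = \<alpha> * \<beta> * area2 u v" by (simp add: det_2 M area2_def algebra_simps)
  then have dM: "det M \<noteq> 0" using nz a by simp
  have e1: "M *v vector [1, 0] = \<alpha> *s u" by (simp add: vec_eq_iff forall_2 matvec2 M)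
  have e2: "M *v vector [0, 1] = \<beta> *s v" by (simp add: vec_eq_iff forall_2 matvec2 M)
  have e3: "M *v vector [1, 1] = w" by (simp add: vec_eq_iff forall_2 matvec2 M c)
  have N: "hopf (vector [1, 0]) = (0, 1)" by (rule hopf_pole) (simp_all add: vector2_nz)
  have "moebius_act M (0, 1) = p" "moebius_act M (chart 0) = q" "moebius_act M (chart 1) = r"
    unfolding chart_def N[symmetric]
    using u v w nz by (simp_all add: moebius_hopf vector2_nz e1 e2 e3 hopf_scale)
  moreover obtain A where "det A = 1" "\<And>x. x \<in> S2 \<Longrightarrow> moebius_act A x = moebius_act M x"
    using moebius_normalise[OF dM] by blast
  moreover have "(0, 1) \<in> S2" by (simp add: norm_prod_def)
  ultimately show ?thesis using chart_in_S2 by metis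
qed

lemma moebius_affine:
  assumes "\<alpha> \<noteq> 0"
  shows "\<exists>A. det A = 1 \<and> moebius_act A (0, 1) = (0, 1) \<and> (\<forall>z. moebius_act A (chart z) = chart (\<alpha> * z + \<beta>))"
proof -
  define M :: "complex^2^2" where "M = vector [vector [\<alpha>, \<beta>], vector [0, 1]]"
  have M: "M$1$1 = \<alpha>" "M$1$2 = \<beta>" "M$2$1 = 0" "M$2$2 = 1" by (simp_all add: M_def)
  have dM: "det M \<noteq> 0" using assms by (simp add: det_2 M)
  have N: "hopf (vector [1, 0]) = (0, 1)" by (rule hopf_pole) (simp_all add: vector2_nz)
  have e1: "M *v vector [1, 0] = \<alpha> *s vector [1, 0]" by (simp add: vec_eq_iff forall_2 matvec2 M)
  have e2: "M *v vector [z, 1] = vector [\<alpha> * z + \<beta>, 1]" for z by (simp add: vec_eq_iff forall_2 matvec2 M)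
  have "moebius_act M (0, 1) = (0, 1)"
    unfolding N[symmetric] using assms by (simp add: moebius_hopf vector2_nz e1 hopf_scale)
  moreover have "moebius_act M (chart z) = chart (\<alpha> * z + \<beta>)" for z
    unfolding chart_def by (simp add: moebius_hopf vector2_nz e2)
  moreover obtain A where "det A = 1" "\<And>x. x \<in> S2 \<Longrightarrow> moebius_act A x = moebius_act M x"
    using moebius_normalise[OF dM] by blast
  moreover have "(0, 1) \<in> S2" by (simp add: norm_prod_def)
  ultimately show ?thesis using chart_in_S2 by metis
qed

lemma moebius_fixing_pole:
  assumes "det A = 1" "moebius_act A (0, 1) = (0, 1)"
  shows "\<exists>\<alpha> \<beta>. \<alpha> \<noteq> 0 \<and> (\<forall>z. moebius_act A (chart z) = chart (\<alpha> * z + \<beta>))"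
proof -
  let ?e = "vector [1, 0] :: complex^2"
  have N: "hopf ?e = (0, 1)" by (rule hopf_pole) (simp_all add: vector2_nz)
  have nz: "A *v v \<noteq> 0" if "v \<noteq> 0" for v using det_nz_vec[of A v] assms that by simp
  have "hopf (A *v ?e) = hopf ?e"
    using assms(2) nz[of ?e] unfolding N[symmetric] by (simp add: moebius_hopf vector2_nz)
  then have "area2 (A *v ?e) ?e = 0" using hopf_eq_area2 nz[of ?e] by (simp add: vector2_nz)
  then have c: "A$2$1 = 0" by (simp add: area2_def matvec2)
  then have ad: "A$1$1 * A$2$2 = 1" using assms(1) by (simp add: det_2)
  then have d: "A$1$1 \<noteq> 0" "A$2$2 \<noteq> 0" by auto
  have "moebius_act A (chart z) = chart (A$1$1 / A$2$2 * z + A$1$2 / A$2$2)" for z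
  proof -
    have "moebius_act A (chart z) = hopf (A *v vector [z, 1])"
      unfolding chart_def by (rule moebius_hopf) (simp_all add: vector2_nz nz)
    also have "\<dots> = chart ((A *v vector [z, 1])$1 / (A *v vector [z, 1])$2)"
      by (rule hopf_chart) (simp add: matvec2 c d)
    also have "(A *v vector [z, 1])$1 / (A *v vector [z, 1])$2 = A$1$1 / A$2$2 * z + A$1$2 / A$2$2"
      using d by (simp add: matvec2 c add_divide_distrib)
    finally show ?thesis .
  qed
  then show ?thesis using d by (intro exI[of _ "A$1$1 / A$2$2"] exI[of _ "A$1$2 / A$2$2"]) simp
qed

text \<open>
  Such a map fixes the rationals, hence by continuity the reals, and permutes the square roots of $-1$.
\<close>

lemma continuous_field_endomorphism_complex:
  fixes f :: "complex \<Rightarrow> complex"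
  assumes cont: "continuous_on UNIV f" and one: "f 1 = 1"
    and add: "\<And>x y. f (x + y) = f x + f y" and mult: "\<And>x y. f (x * y) = f x * f y"
  shows "f = id \<or> f = cnj"
proof -
  interpret f: additive f by unfold_locales (rule add)
  have nat: "f (of_nat n) = of_nat n" for n
    by (induction n) (simp_all add: f.zero add one)
  have int: "f (of_int k) = of_int k" for k
    by (cases k rule: int_cases2) (simp_all add: nat f.minus)
  have rat: "f (complex_of_real x) = complex_of_real x" if x: "x \<in> \<rat>" for x
  proof -
    obtain a b where ab: "b \<noteq> 0" "x = real_of_int a / real_of_int b" by (metis Rats_cases' x less_irrefl)
    have "f (complex_of_real x) * f (of_int b) = f (of_int a)"
      unfolding mult[symmetric] using ab by simp
    then have "f (complex_of_real x) = of_int a / of_int b" using ab(1) by (simp add: int nonzero_eq_divide_eq)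
    then show ?thesis using ab(2) by simp
  qed
  have cl: "closed {x::real. f (complex_of_real x) = complex_of_real x}"
    by (intro closed_Collect_eq continuous_on_compose2[OF cont] continuous_intros) auto
  have "closure \<rat> \<subseteq> {x::real. f (complex_of_real x) = complex_of_real x}"
    by (rule closure_minimal[OF _ cl]) (use rat in auto)
  then have re: "f (complex_of_real x) = complex_of_real x" for x using Rats_closure_real by auto
  have "f \<i> * f \<i> = -1" using mult[of \<i> \<i>] f.minus[of 1] one by simp
  then have "(f \<i> - \<i>) * (f \<i> + \<i>) = 0" by (simp add: algebra_simps)
  then have i: "f \<i> = \<i> \<or> f \<i> = - \<i>" by (auto simp: add_eq_0_iff2)
  have z: "f z = complex_of_real (Re z) + f \<i> * complex_of_real (Im z)" for z
    by (subst complex_eq[of z]) (simp add: add mult re)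
  show ?thesis using i
  proof
    assume "f \<i> = \<i>"
    then have "f z = id z" for z unfolding z[of z] by (simp add: complex_eq_iff)
    then show ?thesis by (intro disjI1 ext)
  next
    assume "f \<i> = - \<i>"
    then have "f z = cnj z" for z unfolding z[of z] by (simp add: complex_eq_iff)
    then show ?thesis by (intro disjI2 ext)
  qed
qed

section \<open>Homeomorphisms that normalise PSL(2,C)\<close>

lemma chart_denominator: "1 - snd (chart z) \<noteq> 0"
proof -
  have "(cmod z)\<^sup>2 + 1 > 0" by (simp add: add_nonneg_pos)
  then have "1 - snd (chart z) = 2 / ((cmod z)\<^sup>2 + 1)" by (simp add: chart_explicit field_simps)
  then show ?thesis using \<open>(cmod z)\<^sup>2 + 1 > 0\<close> by simp
qed

lemma chart_unchart: "x \<in> S2 \<Longrightarrow> x \<noteq> (0, 1) \<Longrightarrow> chart (unchart x) = x"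
  by (metis S2_cases unchart_chart)

lemma continuous_on_chart: "continuous_on UNIV chart"
proof -
  have "complex_of_real ((cmod z)\<^sup>2 + 1) \<noteq> 0" "(cmod z)\<^sup>2 + 1 \<noteq> 0" for z
    by (smt (verit) of_real_eq_0_iff zero_le_power2)+
  then show ?thesis unfolding chart_explicit[abs_def] by (intro continuous_intros) auto
qed

lemma conj_S2_chart: "conj_S2 (chart z) = chart (cnj z)"
  by (simp add: conj_S2_def chart_explicit)

text \<open>
  Conjugation by \<open>h\<close> preserves the stabiliser of the pole, the affine group, so the map \<open>\<phi>\<close>
  induced on the plane satisfies $\phi(\alpha z+\beta) = \alpha' \phi(z)+\beta'$. A translation is
  an affine map without fixed points, hence goes to a translation, and a map that fixes 0 goes to
  one that fixes 0; so \<open>\<phi>\<close> is additive and multiplicative.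
\<close>

lemma normaliser_fixing_triple:
  assumes cont: "continuous_on S2 h" and img: "h ` S2 = S2" and inj: "inj_on h S2"
    and N: "\<And>A. det A = 1 \<Longrightarrow> \<exists>B. det B = 1 \<and> (\<forall>x\<in>S2. h (moebius_act A x) = moebius_act B (h x))"
    and fx: "h (0, 1) = (0, 1)" "h (chart 0) = chart 0" "h (chart 1) = chart 1"
  shows "(\<forall>x\<in>S2. h x = x) \<or> (\<forall>x\<in>S2. h x = conj_S2 x)"
proof -
  define \<phi> where "\<phi> z = unchart (h (chart z))" for z
  have h_in: "h x \<in> S2" if "x \<in> S2" for x using img that by (metis imageI)
  have h_chart: "h (chart z) = chart (\<phi> z)" for z
  proof -
    have "h (chart z) \<noteq> h (0, 1)"
      using inj_onD[OF inj _ chart_in_S2 pole_in_S2] chart_neq_pole by metis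
    then show ?thesis unfolding \<phi>_def using chart_unchart h_in chart_in_S2 fx(1) by metis
  qed
  have \<phi>01: "\<phi> 0 = 0" "\<phi> 1 = 1" using fx by (simp_all add: \<phi>_def)
  have \<phi>_inj: "z = w" if "\<phi> z = \<phi> w" for z w
    using inj_onD[OF inj, of "chart z" "chart w"] that chart_in_S2 by (simp only: h_chart inj_chart)
  have \<phi>_onto: "\<exists>z. \<phi> z = w" for w
  proof -
    have "chart w \<in> h ` S2" unfolding img by (rule chart_in_S2)
    then obtain x where x: "x \<in> S2" "h x = chart w" by (metis imageE)
    then have "x \<noteq> (0, 1)" using fx(1) chart_neq_pole by metis
    then obtain z where "x = chart z" using S2_cases x(1) by metis
    then have "chart (\<phi> z) = chart w" using x(2) by (simp only: h_chart)
    then show ?thesis unfolding inj_chart by blast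
  qed
  have \<phi>_cont: "continuous_on UNIV \<phi>"
  proof -
    have c: "continuous_on UNIV (\<lambda>z. h (chart z))"
      by (rule continuous_on_compose2[OF cont continuous_on_chart]) (use chart_in_S2 in blast)
    have "complex_of_real (1 - snd (h (chart z))) \<noteq> 0" for z
      unfolding h_chart of_real_eq_0_iff by (rule chart_denominator)
    then show ?thesis unfolding \<phi>_def[abs_def] unchart_def by (intro continuous_intros c) auto
  qed
  have affine: "\<exists>\<alpha>' \<beta>'. \<alpha>' \<noteq> 0 \<and> (\<forall>z. \<phi> (\<alpha> * z + \<beta>) = \<alpha>' * \<phi> z + \<beta>')" if a0: "\<alpha> \<noteq> 0" for \<alpha> \<beta>
  proof -
    obtain A where A: "det A = 1" "moebius_act A (0, 1) = (0, 1)" "\<And>z. moebius_act A (chart z) = chart (\<alpha> * z + \<beta>)"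
      using moebius_affine[OF a0] by metis
    obtain B where B: "det B = 1" "\<And>x. x \<in> S2 \<Longrightarrow> h (moebius_act A x) = moebius_act B (h x)" using N[OF A(1)] by blast
    have "moebius_act B (0, 1) = (0, 1)" using B(2)[OF pole_in_S2] A(2) fx(1) by simp
    then obtain \<alpha>' \<beta>' where ab: "\<alpha>' \<noteq> 0" "\<And>z. moebius_act B (chart z) = chart (\<alpha>' * z + \<beta>')"
      using moebius_fixing_pole[OF B(1)] by blast
    have "chart (\<phi> (\<alpha> * z + \<beta>)) = chart (\<alpha>' * \<phi> z + \<beta>')" for z
      using B(2)[OF chart_in_S2[of z]] by (simp only: A h_chart ab)
    then show ?thesis using ab(1) unfolding inj_chart by blast
  qed
  have add: "\<phi> (z + w) = \<phi> z + \<phi> w" for z w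
  proof (cases "w = 0")
    case True then show ?thesis using \<phi>01 by simp
  next
    case False
    obtain \<alpha>' \<beta>' where ab: "\<alpha>' \<noteq> 0" "\<And>z. \<phi> (1 * z + w) = \<alpha>' * \<phi> z + \<beta>'"
      using affine[of 1 w] by auto
    have b: "\<beta>' = \<phi> w" using ab(2)[of 0] \<phi>01 by simp
    \<comment> \<open>otherwise the image of the translation would be an affine map with a fixed point\<close>
    have "\<alpha>' = 1"
    proof (rule ccontr)
      assume n: "\<alpha>' \<noteq> 1"
      obtain u where u: "\<phi> u = \<beta>' / (1 - \<alpha>')" using \<phi>_onto by blast
      have "\<phi> (1 * u + w) = \<phi> u" unfolding ab(2) u using n by (simp add: field_simps)
      then have "1 * u + w = u" by (rule \<phi>_inj)
      then show False using False by simp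
    qed
    then show ?thesis using ab(2)[of z] b by simp
  qed
  have mult: "\<phi> (z * w) = \<phi> z * \<phi> w" for z w
  proof (cases "z = 0")
    case True then show ?thesis using \<phi>01 by simp
  next
    case False
    obtain \<alpha>' \<beta>' where ab: "\<And>w. \<phi> (z * w + 0) = \<alpha>' * \<phi> w + \<beta>'"
      using affine[OF False, of 0] by auto
    show ?thesis using ab[of 0] ab[of 1] ab[of w] \<phi>01 by simp
  qed
  have "\<phi> = id \<or> \<phi> = cnj"
    by (rule continuous_field_endomorphism_complex) (fact \<phi>_cont \<phi>01 add mult)+
  then show ?thesis
  proof
    assume "\<phi> = id"
    then have "h x = x" if "x \<in> S2" for x using that by (metis S2_cases fx(1) h_chart id_apply)
    then show ?thesis by blast
  next
    assume "\<phi> = cnj"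
    have "h x = conj_S2 x" if "x \<in> S2" for x
    proof (rule S2_cases[OF that])
      show "h x = conj_S2 x" if "x = (0, 1)" unfolding that fx(1) by (simp add: conj_S2_def)
      show "h x = conj_S2 x" if "x = chart z" for z unfolding that h_chart conj_S2_chart \<open>\<phi> = cnj\<close> ..
    qed
    then show ?thesis by blast
  qed
qed

lemma conj_S2_in_S2: "x \<in> S2 \<Longrightarrow> conj_S2 x \<in> S2"
  by (simp add: conj_S2_def norm_prod_def)

lemma normaliser_moebius:
  assumes cont: "continuous_on S2 h" and img: "h ` S2 = S2" and inj: "inj_on h S2"
    and N: "\<And>A. det A = 1 \<Longrightarrow> \<exists>B. det B = 1 \<and> (\<forall>x\<in>S2. h (moebius_act A x) = moebius_act B (h x))"
  shows "\<exists>A. det A = 1 \<and> ((\<forall>x\<in>S2. h x = moebius_act A x) \<or> (\<forall>x\<in>S2. h x = moebius_act A (conj_S2 x)))"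
proof -
  have h_in: "h x \<in> S2" if "x \<in> S2" for x using img that by (metis imageI)
  have neq: "h x \<noteq> h y" if "x \<in> S2" "y \<in> S2" "x \<noteq> y" for x y using inj that by (metis inj_onD)
  have "chart 0 \<noteq> chart 1" by (simp add: inj_chart)
  then obtain A where A: "det A = 1" "moebius_act A (0, 1) = h (0, 1)" "moebius_act A (chart 0) = h (chart 0)"
      "moebius_act A (chart 1) = h (chart 1)"
    using moebius_three_points[of "h (0, 1)" "h (chart 0)" "h (chart 1)"] h_in neq chart_in_S2 pole_in_S2 chart_neq_pole
    by metis
  obtain B where B: "det B = 1" "\<And>x. x \<in> S2 \<Longrightarrow> moebius_act B (moebius_act A x) = x" "\<And>x. x \<in> S2 \<Longrightarrow> moebius_act A (moebius_act B x) = x"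
    using moebius_inverse[OF A(1)] by metis
  have nz: "det A \<noteq> 0" "det B \<noteq> 0" using A B by auto
  define k where "k x = moebius_act B (h x)" for x
  have "(\<forall>x\<in>S2. k x = x) \<or> (\<forall>x\<in>S2. k x = conj_S2 x)"
  proof (rule normaliser_fixing_triple)
    show "continuous_on S2 k" unfolding k_def[abs_def]
      by (rule continuous_on_compose2[OF continuous_on_moebius_S2[OF nz(2)] cont]) (use h_in in blast)
    show "inj_on k S2"
      unfolding k_def[abs_def] using comp_inj_on[OF inj, of "moebius_act B"] moebius_inj_on_S2[OF B(1)] img
      by (simp add: o_def)
    have "moebius_act B ` S2 = S2"
    proof
      show "moebius_act B ` S2 \<subseteq> S2" using moebius_in_S2 nz by blast
      show "S2 \<subseteq> moebius_act B ` S2"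
      proof
        fix x assume x: "x \<in> S2"
        then show "x \<in> moebius_act B ` S2" using B(2)[OF x] moebius_in_S2[OF nz(1) x] by (intro image_eqI[of _ _ "moebius_act A x"]) simp
      qed
    qed
    moreover have "k ` S2 = moebius_act B ` (h ` S2)" by (simp add: k_def image_image)
    ultimately show "k ` S2 = S2" using img by simp
    show "\<exists>K. det K = 1 \<and> (\<forall>x\<in>S2. k (moebius_act L x) = moebius_act K (k x))" if L: "det L = 1" for L
    proof -
      obtain M where M: "det M = 1" "\<And>x. x \<in> S2 \<Longrightarrow> h (moebius_act L x) = moebius_act M (h x)" using N[OF L] by blast
      have "k (moebius_act L x) = moebius_act (B ** M ** A) (k x)" if x: "x \<in> S2" for x
      proof -
        have kx: "k x \<in> S2" unfolding k_def by (intro moebius_in_S2 nz h_in x)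
        have "moebius_act (B ** M ** A) (k x) = moebius_act (B ** M) (moebius_act A (k x))"
          using A B M kx by (intro moebius_mult) (auto simp: det_mul)
        also have "moebius_act A (k x) = h x" unfolding k_def by (rule B(3)[OF h_in[OF x]])
        also have "moebius_act (B ** M) (h x) = moebius_act B (moebius_act M (h x))"
          using B M h_in[OF x] by (intro moebius_mult) auto
        finally show ?thesis unfolding k_def M(2)[OF x] by simp
      qed
      moreover have "det (B ** M ** A) = 1" using A B M by (simp add: det_mul)
      ultimately show ?thesis by (intro exI[of _ "B ** M ** A"] conjI ballI)
    qed
    show "k (0, 1) = (0, 1)" "k (chart 0) = chart 0" "k (chart 1) = chart 1"
      unfolding k_def A(2,3,4)[symmetric] by (intro B(2) chart_in_S2 pole_in_S2)+
  qed
  moreover have "h x = moebius_act A (k x)" if "x \<in> S2" for x unfolding k_def B(3)[OF h_in[OF that]] ..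
  ultimately have "(\<forall>x\<in>S2. h x = moebius_act A x) \<or> (\<forall>x\<in>S2. h x = moebius_act A (conj_S2 x))" by metis
  then show ?thesis using A(1) by (intro exI[of _ A] conjI)
qed

context orbit_equivalent_subgroups
begin

text \<open>
  The conjugates of approximating group elements converge pointwise, and \<open>moebius_limit\<close> applies.
\<close>

lemma normalises:
  assumes G': "dense_subgroup G" and "countable H" and A: "det A = 1"
  shows "\<exists>B. det B = 1 \<and> (\<forall>x\<in>S2. h (moebius_act A x) = moebius_act B (h x))"
proof -
  have "\<exists>B\<in>ball A (1 / Suc n). det B = 1 \<and> {B, - B} \<in> G" for n
    by (rule dense_subgroup_meets_open[OF G']) (use A in auto)
  then obtain L where L: "\<And>n. L n \<in> ball A (1 / Suc n)" "\<And>n. det (L n) = 1" "\<And>n. {L n, - L n} \<in> G"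
    by metis
  have "\<exists>B. det B = 1 \<and> (\<forall>x\<in>S2. h (moebius_act (L n) x) = moebius_act B (h x))" for n
  proof -
    obtain k where k: "k \<in> H" "\<And>x. x \<in> S2 \<Longrightarrow> h (PSL_act {L n, - L n} x) = PSL_act k (h x)"
      using conjugates[OF assms(2) L(3)[of n]] by (elim bexE) simp
    obtain B where B: "det B = 1" "k = {B, - B}" by (rule PSL_elem[OF carrier(2)[OF k(1)]])
    have "h (moebius_act (L n) x) = moebius_act B (h x)" if x: "x \<in> S2" for x
      using k(2)[OF x] unfolding B(2) PSL_act_moebius[OF L(2) x] PSL_act_moebius[OF B(1) h_in[OF x]] .
    then show ?thesis using B(1) by (intro exI[of _ B] conjI ballI)
  qed
  then obtain B where B: "\<And>n. det (B n) = 1" "\<And>n x. x \<in> S2 \<Longrightarrow> h (moebius_act (L n) x) = moebius_act (B n) (h x)"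
    by metis
  have "(\<lambda>n. dist (L n) A) \<longlonglongrightarrow> 0"
  proof (rule tendsto_sandwich[OF _ _ tendsto_const LIMSEQ_inverse_real_of_nat])
    have "dist (L n) A \<le> inverse (real (Suc n))" for n
      using L(1)[of n] by (simp add: dist_commute inverse_eq_divide)
    then show "\<forall>\<^sub>F n in sequentially. dist (L n) A \<le> inverse (real (Suc n))" by simp
  qed auto
  then have LA: "L \<longlonglongrightarrow> A" by (rule iffD2[OF tendsto_dist_iff])
  define f where "f y = h (moebius_act A (inv_into S2 h y))" for y
  have f: "f (h x) = h (moebius_act A x)" if "x \<in> S2" for x
    unfolding f_def inv_into_f_f[OF h_inj that] ..
  have lim: "(\<lambda>n. moebius_act (B n) y) \<longlonglongrightarrow> f y" if y: "y \<in> S2" for y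
  proof -
    obtain x where x: "x \<in> S2" "h x = y" using h_onto[OF y] by (elim bexE)
    let ?P = "{N. 0 < stretch N x}"
    have "open ?P" by (intro open_Collect_less continuous_intros)
    moreover have "continuous_on ?P (\<lambda>N. moebius_act N x)" by (intro continuous_intros) auto
    moreover have "A \<in> ?P" using stretch_pos[of A x] A x by simp
    ultimately have "isCont (\<lambda>N. moebius_act N x) A" by (simp add: continuous_on_eq_continuous_at)
    then have "(\<lambda>n. moebius_act (L n) x) \<longlonglongrightarrow> moebius_act A x" using LA isCont_tendsto_compose by blast
    then have "(\<lambda>n. h (moebius_act (L n) x)) \<longlonglongrightarrow> h (moebius_act A x)"
    proof (rule continuous_on_tendsto_compose[OF h_cont])
      show "moebius_act A x \<in> S2" by (rule moebius_in_S2[OF _ x(1)]) (simp add: A)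
      have "moebius_act (L n) x \<in> S2" for n by (rule moebius_in_S2[OF _ x(1)]) (simp add: L(2))
      then show "\<forall>\<^sub>F n in sequentially. moebius_act (L n) x \<in> S2" by (rule always_eventually[OF allI])
    qed
    then show ?thesis unfolding x(2)[symmetric] B(2)[OF x(1), symmetric] f[OF x(1)] .
  qed
  have "inj_on f S2"
  proof (rule inj_onI)
    fix y z assume yz: "y \<in> S2" "z \<in> S2" "f y = f z"
    obtain x w where x: "x \<in> S2" "h x = y" "w \<in> S2" "h w = z" using h_onto yz by metis
    have "h (moebius_act A x) = h (moebius_act A w)" using yz(3) f[OF x(1)] f[OF x(3)] unfolding x(2,4) by simp
    moreover have "moebius_act A x \<in> S2" "moebius_act A w \<in> S2" using moebius_in_S2 A x by auto
    ultimately have "moebius_act A x = moebius_act A w" by (rule inj_onD[OF h_inj])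
    then have "x = w" by (rule inj_onD[OF moebius_inj_on_S2[OF A] _ x(1,3)])
    then show "y = z" unfolding x(2,4)[symmetric] by (rule arg_cong)
  qed
  from moebius_limit[OF B(1) lim this]
  obtain C where "det C = 1" "\<And>x. x \<in> S2 \<Longrightarrow> f x = moebius_act C x" by metis
  then have "h (moebius_act A x) = moebius_act C (h x)" if "x \<in> S2" for x using f[OF that] h_in[OF that] by simp
  then show ?thesis using \<open>det C = 1\<close> by (intro exI[of _ C] conjI ballI)
qed

end

section \<open>Degrees\<close>

lemma topspace_nsphere_2:
  "topspace (nsphere 2) = {s. (s 0)\<^sup>2 + (s 1)\<^sup>2 + (s 2)\<^sup>2 = 1 \<and> (\<forall>i>2. s i = 0)}"
proof -
  have "(\<Sum>i\<le>2. (s i)\<^sup>2) = (s 0)\<^sup>2 + (s 1)\<^sup>2 + (s 2)\<^sup>2" for s :: "nat \<Rightarrow> real"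
  proof -
    have "{..2::nat} = {0, 1, 2}" by auto
    then show ?thesis by simp
  qed
  then show ?thesis by (simp add: nsphere)
qed

lemma continuous_map_to_nsphere: "continuous_map (top_of_set S2) (nsphere 2) to_nsphere"
proof -
  have "continuous_map (top_of_set S2) (powertop_real UNIV) to_nsphere"
    unfolding continuous_map_componentwise_UNIV
  proof
    fix i
    have "continuous_on S2 (\<lambda>x. to_nsphere x i)"
    proof -
      have e: "(\<lambda>x. to_nsphere x i) = (if i = 0 then (\<lambda>x. Re (fst x)) else if i = 1 then (\<lambda>x. Im (fst x))
          else if i = 2 then (\<lambda>x. snd x) else (\<lambda>x. 0))"
        by (auto simp: to_nsphere_def)
      show ?thesis by (subst e) (auto intro!: continuous_intros)
    qed
    then show "continuous_map (top_of_set S2) euclideanreal (\<lambda>x. to_nsphere x i)" by simp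
  qed
  moreover have "to_nsphere ` S2 \<subseteq> topspace (nsphere 2)"
  proof (rule image_subsetI)
    fix x assume "x \<in> S2"
    then have "(cmod (fst x))\<^sup>2 + (snd x)\<^sup>2 = 1" by (simp add: norm_prod_def)
    then show "to_nsphere x \<in> topspace (nsphere 2)"
      by (simp add: topspace_nsphere_2 to_nsphere_def cmod_power2)
  qed
  then have "to_nsphere \<in> topspace (top_of_set S2) \<rightarrow> {x. (\<Sum>i\<le>2. x i ^ 2) = 1 \<and> (\<forall>i>2. x i = 0)}"
    by (auto simp: nsphere)
  ultimately show ?thesis unfolding nsphere continuous_map_in_subtopology by blast
qed

lemma of_nsphere_in_S2: "s \<in> topspace (nsphere 2) \<Longrightarrow> of_nsphere s \<in> S2"
  by (simp add: topspace_nsphere_2 of_nsphere_def norm_prod_def cmod_power2)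

lemma continuous_map_of_nsphere: "continuous_map (nsphere 2) (top_of_set S2) of_nsphere"
proof -
  have p: "continuous_map (nsphere 2) euclideanreal (\<lambda>s. s k)" for k
    by (rule continuous_map_nsphere_projection)
  have "of_nsphere = (\<lambda>s. (complex_of_real (s 0) + \<i> * complex_of_real (s 1), s 2))"
    by (simp add: of_nsphere_def fun_eq_iff complex_eq_iff)
  moreover have "continuous_map (nsphere 2) euclidean (\<lambda>s. (complex_of_real (s 0) + \<i> * complex_of_real (s 1), s 2))"
  proof -
    have c: "continuous_map euclideanreal euclidean complex_of_real"
      "continuous_map euclideanreal euclidean (\<lambda>x. \<i> * complex_of_real x)"
      by (auto intro!: continuous_intros)
    have "continuous_map (nsphere 2) euclidean (\<lambda>s. complex_of_real (s 0) + \<i> * complex_of_real (s 1))"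
      using continuous_map_compose[OF p[of 0] c(1)] continuous_map_compose[OF p[of 1] c(2)]
      by (intro continuous_map_add) (auto simp: o_def)
    then show ?thesis
      unfolding prod_topology_euclidean[symmetric] using p[of 2] by (rule continuous_map_pairedI)
  qed
  ultimately have "continuous_map (nsphere 2) euclidean of_nsphere" by simp
  then show ?thesis
    unfolding continuous_map_in_subtopology using of_nsphere_in_S2 by (intro conjI Pi_I)
qed

lemma to_of_nsphere:
  assumes "s \<in> topspace (nsphere 2)" shows "to_nsphere (of_nsphere s) = s"
proof
  fix i :: nat
  have "s i = 0" if "i \<noteq> 0" "i \<noteq> 1" "i \<noteq> 2"
    using assms that by (auto simp: topspace_nsphere_2)
  then show "to_nsphere (of_nsphere s) i = s i" by (simp add: to_nsphere_def of_nsphere_def)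
qed

lemma of_to_nsphere: "of_nsphere (to_nsphere x) = x"
  by (simp add: to_nsphere_def of_nsphere_def)

text \<open>
  On the complex line through the identity and \<open>M\<close> the determinant is a nonzero polynomial. Its
  roots do not separate the plane, so a path in the complement joins the two matrices.
\<close>

lemma homotopic_moebius_id:
  assumes "det M \<noteq> 0"
  shows "homotopic_with (\<lambda>x. True) (top_of_set S2) (top_of_set S2) id (moebius_act M)"
proof -
  define L :: "complex \<Rightarrow> complex^2^2" where "L z = (\<chi> i j. (1 - z) * (if i = j then 1 else 0) + z * M$i$j)" for z
  define p where "p = [:1, M$1$1 - 1:] * [:1, M$2$2 - 1:] - [:0, M$1$2:] * [:0, M$2$1:]"
  have L: "L z $ i $ j = (1 - z) * (if i = j then 1 else 0) + z * M$i$j" for z i j by (simp add: L_def)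
  have dL: "det (L z) = poly p z" for z by (simp add: det_2 L p_def algebra_simps)
  have L0: "L 0 = mat 1" by (simp add: vec_eq_iff L mat_def)
  have L1: "L 1 = M" by (simp add: vec_eq_iff L)
  have "poly p 0 \<noteq> 0" by (simp add: p_def)
  then have "p \<noteq> 0" by auto
  then have "finite {z. poly p z = 0}" by (rule poly_roots_finite)
  then have "path_connected (UNIV - {z. poly p z = 0})"
    by (intro path_connected_open_diff_countable) (auto intro: countable_finite)
  moreover have "0 \<in> UNIV - {z. poly p z = 0}" "1 \<in> UNIV - {z. poly p z = 0}"
    using dL[of 0] dL[of 1] assms by (auto simp: L0 L1)
  ultimately obtain g where g: "path g" "path_image g \<subseteq> UNIV - {z. poly p z = 0}" "pathstart g = 0" "pathfinish g = 1"
    unfolding path_connected_def by blast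
  have nz: "det (L (g t)) \<noteq> 0" if "t \<in> {0..1}" for t
  proof -
    have "g t \<in> path_image g" using that by (simp add: path_image_def)
    then have "poly p (g t) \<noteq> 0" using g(2) by blast
    then show ?thesis by (simp add: dL)
  qed
  have c: "continuous_on ({0..1} \<times> S2) (\<lambda>q. g (fst q))"
    using g(1) unfolding path_def by (rule continuous_on_compose2) (auto intro: continuous_intros)
  have "continuous_on ({0..1} \<times> S2) (\<lambda>q. moebius_act (L (g (fst q))) (snd q))"
  proof (intro continuous_intros)
    show "continuous_on ({0..1} \<times> S2) (\<lambda>q. L (g (fst q)))"
      unfolding L_def by (intro continuous_on_vec_lambda continuous_intros c)
    show "stretch (L (g (fst q))) (snd q) \<noteq> 0" if "q \<in> {0..1} \<times> S2" for q
      using stretch_pos[OF nz, of "fst q" "snd q"] that by auto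
  qed
  moreover have "(\<lambda>q. moebius_act (L (g (fst q))) (snd q)) ` ({0..1} \<times> S2) \<subseteq> S2"
    using moebius_in_S2[OF nz] by (auto simp del: mem_sphere mem_sphere_0)
  ultimately have "continuous_map (prod_topology (top_of_set {0..1}) (top_of_set S2)) (top_of_set S2)
      (\<lambda>q. moebius_act (L (g (fst q))) (snd q))"
    unfolding prod_topology_subtopology_eu by (simp add: image_subset_iff_funcset)
  then have "homotopic_with (\<lambda>x. True) (top_of_set S2) (top_of_set S2) (moebius_act (mat 1)) (moebius_act M)"
    unfolding homotopic_with_def using g L0 L1
    by (intro exI[of _ "\<lambda>q. moebius_act (L (g (fst q))) (snd q)"]) (simp add: pathstart_def pathfinish_def)
  then show ?thesis
    by (rule homotopic_with_eq) (simp_all add: moebius_one)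
qed

lemma Brouwer_degree_moebius:
  assumes "det M \<noteq> 0"
  shows "Brouwer_degree2 2 (to_nsphere \<circ> moebius_act M \<circ> of_nsphere) = 1"
proof -
  have "homotopic_with (\<lambda>x. True) (nsphere 2) (nsphere 2) (to_nsphere \<circ> id \<circ> of_nsphere) (to_nsphere \<circ> moebius_act M \<circ> of_nsphere)"
    by (rule homotopic_with_compose_continuous_map_right[OF
          homotopic_with_compose_continuous_map_left[OF homotopic_moebius_id[OF assms] continuous_map_to_nsphere]
          continuous_map_of_nsphere]) auto
  then have "Brouwer_degree2 2 (to_nsphere \<circ> moebius_act M \<circ> of_nsphere) = Brouwer_degree2 2 (to_nsphere \<circ> id \<circ> of_nsphere)"
    using Brouwer_degree2_homotopic by metis
  also have "\<dots> = Brouwer_degree2 2 id"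
    by (rule Brouwer_degree2_eq) (simp add: to_of_nsphere)
  finally show ?thesis by simp
qed

lemma continuous_map_S2:
  assumes "continuous_on S2 f" "\<And>x. x \<in> S2 \<Longrightarrow> f x \<in> S2"
  shows "continuous_map (top_of_set S2) (top_of_set S2) f"
  unfolding continuous_map_subtopology_eu using assms by (intro conjI Pi_I)

lemma continuous_map_nsphere_conjugate:
  assumes "continuous_map (top_of_set S2) (top_of_set S2) f"
  shows "continuous_map (nsphere 2) (nsphere 2) (to_nsphere \<circ> f \<circ> of_nsphere)"
  by (rule continuous_map_compose[OF continuous_map_of_nsphere
        continuous_map_compose[OF assms continuous_map_to_nsphere]])

text \<open>
  The reflection whose degree is known reverses the first coordinate, conjugation the second. They
  differ by the half turn about the axis, which is the Moebius transformation \<open>D\<close>.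
\<close>

lemma Brouwer_degree_conj_S2:
  "Brouwer_degree2 2 (to_nsphere \<circ> conj_S2 \<circ> of_nsphere) = -1"
proof -
  define D :: "complex^2^2" where "D = vector [vector [\<i>, 0], vector [0, - \<i>]]"
  have D: "D$1$1 = \<i>" "D$1$2 = 0" "D$2$1 = 0" "D$2$2 = - \<i>" by (simp_all add: D_def)
  have dD: "det D \<noteq> 0" by (simp add: det_2 D)
  have "stretch D x = 1" for x by (simp add: stretch_def D add_divide_distrib[symmetric])
  then have mD: "moebius_act D x = (- fst x, snd x)" for x
    by (simp add: moebius_act_def D add_divide_distrib diff_divide_distrib)
  let ?r = "\<lambda>(x :: nat \<Rightarrow> real) i. if i = 0 then - x i else x i"
  have cD: "continuous_map (top_of_set S2) (top_of_set S2) (moebius_act D)"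
    by (rule continuous_map_S2[OF continuous_on_moebius_S2[OF dD] moebius_in_S2[OF dD]])
  have "Brouwer_degree2 2 (to_nsphere \<circ> conj_S2 \<circ> of_nsphere) = Brouwer_degree2 2 ((to_nsphere \<circ> moebius_act D \<circ> of_nsphere) \<circ> ?r)"
  proof (rule Brouwer_degree2_eq)
    fix s :: "nat \<Rightarrow> real"
    have "- Complex (- s 0) (s 1) = Complex (s 0) (- s 1)" by (simp add: complex_eq_iff)
    then show "(to_nsphere \<circ> conj_S2 \<circ> of_nsphere) s = (to_nsphere \<circ> moebius_act D \<circ> of_nsphere \<circ> ?r) s"
      by (simp add: mD conj_S2_def of_nsphere_def complex_cnj)
  qed
  also have "\<dots> = Brouwer_degree2 2 (to_nsphere \<circ> moebius_act D \<circ> of_nsphere) * Brouwer_degree2 2 ?r"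
    by (rule Brouwer_degree2_compose[OF continuous_map_nsphere_reflection continuous_map_nsphere_conjugate[OF cD]])
  also have "\<dots> = -1" using Brouwer_degree_moebius[OF dD] Brouwer_degree2_reflection[of 2] by simp
  finally show ?thesis .
qed

lemma orientation_preserving_moebius:
  assumes "det A \<noteq> 0" "\<And>x. x \<in> S2 \<Longrightarrow> h x = moebius_act A x"
  shows "orientation_preserving h"
proof -
  have "Brouwer_degree2 2 (to_nsphere \<circ> h \<circ> of_nsphere) = Brouwer_degree2 2 (to_nsphere \<circ> moebius_act A \<circ> of_nsphere)"
    by (rule Brouwer_degree2_eq) (simp add: assms(2) of_nsphere_in_S2 del: mem_sphere mem_sphere_0)
  then show ?thesis using Brouwer_degree_moebius[OF assms(1)] by (simp add: orientation_preserving_def)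
qed

lemma orientation_reversing_moebius_conj:
  assumes "det A \<noteq> 0" "\<And>x. x \<in> S2 \<Longrightarrow> h x = moebius_act A (conj_S2 x)"
  shows "\<not> orientation_preserving h"
proof -
  have cA: "continuous_map (top_of_set S2) (top_of_set S2) (moebius_act A)"
    by (rule continuous_map_S2[OF continuous_on_moebius_S2[OF assms(1)] moebius_in_S2[OF assms(1)]])
  have "continuous_on S2 conj_S2" unfolding conj_S2_def[abs_def] by (intro continuous_intros)
  then have cc: "continuous_map (top_of_set S2) (top_of_set S2) conj_S2"
    by (rule continuous_map_S2) (simp add: conj_S2_def norm_prod_def)
  have "Brouwer_degree2 2 (to_nsphere \<circ> h \<circ> of_nsphere)
     = Brouwer_degree2 2 ((to_nsphere \<circ> moebius_act A \<circ> of_nsphere) \<circ> (to_nsphere \<circ> conj_S2 \<circ> of_nsphere))"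
    by (rule Brouwer_degree2_eq) (simp add: assms(2) of_nsphere_in_S2 of_to_nsphere del: mem_sphere mem_sphere_0)
  also have "\<dots> = Brouwer_degree2 2 (to_nsphere \<circ> moebius_act A \<circ> of_nsphere) * Brouwer_degree2 2 (to_nsphere \<circ> conj_S2 \<circ> of_nsphere)"
    by (rule Brouwer_degree2_compose[OF continuous_map_nsphere_conjugate[OF cc] continuous_map_nsphere_conjugate[OF cA]])
  also have "\<dots> = -1" using Brouwer_degree_moebius[OF assms(1)] Brouwer_degree_conj_S2 by simp
  finally show ?thesis by (simp add: orientation_preserving_def)
qed

section \<open>The area of spherical caps\<close>

abbreviation borel_S2 :: "(complex \<times> real) measure"
  where "borel_S2 \<equiv> restrict_space borel S2"

definition cap :: "complex \<times> real \<Rightarrow> real \<Rightarrow> (complex \<times> real) set"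
  where "cap x r = S2 \<inter> cball x r"

lemma sets_borel_S2: "B \<in> sets borel_S2 \<longleftrightarrow> B \<subseteq> S2 \<and> B \<in> sets borel"
  by (rule sets_restrict_space_iff) simp

lemma cap_sets [measurable]: "cap x r \<in> sets borel_S2"
  unfolding sets_borel_S2 cap_def by simp

lemma closed_S2_sets: "closed K \<Longrightarrow> K \<subseteq> S2 \<Longrightarrow> K \<in> sets borel_S2"
  unfolding sets_borel_S2 by simp

lemma sgn_measurable: "sgn \<in> measurable (restrict_space lborel (ball 0 1 - {0})) borel_S2"
proof (rule measurable_restrict_space2)
  show "sgn \<in> space (restrict_space lborel (ball 0 1 - {0})) \<rightarrow> S2"
    by (auto simp: space_restrict_space norm_sgn)
  show "sgn \<in> borel_measurable (restrict_space lborel (ball 0 1 - {0}))"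
    unfolding sgn_div_norm[abs_def] by (intro measurable_restrict_space1) measurable
qed

lemma sets_sphere_area: "sets sphere_area = sets borel_S2"
  by (simp add: sphere_area_def)

lemma emeasure_sphere_area:
  assumes "B \<in> sets borel_S2"
  shows "emeasure sphere_area B = 3 * emeasure lborel {y \<in> ball 0 1 - {0}. sgn y \<in> B}"
proof -
  let ?R = "restrict_space lborel (ball 0 1 - {0}) :: (complex \<times> real) measure"
  have sp: "space ?R = ball 0 1 - {0}" by (simp add: space_restrict_space)
  have "emeasure (distr ?R borel_S2 sgn) B = emeasure ?R (sgn -` B \<inter> space ?R)"
    by (rule emeasure_distr[OF sgn_measurable assms])
  also have "\<dots> = emeasure lborel (sgn -` B \<inter> space ?R)"
    unfolding sp by (rule emeasure_restrict_space) auto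
  also have "sgn -` B \<inter> space ?R = {y \<in> ball 0 1 - {0}. sgn y \<in> B}" unfolding sp by auto
  finally show ?thesis by (simp add: sphere_area_def)
qed

text \<open>
  The part of the ball over a cap, whose volume is a third of the area of the cap. Its volume is
  compared with $r^2$ by counting how many points of the axis lie close to a given point: a Fubini
  argument that needs only the volume of balls, and treats all centres alike.
\<close>

definition solid_cone :: "complex \<times> real \<Rightarrow> real \<Rightarrow> (complex \<times> real) set"
  where "solid_cone x r = {y \<in> ball 0 1 - {0}. dist (sgn y) x \<le> r}"

lemma cone_sets: "solid_cone x r \<in> sets borel"
proof -
  have "(\<lambda>y :: complex \<times> real. dist (sgn y) x) \<in> borel_measurable borel"
    unfolding sgn_div_norm[abs_def] by measurable
  then have "{y \<in> space borel. dist (sgn y) x \<le> r} \<in> sets borel" by measurable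
  then have "(ball 0 1 - {0}) \<inter> {y. dist (sgn y) x \<le> r} \<in> sets borel" by (intro sets.Int) auto
  moreover have "(ball 0 1 - {0}) \<inter> {y. dist (sgn y) x \<le> r} = solid_cone x r" by (auto simp: solid_cone_def)
  ultimately show ?thesis by simp
qed

lemma area_cap: "emeasure sphere_area (cap x r) = 3 * emeasure lborel (solid_cone x r)"
  unfolding emeasure_sphere_area[OF cap_sets]
  by (rule arg_cong[where f = "\<lambda>X. 3 * emeasure lborel X"]) (auto simp: cap_def solid_cone_def norm_sgn dist_commute)

definition ball_vol3 :: real where "ball_vol3 = unit_ball_vol 3"

lemma ball_vol3_pos: "0 < ball_vol3" unfolding ball_vol3_def by (rule unit_ball_vol_pos) simp

lemma lborel_cball: "0 \<le> r \<Longrightarrow> emeasure lborel (cball (c :: complex \<times> real) r) = ennreal (ball_vol3 * r ^ 3)"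
  using emeasure_cball[of r c] by (simp add: ball_vol3_def)

lemma closed_tube_slice:
  fixes x y :: "'a::real_normed_vector"
  shows "closed {t \<in> {a..b}. dist y (t *\<^sub>R x) \<le> (r::real)}"
proof -
  have "closed {t. dist y (t *\<^sub>R x) \<le> r}" by (intro closed_Collect_le continuous_intros)
  then have "closed ({a..b} \<inter> {t. dist y (t *\<^sub>R x) \<le> r})" by (rule closed_Int[OF closed_atLeastAtMost])
  moreover have "{a..b} \<inter> {t. dist y (t *\<^sub>R x) \<le> r} = {t \<in> {a..b}. dist y (t *\<^sub>R x) \<le> r}" by blast
  ultimately show ?thesis by simp
qed

text \<open>
  Both sides compute the volume of the set of pairs of a point of the segment and a point within
  distance \<open>r\<close> of it.
\<close>

lemma Fubini_tube:
  fixes x :: "complex \<times> real"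
  assumes "a \<le> b" "0 \<le> r"
  shows "(\<integral>\<^sup>+y. emeasure lborel {t \<in> {a..b}. dist y (t *\<^sub>R x) \<le> r} \<partial>lborel) = ennreal ((b - a) * (ball_vol3 * r ^ 3))"
proof -
  define D where "D = {p :: real \<times> (complex \<times> real). fst p \<in> {a..b} \<and> dist (snd p) (fst p *\<^sub>R x) \<le> r}"
  have "closed {p :: real \<times> (complex \<times> real). a \<le> fst p}" "closed {p :: real \<times> (complex \<times> real). fst p \<le> b}"
    "closed {p :: real \<times> (complex \<times> real). dist (snd p) (fst p *\<^sub>R x) \<le> r}"
    by (intro closed_Collect_le continuous_intros)+
  then have "closed D" unfolding D_def by (simp add: Collect_conj_eq closed_Int)
  then have "D \<in> sets (borel \<Otimes>\<^sub>M borel)" unfolding borel_prod by (rule borel_closed)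
  then have D: "D \<in> sets (lborel \<Otimes>\<^sub>M lborel)"
    by (simp only: sets_pair_measure_cong[OF sets_lborel sets_lborel])
  have f: "(\<lambda>(t, y). indicator D (t, y) :: ennreal) \<in> borel_measurable (lborel \<Otimes>\<^sub>M lborel)"
    using D by (simp add: case_prod_unfold)
  have 1: "(\<integral>\<^sup>+t. indicator D (t, y) \<partial>lborel) = emeasure lborel {t \<in> {a..b}. dist y (t *\<^sub>R x) \<le> r}" for y
  proof -
    have T: "{t \<in> {a..b}. dist y (t *\<^sub>R x) \<le> r} \<in> sets lborel"
      unfolding sets_lborel by (rule borel_closed[OF closed_tube_slice])
    have "indicator D (t, y) = (indicator {t \<in> {a..b}. dist y (t *\<^sub>R x) \<le> r} t :: ennreal)" for t
      by (auto simp: D_def indicator_def)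
    then show ?thesis using nn_integral_indicator[OF T] by presburger
  qed
  have 2: "(\<integral>\<^sup>+y. indicator D (t, y) \<partial>lborel) = ennreal (ball_vol3 * r ^ 3) * indicator {a..b} t" for t
  proof -
    have "indicator D (t, y) = indicator {a..b} t * (indicator (cball (t *\<^sub>R x) r) y :: ennreal)" for y
      by (auto simp: D_def indicator_def dist_commute)
    then have "(\<integral>\<^sup>+y. indicator D (t, y) \<partial>lborel) = (\<integral>\<^sup>+y. indicator {a..b} t * indicator (cball (t *\<^sub>R x) r) y \<partial>lborel)"
      by presburger
    also have "\<dots> = indicator {a..b} t * emeasure lborel (cball (t *\<^sub>R x) r)"
      by (rule nn_integral_cmult_indicator) simp
    finally show ?thesis unfolding lborel_cball[OF assms(2)] by (simp add: mult.commute)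
  qed
  have "(\<integral>\<^sup>+y. \<integral>\<^sup>+t. indicator D (t, y) \<partial>lborel \<partial>lborel) = (\<integral>\<^sup>+t. \<integral>\<^sup>+y. indicator D (t, y) \<partial>lborel \<partial>lborel)"
    by (rule lborel_pair.Fubini'[OF f])
  also have "\<dots> = ennreal (ball_vol3 * r ^ 3) * ennreal (b - a)"
    unfolding 2 using assms by (simp add: nn_integral_cmult)
  also have "\<dots> = ennreal ((b - a) * (ball_vol3 * r ^ 3))"
    using assms ball_vol3_pos by (simp add: ennreal_mult mult.commute)
  finally show ?thesis unfolding 1 .
qed

lemma ennreal_scale_cancel:
  assumes "0 < r" "ennreal r * a \<le> ennreal r * b" shows "a \<le> b"
  using assms by (subst (asm) ennreal_mult_le_mult_iff) auto

text \<open>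
  A point of the cone has distance at most $2r$ from all points of the axis within $r/2$ of the
  point of the axis that has the same norm.
\<close>

lemma cone_upper:
  assumes x: "x \<in> S2" and r: "0 < r"
  shows "emeasure lborel (solid_cone x r) \<le> ennreal (24 * ball_vol3 * r\<^sup>2)"
proof (cases "r \<le> 2")
  case True
  have "ennreal r * emeasure lborel (solid_cone x r) = (\<integral>\<^sup>+y. ennreal r * indicator (solid_cone x r) y \<partial>lborel)"
    using cone_sets by (simp add: nn_integral_cmult)
  also have "\<dots> \<le> (\<integral>\<^sup>+y. emeasure lborel {t \<in> {- r / 2..1 + r / 2}. dist y (t *\<^sub>R x) \<le> 2 * r} \<partial>lborel)"
  proof (rule nn_integral_mono)
    fix y :: "complex \<times> real"
    let ?T = "{t \<in> {- r / 2..1 + r / 2}. dist y (t *\<^sub>R x) \<le> 2 * r}"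
    show "ennreal r * indicator (solid_cone x r) y \<le> emeasure lborel ?T"
    proof (cases "y \<in> solid_cone x r")
      case True
      then have y: "norm y < 1" "y \<noteq> 0" "norm (sgn y - x) \<le> r" by (auto simp: solid_cone_def dist_norm)
      have "y - norm y *\<^sub>R x = norm y *\<^sub>R (sgn y - x)"
        using y(2) by (simp add: sgn_div_norm algebra_simps)
      then have "norm (y - norm y *\<^sub>R x) = norm y * norm (sgn y - x)" by simp
      also have "\<dots> \<le> 1 * r" using y by (intro mult_mono) auto
      finally have n: "norm (y - norm y *\<^sub>R x) \<le> r" by simp
      have "{norm y - r / 2..norm y + r / 2} \<subseteq> ?T"
      proof
        fix t assume t: "t \<in> {norm y - r / 2..norm y + r / 2}"
        then have "\<bar>norm y - t\<bar> \<le> r / 2" unfolding atLeastAtMost_iff by linarith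
        have "y - t *\<^sub>R x = (y - norm y *\<^sub>R x) + (norm y - t) *\<^sub>R x" by (simp add: algebra_simps)
        then have "norm (y - t *\<^sub>R x) \<le> norm (y - norm y *\<^sub>R x) + norm ((norm y - t) *\<^sub>R x)"
          by (metis norm_triangle_ineq)
        also have "norm ((norm y - t) *\<^sub>R x) = \<bar>norm y - t\<bar>" using x by simp
        finally have "dist y (t *\<^sub>R x) \<le> 2 * r" using n \<open>\<bar>norm y - t\<bar> \<le> r / 2\<close> r by (simp add: dist_norm)
        moreover have "t \<in> {- r / 2..1 + r / 2}" using t y(1) norm_ge_zero[of y] unfolding atLeastAtMost_iff by linarith
        ultimately show "t \<in> ?T" by simp
      qed
      moreover have "?T \<in> sets lborel"
        unfolding sets_lborel by (rule borel_closed[OF closed_tube_slice])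
      ultimately have "emeasure lborel {norm y - r / 2..norm y + r / 2} \<le> emeasure lborel ?T"
        by (rule emeasure_mono)
      then show ?thesis using True r by simp
    qed simp
  qed
  also have "\<dots> = ennreal ((1 + r / 2 - (- r / 2)) * (ball_vol3 * (2 * r) ^ 3))"
    using r by (intro Fubini_tube) auto
  also have "\<dots> \<le> ennreal (r * (24 * ball_vol3 * r\<^sup>2))"
  proof (rule ennreal_leI)
    have "(1 + r / 2 - (- r / 2)) * (ball_vol3 * (2 * r) ^ 3) = (1 + r) * (8 * ball_vol3 * r ^ 3)"
      by (simp add: power_mult_distrib)
    also have "\<dots> \<le> 3 * (8 * ball_vol3 * r ^ 3)" using True r ball_vol3_pos by (intro mult_right_mono) auto
    also have "\<dots> = r * (24 * ball_vol3 * r\<^sup>2)" by (simp add: power2_eq_square power3_eq_cube)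
    finally show "(1 + r / 2 - (- r / 2)) * (ball_vol3 * (2 * r) ^ 3) \<le> r * (24 * ball_vol3 * r\<^sup>2)" .
  qed
  also have "\<dots> = ennreal r * ennreal (24 * ball_vol3 * r\<^sup>2)" using r ball_vol3_pos by (simp add: ennreal_mult)
  finally show ?thesis by (rule ennreal_scale_cancel[OF r])
next
  case False
  have "emeasure lborel (solid_cone x r) \<le> emeasure lborel (cball (0 :: complex \<times> real) 1)"
    by (rule emeasure_mono) (auto simp: solid_cone_def)
  also have "\<dots> = ennreal ball_vol3" by (simp add: lborel_cball)
  also have "\<dots> \<le> ennreal (24 * ball_vol3 * r\<^sup>2)"
  proof (rule ennreal_leI)
    have "1 \<le> r\<^sup>2" using False by (simp add: one_le_power)
    then have "ball_vol3 * 1 \<le> ball_vol3 * (24 * r\<^sup>2)" using ball_vol3_pos by (intro mult_left_mono) auto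
    then show "ball_vol3 \<le> 24 * ball_vol3 * r\<^sup>2" by simp
  qed
  finally show ?thesis .
qed

text \<open>
  A point within $r/8$ of some point of the middle part of the axis lies in the cone, and the points
  of the axis that are so close to it fill at most an interval of length $r/4$.
\<close>

lemma cone_lower:
  assumes x: "x \<in> S2" and r: "0 < r" "r \<le> 1"
  shows "ennreal (ball_vol3 * r\<^sup>2 / 512) \<le> emeasure lborel (solid_cone x r)"
proof -
  have "ennreal (r / 4) * ennreal (ball_vol3 * r\<^sup>2 / 512) = ennreal ((3 / 4 - 1 / 2) * (ball_vol3 * (r / 8) ^ 3))"
    using r ball_vol3_pos by (simp add: ennreal_mult[symmetric] power_divide power2_eq_square power3_eq_cube)
  also have "\<dots> = (\<integral>\<^sup>+y. emeasure lborel {t \<in> {1 / 2..3 / 4}. dist y (t *\<^sub>R x) \<le> r / 8} \<partial>lborel)"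
    using r by (intro Fubini_tube[symmetric]) auto
  also have "\<dots> \<le> (\<integral>\<^sup>+y. ennreal (r / 4) * indicator (solid_cone x r) y \<partial>lborel)"
  proof (rule nn_integral_mono)
    fix y :: "complex \<times> real"
    let ?T = "{t \<in> {1 / 2..3 / 4}. dist y (t *\<^sub>R x) \<le> r / 8}"
    show "emeasure lborel ?T \<le> ennreal (r / 4) * indicator (solid_cone x r) y"
    proof (cases "?T = {}")
      case True
      then have "emeasure lborel ?T = 0" by (simp only: emeasure_empty)
      then show ?thesis by simp
    next
      case False
      have T: "\<bar>norm y - t\<bar> \<le> r / 8" if "t \<in> ?T" for t
      proof -
        have "norm (t *\<^sub>R x) = t" using that x by simp
        then have "\<bar>norm y - t\<bar> \<le> norm (y - t *\<^sub>R x)" using norm_triangle_ineq3[of y "t *\<^sub>R x"] by simp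
        then show ?thesis using that by (simp add: dist_norm)
      qed
      obtain t where t: "t \<in> ?T" using False by blast
      then have t': "1 / 2 \<le> t" "t \<le> 3 / 4" "norm (y - t *\<^sub>R x) \<le> r / 8" by (auto simp: dist_norm)
      have "norm y < 1" "0 < norm y" using T[OF t] t' r by linarith+
      then have ny: "norm y < 1" "y \<noteq> 0" by auto
      have "t *\<^sub>R (sgn y - x) = (y - t *\<^sub>R x) + ((t - norm y) / norm y) *\<^sub>R y"
        using ny(2) by (simp add: sgn_div_norm algebra_simps divide_inverse)
      then have "norm (t *\<^sub>R (sgn y - x)) \<le> norm (y - t *\<^sub>R x) + norm (((t - norm y) / norm y) *\<^sub>R y)"
        by (metis norm_triangle_ineq)
      also have "norm (((t - norm y) / norm y) *\<^sub>R y) = \<bar>norm y - t\<bar>" using ny(2) by (simp add: abs_minus_commute)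
      finally have "t * norm (sgn y - x) \<le> r / 4" using T[OF t] t' by simp
      moreover have "1 / 2 * norm (sgn y - x) \<le> t * norm (sgn y - x)" using t' by (intro mult_right_mono) auto
      ultimately have "norm (sgn y - x) \<le> r" using r by simp
      then have yc: "y \<in> solid_cone x r" using ny by (simp add: solid_cone_def dist_norm)
      have "emeasure lborel ?T \<le> emeasure lborel {norm y - r / 8..norm y + r / 8}"
      proof (rule emeasure_mono)
        show "?T \<subseteq> {norm y - r / 8..norm y + r / 8}"
        proof
          fix s assume "s \<in> ?T"
          from T[OF this] show "s \<in> {norm y - r / 8..norm y + r / 8}" unfolding atLeastAtMost_iff by linarith
        qed
      qed simp
      then show ?thesis using yc r by simp
    qed
  qed
  also have "\<dots> = ennreal (r / 4) * emeasure lborel (solid_cone x r)"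
    using cone_sets by (simp add: nn_integral_cmult)
  finally show ?thesis by (rule ennreal_scale_cancel[rotated]) (use r in simp)
qed

lemma area_cap_upper:
  assumes "x \<in> S2" "0 < r" shows "emeasure sphere_area (cap x r) \<le> ennreal (72 * ball_vol3 * r\<^sup>2)"
proof -
  have "emeasure sphere_area (cap x r) \<le> ennreal 3 * ennreal (24 * ball_vol3 * r\<^sup>2)"
    unfolding area_cap using cone_upper[OF assms] by (simp add: mult_left_mono)
  also have "\<dots> = ennreal (72 * ball_vol3 * r\<^sup>2)" using ball_vol3_pos by (subst ennreal_mult[symmetric]) auto
  finally show ?thesis .
qed

lemma area_cap_lower:
  assumes "x \<in> S2" "0 < r" "r \<le> 1" shows "ennreal (ball_vol3 / 512 * r\<^sup>2) \<le> emeasure sphere_area (cap x r)"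
proof -
  have "ennreal (ball_vol3 / 512 * r\<^sup>2) \<le> 1 * emeasure lborel (solid_cone x r)" using cone_lower[OF assms] by simp
  also have "\<dots> \<le> 3 * emeasure lborel (solid_cone x r)" by (rule mult_right_mono) auto
  finally show ?thesis unfolding area_cap .
qed

lemma cap_2: assumes "x \<in> S2" shows "cap x 2 = S2"
proof -
  have "dist x y \<le> 2" if "y \<in> S2" for y
    using norm_triangle_ineq4[of x y] assms that by (simp add: dist_norm)
  then show ?thesis by (auto simp: cap_def)
qed

lemma finite_measure_sphere_area: "finite_measure sphere_area"
proof
  have "space sphere_area = S2" using sets_eq_imp_space_eq[OF sets_sphere_area] by (simp add: space_restrict_space)
  then have "emeasure sphere_area (space sphere_area) = emeasure sphere_area (cap (0, 1) 2)"
    using cap_2[of "(0, 1)"] by (simp add: norm_prod_def)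
  also have "\<dots> \<le> ennreal (72 * ball_vol3 * 2\<^sup>2)" by (rule area_cap_upper) (auto simp: norm_prod_def)
  finally show "emeasure sphere_area (space sphere_area) \<noteq> \<infinity>" by (auto simp: top_unique)
qed

section \<open>Comparing measures by their values on caps\<close>

text \<open>
  Both integrals measure sets of pairs of points at distance at most \<open>r\<close>: on the left one
  point lies in \<open>K\<close>, and then the other one lies in the thickening of \<open>K\<close>.
\<close>

lemma cap_Fubini:
  assumes m: "finite_measure m1" "finite_measure m2" "sets m1 = sets borel_S2" "sets m2 = sets borel_S2"
    and K: "closed K" "K \<subseteq> S2"
  shows "(\<integral>\<^sup>+y\<in>K. emeasure m1 (cap y r) \<partial>m2)
    \<le> (\<integral>\<^sup>+x\<in>{x \<in> S2. infdist x K \<le> r}. emeasure m2 (cap x r) \<partial>m1)"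
proof -
  interpret m1: finite_measure m1 by fact
  interpret m2: finite_measure m2 by fact
  interpret pair_sigma_finite m1 m2 ..
  have sp: "space m1 = S2" "space m2 = S2"
    using sets_eq_imp_space_eq[OF m(3)] sets_eq_imp_space_eq[OF m(4)] by (simp_all add: space_restrict_space)
  have id: "(\<lambda>x. x) \<in> measurable borel_S2 borel" by (rule measurable_restrict_space1) simp
  have [measurable]: "(\<lambda>x. x) \<in> measurable m1 borel" "(\<lambda>x. x) \<in> measurable m2 borel"
    using id by (simp_all add: measurable_cong_sets[OF m(3) refl] measurable_cong_sets[OF m(4) refl])
  have [measurable]: "K \<in> sets borel" using K(1) by simp
  have fst: "fst \<in> measurable (m1 \<Otimes>\<^sub>M m2) borel" and snd: "snd \<in> measurable (m1 \<Otimes>\<^sub>M m2) borel"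
    using measurable_compose[OF measurable_fst[of m1 m2], of "\<lambda>x. x" borel]
      measurable_compose[OF measurable_snd[of m1 m2], of "\<lambda>x. x" borel] by simp_all
  define f :: "complex \<times> real \<Rightarrow> complex \<times> real \<Rightarrow> ennreal"
    where "f x y = indicator {..r} (dist x y) * indicator K y" for x y
  have fm: "case_prod f \<in> borel_measurable (m1 \<Otimes>\<^sub>M m2)"
    unfolding f_def case_prod_unfold using fst snd by measurable
  have sp1: "(\<integral>\<^sup>+x. f x y \<partial>m1) = emeasure m1 (cap y r) * indicator K y" if "y \<in> space m2" for y
  proof -
    have "(\<integral>\<^sup>+x. f x y \<partial>m1) = (\<integral>\<^sup>+x. indicator K y * indicator (cap y r) x \<partial>m1)"
      by (rule nn_integral_cong) (auto simp: f_def indicator_def cap_def sp dist_commute)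
    then show ?thesis using m by (simp add: nn_integral_cmult mult.commute)
  qed
  have sp2: "(\<integral>\<^sup>+y. f x y \<partial>m2) \<le> emeasure m2 (cap x r) * indicator {x \<in> S2. infdist x K \<le> r} x" if "x \<in> space m1" for x
  proof (cases "infdist x K \<le> r")
    case True
    have "(\<integral>\<^sup>+y. f x y \<partial>m2) \<le> (\<integral>\<^sup>+y. indicator (cap x r) y \<partial>m2)"
      by (rule nn_integral_mono) (auto simp: f_def indicator_def cap_def sp)
    then show ?thesis using True that m by (simp add: sp)
  next
    case False
    have "f x y = 0" for y
    proof (cases "y \<in> K")
      case True
      then have "infdist x K \<le> dist x y" by (rule infdist_le)
      then show ?thesis using False by (simp add: f_def)
    qed (simp add: f_def)
    then show ?thesis by simp
  qed
  have "(\<integral>\<^sup>+y\<in>K. emeasure m1 (cap y r) \<partial>m2) = (\<integral>\<^sup>+y. \<integral>\<^sup>+x. f x y \<partial>m1 \<partial>m2)"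
    by (rule nn_integral_cong) (simp add: sp1)
  also have "\<dots> = (\<integral>\<^sup>+x. \<integral>\<^sup>+y. f x y \<partial>m2 \<partial>m1)"
    by (rule Fubini'[OF fm])
  also have "\<dots> \<le> (\<integral>\<^sup>+x\<in>{x \<in> S2. infdist x K \<le> r}. emeasure m2 (cap x r) \<partial>m1)"
    by (rule nn_integral_mono) (rule sp2)
  finally show ?thesis .
qed

lemma thickening_closed: "closed {x \<in> S2. infdist x K \<le> r}"
proof -
  have "closed {x. infdist x K \<le> r}" by (intro closed_Collect_le continuous_intros)
  then have "closed (S2 \<inter> {x. infdist x K \<le> r})" by (rule closed_Int[OF closed_sphere])
  then show ?thesis by (simp add: Int_def)
qed

text \<open>
  By \<open>cap_Fubini\<close> the second measure of \<open>K\<close> is at most \<open>c\<close> times the first measure of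
  its closed $r$-neighbourhood; then let $r$ tend to 0.
\<close>

lemma domination_closed:
  assumes m: "finite_measure m1" "finite_measure m2" "sets m1 = sets borel_S2" "sets m2 = sets borel_S2"
    and \<phi>: "\<And>r. 0 < r \<Longrightarrow> r \<le> 1 \<Longrightarrow> 0 < \<phi> r" and c: "0 \<le> c"
    and lower: "\<And>x r. x \<in> S2 \<Longrightarrow> 0 < r \<Longrightarrow> r \<le> 1 \<Longrightarrow> ennreal (\<phi> r) \<le> emeasure m1 (cap x r)"
    and upper: "\<And>x r. x \<in> S2 \<Longrightarrow> 0 < r \<Longrightarrow> r \<le> 1 \<Longrightarrow> emeasure m2 (cap x r) \<le> ennreal (c * \<phi> r)"
    and K: "closed K" "K \<subseteq> S2"
  shows "emeasure m2 K \<le> ennreal c * emeasure m1 K"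
proof (cases "K = {}")
  case False
  define T where "T n = {x \<in> S2. infdist x K \<le> 1 / Suc n}" for n :: nat
  have Ts: "T n \<in> sets m1" for n
    unfolding m(3) T_def by (rule closed_S2_sets[OF thickening_closed]) blast
  have Ks: "K \<in> sets m1" "K \<in> sets m2" using closed_S2_sets[OF K] m by simp_all
  have sp: "space m2 = S2" "space m1 = S2"
    using sets_eq_imp_space_eq[OF m(3)] sets_eq_imp_space_eq[OF m(4)] by (simp_all add: space_restrict_space)
  have le: "emeasure m2 K \<le> ennreal c * emeasure m1 (T n)" for n
  proof -
    define r where "r = 1 / real (Suc n)"
    have r: "0 < r" "r \<le> 1" by (auto simp: r_def)
    have "ennreal (\<phi> r) * emeasure m2 K = (\<integral>\<^sup>+y. ennreal (\<phi> r) * indicator K y \<partial>m2)"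
      using Ks by (simp add: nn_integral_cmult)
    also have "\<dots> \<le> (\<integral>\<^sup>+y\<in>K. emeasure m1 (cap y r) \<partial>m2)"
      using lower r K by (intro nn_integral_mono mult_right_mono) (auto simp: sp indicator_def)
    also have "\<dots> \<le> (\<integral>\<^sup>+x\<in>T n. emeasure m2 (cap x r) \<partial>m1)"
      unfolding T_def r_def by (rule cap_Fubini[OF m K])
    also have "\<dots> \<le> (\<integral>\<^sup>+x. ennreal (c * \<phi> r) * indicator (T n) x \<partial>m1)"
      using upper r by (intro nn_integral_mono mult_right_mono) (auto simp: sp)
    also have "\<dots> = ennreal (\<phi> r) * (ennreal c * emeasure m1 (T n))"
      using Ts c \<phi>[OF r] by (simp add: nn_integral_cmult ennreal_mult mult_ac)
    finally show ?thesis by (rule ennreal_scale_cancel[OF \<phi>[OF r]])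
  qed
  have "(\<lambda>n. emeasure m1 (T n)) \<longlonglongrightarrow> emeasure m1 (\<Inter>n. T n)"
  proof (rule Lim_emeasure_decseq)
    show "range T \<subseteq> sets m1" using Ts by blast
    show "decseq T"
    proof (rule decseq_SucI)
      fix n
      have "1 / real (Suc (Suc n)) \<le> 1 / real (Suc n)" by (simp add: frac_le)
      then show "T (Suc n) \<subseteq> T n" unfolding T_def by (auto intro: order_trans)
    qed
    show "emeasure m1 (T n) \<noteq> \<infinity>" for n
      using finite_measure.emeasure_finite[OF m(1)] by simp
  qed
  moreover have "(\<Inter>n. T n) = K"
  proof
    show "K \<subseteq> (\<Inter>n. T n)" using K by (auto simp: T_def)
    show "(\<Inter>n. T n) \<subseteq> K"
    proof
      fix x assume "x \<in> (\<Inter>n. T n)"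
      then have x: "infdist x K \<le> inverse (real (Suc n))" for n by (auto simp: T_def inverse_eq_divide)
      have "infdist x K \<le> 0"
        by (rule LIMSEQ_le_const[OF LIMSEQ_inverse_real_of_nat]) (use x in blast)
      then have "infdist x K = 0" using infdist_nonneg[of x K] by simp
      then show "x \<in> K" using in_closed_iff_infdist_zero[OF K(1) False] by blast
    qed
  qed
  ultimately have "(\<lambda>n. ennreal c * emeasure m1 (T n)) \<longlonglongrightarrow> ennreal c * emeasure m1 K"
    by (intro ennreal_tendsto_cmult) auto
  then show ?thesis by (rule LIMSEQ_le_const) (use le in blast)
qed simp

lemma domination:
  assumes m: "finite_measure m1" "finite_measure m2" "sets m1 = sets borel_S2" "sets m2 = sets borel_S2"
    and cl: "\<And>K. closed K \<Longrightarrow> K \<subseteq> S2 \<Longrightarrow> emeasure m2 K \<le> ennreal c * emeasure m1 K"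
    and B: "B \<in> sets borel_S2"
  shows "emeasure m2 B \<le> ennreal c * emeasure m1 B"
proof -
  have id: "(\<lambda>x. x) \<in> measurable m2 borel"
    unfolding measurable_cong_sets[OF m(4) refl] by (rule measurable_restrict_space1) simp
  have sp: "space m2 = S2" using sets_eq_imp_space_eq[OF m(4)] by (simp add: space_restrict_space)
  define M where "M = distr m2 borel (\<lambda>x. x)"
  have M: "emeasure M A = emeasure m2 (A \<inter> S2)" if "A \<in> sets borel" for A
    unfolding M_def using emeasure_distr[OF id that] by (simp add: sp)
  have B': "B \<subseteq> S2" "B \<in> sets borel" using B sets_borel_S2 by auto
  have "emeasure M B = (SUP K\<in>{K. K \<subseteq> B \<and> compact K}. emeasure M K)"
  proof (rule inner_regular)
    show "sets M = sets borel" by (simp add: M_def)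
    have "emeasure M (space M) = emeasure m2 S2" using M[of UNIV] by (simp add: M_def)
    then show "emeasure M (space M) \<noteq> \<infinity>"
      using finite_measure.emeasure_finite[OF m(2)] by simp
  qed (rule B')
  also have "\<dots> \<le> ennreal c * emeasure m1 B"
  proof (rule SUP_least)
    fix K assume K: "K \<in> {K. K \<subseteq> B \<and> compact K}"
    then have K': "closed K" "K \<subseteq> S2" "K \<subseteq> B" using B' compact_imp_closed by auto
    have "K \<inter> S2 = K" using K' by blast
    then have "emeasure M K = emeasure m2 K" using M[of K] K' by simp
    also have "\<dots> \<le> ennreal c * emeasure m1 K" using cl K' by blast
    also have "\<dots> \<le> ennreal c * emeasure m1 B"
      using K' B m by (intro mult_left_mono emeasure_mono) auto
    finally show "emeasure M K \<le> ennreal c * emeasure m1 B" .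
  qed
  also have "emeasure M B = emeasure m2 B" using M[OF B'(2)] B'(1) by (simp add: Int_absorb2)
  finally show ?thesis .
qed

text \<open>
  The unitary matrix whose first column is a unit lift of \<open>x\<close>.
\<close>

lemma transitive_isometry:
  assumes "x \<in> S2"
  shows "\<exists>A. det A = 1 \<and> moebius_act A (0, 1) = x \<and> (\<forall>y. stretch A y = 1)"
proof -
  obtain v where v: "v \<noteq> 0" "hopf v = x" using hopf_surj assms by blast
  define w where "w = complex_of_real (1 / norm v) *s v"
  have w1: "(cmod (w$1))\<^sup>2 + (cmod (w$2))\<^sup>2 = 1"
  proof -
    have "(cmod (w$1))\<^sup>2 + (cmod (w$2))\<^sup>2 = ((cmod (v$1))\<^sup>2 + (cmod (v$2))\<^sup>2) / (norm v)\<^sup>2"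
      by (simp add: w_def norm_mult norm_divide power_divide add_divide_distrib)
    also have "\<dots> = 1" unfolding norm_vec2_sq[symmetric] using v by simp
    finally show ?thesis .
  qed
  have w: "w \<noteq> 0" "hopf w = x"
    using v hopf_scale[of "complex_of_real (1 / norm v)" v] by (auto simp: w_def)
  define A :: "complex^2^2" where "A = vector [vector [w$1, - cnj (w$2)], vector [w$2, cnj (w$1)]]"
  have A: "A$1$1 = w$1" "A$1$2 = - cnj (w$2)" "A$2$1 = w$2" "A$2$2 = cnj (w$1)" by (simp_all add: A_def)
  have "det A = complex_of_real ((cmod (w$1))\<^sup>2 + (cmod (w$2))\<^sup>2)"
    unfolding of_real_add complex_norm_square by (simp add: det_2 A)
  then have dA: "det A = 1" unfolding w1 by simp
  have e: "A *v vector [1, 0] = w" by (simp add: vec_eq_iff forall_2 matvec2 A)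
  have N: "hopf (vector [1, 0]) = (0, 1)" by (rule hopf_pole) (simp_all add: vector2_nz)
  have "moebius_act A (0, 1) = x"
    unfolding N[symmetric] using w by (simp add: moebius_hopf vector2_nz e)
  moreover have "stretch A y = 1" for y
  proof -
    have "(cmod (w$2))\<^sup>2 + (cmod (w$1))\<^sup>2 = 1" using w1 by simp
    then show ?thesis by (simp add: stretch_def A w1 mult.commute add_divide_distrib[symmetric])
  qed
  ultimately show ?thesis using dA by blast
qed

lemma moebius_preimage_closed:
  assumes "det A = 1" shows "closed {y \<in> S2. moebius_act A y \<in> cball p r}"
proof -
  have "closed (S2 \<inter> moebius_act A -` cball p r)"
    by (rule continuous_closed_preimage) (use assms continuous_on_moebius_S2 in auto)
  moreover have "S2 \<inter> moebius_act A -` cball p r = {y \<in> S2. moebius_act A y \<in> cball p r}" by blast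
  ultimately show ?thesis by simp
qed

lemma moebius_image_preimage:
  assumes "det A = 1"
  shows "moebius_act A ` {y \<in> S2. moebius_act A y \<in> cball p r} = cap p r"
proof -
  obtain B where B: "det B = 1" "\<And>x. x \<in> S2 \<Longrightarrow> moebius_act B (moebius_act A x) = x"
    "\<And>x. x \<in> S2 \<Longrightarrow> moebius_act A (moebius_act B x) = x" using moebius_inverse[OF assms] by metis
  have "det A \<noteq> 0" "det B \<noteq> 0" using assms B by auto
  show ?thesis
  proof
    show "moebius_act A ` {y \<in> S2. moebius_act A y \<in> cball p r} \<subseteq> cap p r"
      unfolding cap_def using moebius_in_S2[OF \<open>det A \<noteq> 0\<close>] by blast
    show "cap p r \<subseteq> moebius_act A ` {y \<in> S2. moebius_act A y \<in> cball p r}"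
    proof
      fix x assume x: "x \<in> cap p r"
      then have xS: "x \<in> S2" "x \<in> cball p r" unfolding cap_def by blast+
      show "x \<in> moebius_act A ` {y \<in> S2. moebius_act A y \<in> cball p r}"
      proof (rule image_eqI[of _ _ "moebius_act B x"])
        show "x = moebius_act A (moebius_act B x)" using B(3)[OF xS(1)] by simp
        show "moebius_act B x \<in> {y \<in> S2. moebius_act A y \<in> cball p r}"
          using moebius_in_S2[OF \<open>det B \<noteq> 0\<close> xS(1)] xS(2) B(3)[OF xS(1)] by simp
      qed
    qed
  qed
qed

section \<open>Quasiconformal measures are comparable with area\<close>

locale quasiconformal =
  fixes d C :: real and G :: "(complex^2^2) set set" and \<mu> :: "(complex \<times> real) measure"
  assumes d: "0 < d" and C: "1 \<le> C" and G: "dense_subgroup G"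
    and prob: "prob_space \<mu>" and sets: "sets \<mu> = sets borel_S2"
    and distortion: "\<And>g B. g \<in> G \<Longrightarrow> B \<in> sets \<mu> \<Longrightarrow>
      ennreal (1 / C) * (\<integral>\<^sup>+x\<in>B. ennreal (deriv_norm (PSL_act g) x powr d) \<partial>\<mu>) \<le> emeasure \<mu> (PSL_act g ` B) \<and>
      emeasure \<mu> (PSL_act g ` B) \<le> ennreal C * (\<integral>\<^sup>+x\<in>B. ennreal (deriv_norm (PSL_act g) x powr d) \<partial>\<mu>)"
begin

sublocale prob_space \<mu> by (rule prob)

lemma subset_S2: "B \<in> sets \<mu> \<Longrightarrow> B \<subseteq> S2"
  unfolding sets sets_borel_S2 by blast

lemma cap_events [measurable]: "cap x r \<in> sets \<mu>"
  unfolding sets by (rule cap_sets)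

lemma image_moebius:
  assumes "det A = 1" "B \<in> sets \<mu>"
  shows "PSL_act {A, - A} ` B = moebius_act A ` B"
  by (rule image_cong[OF refl]) (use PSL_act_moebius[OF assms(1)] subset_S2[OF assms(2)] in blast)

lemma measure_image_le:
  assumes A: "det A = 1" "{A, - A} \<in> G" and B: "B \<in> sets \<mu>"
    and a: "0 < a" "\<And>x. x \<in> B \<Longrightarrow> a \<le> stretch A x"
  shows "prob (moebius_act A ` B) \<le> C * (1 / a) powr d * prob B"
proof -
  have "emeasure \<mu> (moebius_act A ` B) \<le> ennreal C * (\<integral>\<^sup>+x\<in>B. ennreal (deriv_norm (PSL_act {A, - A}) x powr d) \<partial>\<mu>)"
    using distortion[OF A(2) B] image_moebius[OF A(1) B] by simp
  also have "\<dots> \<le> ennreal C * (\<integral>\<^sup>+x. ennreal ((1 / a) powr d) * indicator B x \<partial>\<mu>)"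
  proof (intro mult_left_mono nn_integral_mono)
    fix x
    show "ennreal (deriv_norm (PSL_act {A, - A}) x powr d) * indicator B x \<le> ennreal ((1 / a) powr d) * indicator B x"
    proof (cases "x \<in> B")
      case True
      then have "x \<in> S2" using subset_S2[OF B] by blast
      then have e: "deriv_norm (PSL_act {A, - A}) x = 1 / stretch A x" by (rule deriv_norm_PSL_act[OF A(1)])
      have "1 / stretch A x \<le> 1 / a" using a(1) a(2)[OF True] by (intro divide_left_mono) auto
      moreover have "0 \<le> 1 / stretch A x" using a(1) a(2)[OF True] by simp
      ultimately have "(1 / stretch A x) powr d \<le> (1 / a) powr d" using d by (intro powr_mono2) auto
      then show ?thesis unfolding e using True by (simp add: ennreal_leI)
    qed simp
  qed simp
  also have "\<dots> = ennreal C * (ennreal ((1 / a) powr d) * emeasure \<mu> B)"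
    using B by (simp add: nn_integral_cmult)
  also have "\<dots> = ennreal (C * (1 / a) powr d * prob B)"
    using C by (simp add: emeasure_eq_measure ennreal_mult mult.assoc)
  finally show ?thesis using C by (simp add: emeasure_eq_measure)
qed

lemma measure_image_ge:
  assumes A: "det A = 1" "{A, - A} \<in> G" and B: "B \<in> sets \<mu>"
    and a: "\<And>x. x \<in> B \<Longrightarrow> stretch A x \<le> b"
  shows "(1 / b) powr d / C * prob B \<le> prob (moebius_act A ` B)"
proof -
  have "ennreal (1 / C) * (ennreal ((1 / b) powr d) * emeasure \<mu> B)
      = ennreal (1 / C) * (\<integral>\<^sup>+x. ennreal ((1 / b) powr d) * indicator B x \<partial>\<mu>)"
    using B by (simp add: nn_integral_cmult)
  also have "\<dots> \<le> ennreal (1 / C) * (\<integral>\<^sup>+x\<in>B. ennreal (deriv_norm (PSL_act {A, - A}) x powr d) \<partial>\<mu>)"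
  proof (intro mult_left_mono nn_integral_mono)
    fix x
    show "ennreal ((1 / b) powr d) * indicator B x \<le> ennreal (deriv_norm (PSL_act {A, - A}) x powr d) * indicator B x"
    proof (cases "x \<in> B")
      case True
      then have x: "x \<in> S2" using subset_S2[OF B] by blast
      then have e: "deriv_norm (PSL_act {A, - A}) x = 1 / stretch A x" by (rule deriv_norm_PSL_act[OF A(1)])
      have s: "0 < stretch A x" using stretch_pos[OF _ x, of A] A(1) by simp
      then have b: "0 < b" using a[OF True] by simp
      have "1 / b \<le> 1 / stretch A x" using s b a[OF True] by (intro divide_left_mono) auto
      then have "(1 / b) powr d \<le> (1 / stretch A x) powr d" using d b by (intro powr_mono2) auto
      then show ?thesis unfolding e using True by (simp add: ennreal_leI)
    qed simp
  qed simp
  also have "\<dots> \<le> emeasure \<mu> (moebius_act A ` B)"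
    using distortion[OF A(2) B] image_moebius[OF A(1) B] by simp
  finally have "ennreal (1 / C) * (ennreal ((1 / b) powr d) * ennreal (prob B)) \<le> ennreal (prob (moebius_act A ` B))"
    by (simp only: emeasure_eq_measure)
  then have "ennreal ((1 / b) powr d / C * prob B) \<le> ennreal (prob (moebius_act A ` B))"
    using C by (simp add: ennreal_mult[symmetric])
  then show ?thesis using C by simp
qed

lemma near_isometry:
  assumes x: "x \<in> S2" and r: "0 < r"
  obtains B where "det B = 1" "{B, - B} \<in> G" "\<And>y. y \<in> S2 \<Longrightarrow> 1 / 2 \<le> stretch B y"
    "\<And>y. y \<in> S2 \<Longrightarrow> stretch B y \<le> 2" "dist (moebius_act B (0, 1)) x \<le> r"
proof -
  obtain A where A: "det A = 1" "moebius_act A (0, 1) = x" "\<And>y. stretch A y = 1"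
    using transitive_isometry[OF x] by metis
  have "\<exists>B. det B = 1 \<and> {B, - B} \<in> G \<and> (\<forall>x\<in>S2. 1 / 2 < stretch B x) \<and> (\<forall>x\<in>S2. stretch B x < 2)
     \<and> dist (moebius_act B (0, 1)) (moebius_act A (0, 1)) < r"
    by (rule dense_subgroup_approx[OF G A(1)]) (use r in \<open>simp_all add: A(3) norm_prod_def\<close>)
  then show thesis using that unfolding A(2) by (meson less_imp_le)
qed

text \<open>
  Elements of the group with stretch between $1/2$ and 2 change distances by a factor of at most 2
  and measures by a factor of at most $C 2^d$. The remaining loss in the radius, up to the factor 4,
  pays for the error in the image of the pole.
\<close>

lemma cap_compare_pole:
  assumes x: "x \<in> S2" and r: "0 < r"
  shows "prob (cap x r) \<le> C * 2 powr d * prob (cap (0, 1) (4 * r))"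
    and "prob (cap (0, 1) r) \<le> C * 2 powr d * prob (cap x (4 * r))"
proof -
  have N: "(0, 1) \<in> S2" by (simp add: norm_prod_def)
  obtain B where B: "det B = 1" "{B, - B} \<in> G" "\<And>y. y \<in> S2 \<Longrightarrow> 1 / 2 \<le> stretch B y"
    "\<And>y. y \<in> S2 \<Longrightarrow> stretch B y \<le> 2" "dist (moebius_act B (0, 1)) x \<le> r"
    using near_isometry[OF x r] by metis
  have s: "1 / 2 \<le> sqrt (stretch B y * stretch B z)" "sqrt (stretch B y * stretch B z) \<le> 2"
    if "y \<in> S2" "z \<in> S2" for y z
  proof -
    have "1 / 2 * (1 / 2) \<le> stretch B y * stretch B z"
      using B(3)[OF that(1)] B(3)[OF that(2)] by (intro mult_mono) auto
    then show "1 / 2 \<le> sqrt (stretch B y * stretch B z)"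
      by (intro real_le_rsqrt) (simp add: power2_eq_square)
    have "stretch B y * stretch B z \<le> 2 * 2"
      using B(3)[OF that(2)] B(4)[OF that(1)] B(4)[OF that(2)] by (intro mult_mono) auto
    then show "sqrt (stretch B y * stretch B z) \<le> 2"
      by (intro real_le_lsqrt) (simp_all add: power2_eq_square)
  qed
  have dist1: "dist y z \<le> 2 * dist (moebius_act B y) (moebius_act B z)" and dist2: "dist (moebius_act B y) (moebius_act B z) \<le> 2 * dist y z"
    if yz: "y \<in> S2" "z \<in> S2" for y z
  proof -
    define q where "q = sqrt (stretch B y * stretch B z)"
    have q: "1 / 2 \<le> q" "q \<le> 2" using s[OF yz] by (simp_all add: q_def)
    have e: "dist y z = q * dist (moebius_act B y) (moebius_act B z)"
      unfolding dist_moebius[OF B(1) yz] q_def[symmetric] using q by simp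
    show "dist y z \<le> 2 * dist (moebius_act B y) (moebius_act B z)"
      unfolding e using q by (intro mult_right_mono) auto
    have "1 / 2 * dist (moebius_act B y) (moebius_act B z) \<le> dist y z"
      unfolding e using q by (intro mult_right_mono) auto
    then show "dist (moebius_act B y) (moebius_act B z) \<le> 2 * dist y z" by simp
  qed
  have P: "{y \<in> S2. moebius_act B y \<in> cball x r} \<in> sets \<mu>"
    unfolding sets by (rule closed_S2_sets[OF moebius_preimage_closed[OF B(1)]]) blast
  have "prob (cap x r) \<le> C * (1 / (1 / 2)) powr d * prob {y \<in> S2. moebius_act B y \<in> cball x r}"
    unfolding moebius_image_preimage[OF B(1), symmetric]
    by (rule measure_image_le[OF B(1,2) P]) (use B(3) in auto)
  also have "\<dots> \<le> C * 2 powr d * prob (cap (0, 1) (4 * r))"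
  proof -
    have "{y \<in> S2. moebius_act B y \<in> cball x r} \<subseteq> cap (0, 1) (4 * r)"
    proof
      fix y assume "y \<in> {y \<in> S2. moebius_act B y \<in> cball x r}"
      then have y: "y \<in> S2" "dist x (moebius_act B y) \<le> r" by (auto simp del: mem_sphere mem_sphere_0)
      have "dist (0, 1) y \<le> 2 * dist (moebius_act B (0, 1)) (moebius_act B y)" by (rule dist1[OF N y(1)])
      also have "\<dots> \<le> 2 * (r + r)"
        using B(5) y(2) dist_triangle[of "moebius_act B (0, 1)" "moebius_act B y" x] by simp
      finally show "y \<in> cap (0, 1) (4 * r)" using y(1) by (simp add: cap_def)
    qed
    then have "prob {y \<in> S2. moebius_act B y \<in> cball x r} \<le> prob (cap (0, 1) (4 * r))"
      by (rule finite_measure_mono) (rule cap_events)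
    then show ?thesis using C by (simp add: mult_left_mono)
  qed
  finally show "prob (cap x r) \<le> C * 2 powr d * prob (cap (0, 1) (4 * r))" .
  have "(1 / 2) powr d / C * prob (cap (0, 1) r) \<le> prob (moebius_act B ` cap (0, 1) r)"
    by (rule measure_image_ge[OF B(1,2) cap_events]) (use B(4) in \<open>auto simp: cap_def\<close>)
  also have "\<dots> \<le> prob (cap x (4 * r))"
  proof (rule finite_measure_mono)
    show "moebius_act B ` cap (0, 1) r \<subseteq> cap x (4 * r)"
    proof (rule image_subsetI)
      fix y assume "y \<in> cap (0, 1) r"
      then have y: "y \<in> S2" "dist (0, 1) y \<le> r" by (auto simp: cap_def)
      have "dist x (moebius_act B y) \<le> dist x (moebius_act B (0, 1)) + dist (moebius_act B (0, 1)) (moebius_act B y)"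
        by (rule dist_triangle)
      also have "\<dots> \<le> r + 2 * r" using B(5) dist2[OF N y(1)] y(2) by (simp add: dist_commute)
      finally show "moebius_act B y \<in> cap x (4 * r)"
        using moebius_in_S2[OF _ y(1), of B] B(1) r by (simp add: cap_def)
    qed
  qed (rule cap_events)
  finally have "(1 / 2) powr d / C * prob (cap (0, 1) r) \<le> prob (cap x (4 * r))" .
  then have "C * 2 powr d * ((1 / 2) powr d / C * prob (cap (0, 1) r)) \<le> C * 2 powr d * prob (cap x (4 * r))"
    using C by (intro mult_left_mono) auto
  moreover have "2 powr d * (1 / 2) powr d = 1" by (simp add: powr_mult[symmetric])
  then have "C * 2 powr d * ((1 / 2) powr d / C * prob (cap (0, 1) r)) = prob (cap (0, 1) r)"
    using C by (simp add: mult.assoc[symmetric])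
  ultimately show "prob (cap (0, 1) r) \<le> C * 2 powr d * prob (cap x (4 * r))" by simp
qed

definition cap_const where "cap_const = (C * 2 powr d)\<^sup>2"

lemma cap_const_pos: "0 < cap_const" using C by (simp add: cap_const_def)

lemma cap_compare:
  assumes "x \<in> S2" "y \<in> S2" "0 < r"
  shows "prob (cap x r) \<le> cap_const * prob (cap y (16 * r))"
proof -
  have "prob (cap x r) \<le> C * 2 powr d * prob (cap (0, 1) (4 * r))" by (rule cap_compare_pole(1)) fact+
  also have "\<dots> \<le> C * 2 powr d * (C * 2 powr d * prob (cap y (4 * (4 * r))))"
    using C assms by (intro mult_left_mono cap_compare_pole(2)) auto
  finally show ?thesis by (simp add: cap_const_def power2_eq_square mult_ac)
qed

lemma thickening_S2: "0 < r \<Longrightarrow> {x \<in> S2. infdist x S2 \<le> r} = S2"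
  by auto

abbreviation "area \<equiv> measure sphere_area"

lemma space_eq: "space \<mu> = S2" "space sphere_area = S2"
  using sets_eq_imp_space_eq[OF sets] sets_eq_imp_space_eq[OF sets_sphere_area] by (simp_all add: space_restrict_space)

lemma area_S2_pos: "0 < area S2"
proof -
  interpret \<sigma>: finite_measure sphere_area by (rule finite_measure_sphere_area)
  have N: "(0, 1) \<in> S2" by (simp add: norm_prod_def)
  have "ennreal (ball_vol3 / 512 * 1\<^sup>2) \<le> emeasure sphere_area (cap (0, 1) 1)" by (rule area_cap_lower[OF N]) auto
  also have "\<dots> \<le> emeasure sphere_area (space sphere_area)" by (rule emeasure_space)
  also have "\<dots> = ennreal (area S2)" by (simp add: \<sigma>.emeasure_eq_measure space_eq)
  finally have "ball_vol3 / 512 \<le> area S2" by simp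
  then show ?thesis using ball_vol3_pos by simp
qed

lemma emeasure_S2: "emeasure sphere_area S2 = ennreal (area S2)" "emeasure \<mu> S2 = 1"
  using finite_measure.emeasure_eq_measure[OF finite_measure_sphere_area] emeasure_space_1 by (simp_all add: space_eq)

text \<open>
  Averaging the comparison \<open>cap_compare\<close> over the centre with respect to area, and exchanging the
  integrals, replaces $\mu$-measures of caps by areas, which are known.
\<close>

lemma cap_upper:
  assumes x: "x \<in> S2" and r: "0 < r"
  shows "prob (cap x r) \<le> cap_const * 72 * ball_vol3 * 256 / area S2 * r\<^sup>2"
proof -
  have r16: "0 < 16 * r" using r by simp
  have "ennreal (prob (cap x r) / cap_const) * ennreal (area S2) = (\<integral>\<^sup>+y\<in>S2. ennreal (prob (cap x r) / cap_const) \<partial>sphere_area)"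
    using nn_integral_cmult_indicator[of S2 sphere_area] by (simp add: emeasure_S2 sets_sphere_area closed_S2_sets)
  also have "\<dots> \<le> (\<integral>\<^sup>+y\<in>S2. emeasure \<mu> (cap y (16 * r)) \<partial>sphere_area)"
  proof (intro nn_integral_mono mult_right_mono)
    fix y assume "y \<in> space sphere_area"
    then have y: "y \<in> S2" unfolding space_eq .
    have "prob (cap x r) / cap_const \<le> prob (cap y (16 * r))"
      using cap_compare[OF x y r] cap_const_pos by (simp add: divide_le_eq mult.commute)
    then show "ennreal (prob (cap x r) / cap_const) \<le> emeasure \<mu> (cap y (16 * r))"
      by (simp add: emeasure_eq_measure ennreal_leI)
  qed simp
  also have "\<dots> \<le> (\<integral>\<^sup>+x\<in>S2. emeasure sphere_area (cap x (16 * r)) \<partial>\<mu>)"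
    using cap_Fubini[OF finite_measure_axioms finite_measure_sphere_area sets sets_sphere_area closed_sphere order_refl, of "16 * r"]
    unfolding thickening_S2[OF r16] .
  also have "\<dots> \<le> (\<integral>\<^sup>+x\<in>S2. ennreal (72 * ball_vol3 * (16 * r)\<^sup>2) \<partial>\<mu>)"
  proof (intro nn_integral_mono mult_right_mono)
    fix y assume "y \<in> space \<mu>"
    then show "emeasure sphere_area (cap y (16 * r)) \<le> ennreal (72 * ball_vol3 * (16 * r)\<^sup>2)"
      unfolding space_eq by (rule area_cap_upper[OF _ r16])
  qed simp
  also have "\<dots> = ennreal (72 * ball_vol3 * (16 * r)\<^sup>2)"
    using nn_integral_cmult_indicator[of S2 \<mu>] by (simp add: emeasure_S2 sets closed_S2_sets)
  finally have "ennreal (prob (cap x r) / cap_const * area S2) \<le> ennreal (72 * ball_vol3 * (16 * r)\<^sup>2)"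
    by (subst ennreal_mult) (use cap_const_pos in simp_all)
  then have "prob (cap x r) / cap_const * area S2 \<le> 72 * ball_vol3 * (16 * r)\<^sup>2"
    using ball_vol3_pos by (subst (asm) ennreal_le_iff) auto
  then show ?thesis using area_S2_pos cap_const_pos by (simp add: field_simps power_mult_distrib)
qed

lemma cap_lower:
  assumes x: "x \<in> S2" and r: "0 < r" "r \<le> 1"
  shows "ball_vol3 / (512 * 256 * cap_const * area S2) * r\<^sup>2 \<le> prob (cap x r)"
proof -
  have r16: "0 < r / 16" using r by simp
  have "ennreal (ball_vol3 / 512 * (r / 16)\<^sup>2) = (\<integral>\<^sup>+y\<in>S2. ennreal (ball_vol3 / 512 * (r / 16)\<^sup>2) \<partial>\<mu>)"
    using nn_integral_cmult_indicator[of S2 \<mu>] by (simp add: emeasure_S2 sets closed_S2_sets)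
  also have "\<dots> \<le> (\<integral>\<^sup>+y\<in>S2. emeasure sphere_area (cap y (r / 16)) \<partial>\<mu>)"
    using area_cap_lower[of _ "r / 16"] r by (intro nn_integral_mono mult_right_mono) (simp_all add: space_eq)
  also have "\<dots> \<le> (\<integral>\<^sup>+y\<in>S2. emeasure \<mu> (cap y (r / 16)) \<partial>sphere_area)"
    using cap_Fubini[OF finite_measure_sphere_area finite_measure_axioms sets_sphere_area sets closed_sphere order_refl, of "r / 16"]
    unfolding thickening_S2[OF r16] .
  also have "\<dots> \<le> (\<integral>\<^sup>+y\<in>S2. ennreal (cap_const * prob (cap x r)) \<partial>sphere_area)"
  proof (intro nn_integral_mono mult_right_mono)
    fix y assume "y \<in> space sphere_area"
    then have y: "y \<in> S2" unfolding space_eq .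
    show "emeasure \<mu> (cap y (r / 16)) \<le> ennreal (cap_const * prob (cap x r))"
      using cap_compare[OF y x, of "r / 16"] r by (simp add: emeasure_eq_measure ennreal_leI)
  qed simp
  also have "\<dots> = ennreal (cap_const * prob (cap x r)) * ennreal (area S2)"
    using nn_integral_cmult_indicator[of S2 sphere_area] by (simp add: emeasure_S2 sets_sphere_area closed_S2_sets)
  also have "\<dots> = ennreal (cap_const * prob (cap x r) * area S2)" using cap_const_pos by (simp add: ennreal_mult)
  finally have "ball_vol3 / 512 * (r / 16)\<^sup>2 \<le> cap_const * prob (cap x r) * area S2"
    using cap_const_pos by (subst (asm) ennreal_le_iff) auto
  then show ?thesis using area_S2_pos cap_const_pos by (simp add: field_simps)
qed

lemma cap_growth:
  obtains k K where "0 < k" "0 < K" "\<And>x r. x \<in> S2 \<Longrightarrow> 0 < r \<Longrightarrow> prob (cap x r) \<le> K * r\<^sup>2"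
    "\<And>x r. x \<in> S2 \<Longrightarrow> 0 < r \<Longrightarrow> r \<le> 1 \<Longrightarrow> k * r\<^sup>2 \<le> prob (cap x r)"
proof (rule that[OF _ _ cap_upper cap_lower])
  show "0 < ball_vol3 / (512 * 256 * cap_const * area S2)" "0 < cap_const * 72 * ball_vol3 * 256 / area S2"
    using ball_vol3_pos cap_const_pos area_S2_pos by simp_all
qed

lemma absolutely_continuous: "absolutely_continuous sphere_area \<mu>"
proof -
  obtain k K where k: "0 < k" "0 < K" "\<And>x r. x \<in> S2 \<Longrightarrow> 0 < r \<Longrightarrow> prob (cap x r) \<le> K * r\<^sup>2"
    "\<And>x r. x \<in> S2 \<Longrightarrow> 0 < r \<Longrightarrow> r \<le> 1 \<Longrightarrow> k * r\<^sup>2 \<le> prob (cap x r)"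
    using cap_growth by metis
  define c where "c = K * 512 / ball_vol3"
  have c0: "0 \<le> c" using k ball_vol3_pos by (simp add: c_def)
  have cl: "emeasure \<mu> F \<le> ennreal c * emeasure sphere_area F" if F: "closed F" "F \<subseteq> S2" for F
  proof (rule domination_closed[where \<phi> = "\<lambda>r. ball_vol3 / 512 * r\<^sup>2"])
    show "emeasure \<mu> (cap x r) \<le> ennreal (c * (ball_vol3 / 512 * r\<^sup>2))" if "x \<in> S2" "0 < r" for x r
      using k(3)[OF that] ball_vol3_pos by (simp add: emeasure_eq_measure c_def ennreal_leI)
  qed (use finite_measure_sphere_area finite_measure_axioms sets_sphere_area sets c0 F ball_vol3_pos area_cap_lower in \<open>simp_all del: mem_sphere mem_sphere_0\<close>)
  have dom: "emeasure \<mu> B \<le> ennreal c * emeasure sphere_area B" if "B \<in> sets borel_S2" for B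
    by (rule domination[OF finite_measure_sphere_area finite_measure_axioms sets_sphere_area sets cl that])
  show ?thesis unfolding absolutely_continuous_def
  proof
    fix B assume B: "B \<in> null_sets sphere_area"
    then have "B \<in> sets borel_S2" "emeasure sphere_area B = 0" using sets_sphere_area by auto
    then show "B \<in> null_sets \<mu>" using dom[of B] sets by auto
  qed
qed

section \<open>The dimension\<close>

text \<open>
  The matrix $\mathrm{diag}(\sqrt L, 1/\sqrt L)$ contracts the hemisphere around the pole by factors
  of order $1/L$, and nowhere by a factor below $1/L$; a group element is taken near it.
\<close>

lemma near_dilation:
  assumes L: "1 \<le> L"
  obtains B where "det B = 1" "{B, - B} \<in> G" "\<And>y. y \<in> cap (0, 1) 1 \<Longrightarrow> L / 4 \<le> stretch B y"
    "\<And>y. y \<in> S2 \<Longrightarrow> stretch B y \<le> 2 * L"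
proof -
  define l where "l = complex_of_real (sqrt L)"
  have l: "l \<noteq> 0" "(cmod l)\<^sup>2 = L" using L by (simp_all add: l_def)
  define A :: "complex^2^2" where "A = vector [vector [l, 0], vector [0, 1 / l]]"
  have A: "A$1$1 = l" "A$1$2 = 0" "A$2$1 = 0" "A$2$2 = 1 / l" by (simp_all add: A_def)
  have dA: "det A = 1" using l by (simp add: det_2 A)
  have s: "stretch A y = L * ((1 + snd y) / 2) + 1 / L * ((1 - snd y) / 2)" for y
    using l by (simp add: stretch_def A norm_divide power_divide)
  have "1 * 1 \<le> L * L" using L by (intro mult_mono) auto
  then have L1: "1 / L \<le> L" "0 < 1 / L" using L by (simp_all add: divide_le_eq)
  have sb: "stretch A y < 2 * L" if "y \<in> S2" for y
  proof -
    have "\<bar>snd y\<bar> \<le> norm y" using norm_snd_le[of "snd y" "fst y"] by simp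
    then have t: "-1 \<le> snd y" "snd y \<le> 1" using that by auto
    have "1 / L * ((1 - snd y) / 2) \<le> L * ((1 - snd y) / 2)" using L1 t by (intro mult_right_mono) auto
    then have "stretch A y \<le> L * ((1 + snd y) / 2) + L * ((1 - snd y) / 2)" unfolding s by simp
    also have "\<dots> = L" by (simp add: field_simps)
    finally show ?thesis using L by simp
  qed
  have sa: "L / 4 < stretch A y" if y: "y \<in> cap (0, 1) 1" for y
  proof -
    have yS: "norm y = 1" "dist y (0, 1) \<le> 1" using y by (auto simp: cap_def dist_commute)
    have "snd y \<le> 1" using norm_snd_le[of "snd y" "fst y"] yS(1) by simp
    have "\<bar>snd y - 1\<bar> \<le> dist y (0, 1)"
      using dist_snd_le[of y "(0, 1)"] by (simp add: dist_real_def)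
    then have "0 \<le> snd y" using yS by simp
    then have "L * (1 / 2) \<le> L * ((1 + snd y) / 2)" using L by (intro mult_left_mono) auto
    moreover have "0 \<le> 1 / L * ((1 - snd y) / 2)" using L1 \<open>snd y \<le> 1\<close> by (intro mult_nonneg_nonneg) auto
    ultimately have "L * (1 / 2) \<le> stretch A y" unfolding s by linarith
    then show ?thesis using L by simp
  qed
  have cc: "compact (cap (0, 1) 1)" unfolding cap_def by (intro compact_Int_closed compact_sphere closed_cball)
  have "\<exists>B. det B = 1 \<and> {B, - B} \<in> G \<and> (\<forall>x\<in>cap (0, 1) 1. L / 4 < stretch B x) \<and> (\<forall>x\<in>S2. stretch B x < 2 * L)
     \<and> dist (moebius_act B (0, 1)) (moebius_act A (0, 1)) < 1"
    by (rule dense_subgroup_approx[OF G dA cc sa sb]) (simp_all add: norm_prod_def)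
  then show thesis using that by (meson less_imp_le)
qed

text \<open>
  The two inequalities in \<open>two\<close> compare the measure of the image of a cap with that of caps
  outside and inside it. They bound $L^{2-d}$ and $L^{d-2}$, respectively, for all $L \ge 1$.
\<close>

lemma dimension: "d = 2"
proof -
  obtain k K where k: "0 < k" "0 < K" "\<And>x r. x \<in> S2 \<Longrightarrow> 0 < r \<Longrightarrow> prob (cap x r) \<le> K * r\<^sup>2"
    "\<And>x r. x \<in> S2 \<Longrightarrow> 0 < r \<Longrightarrow> r \<le> 1 \<Longrightarrow> k * r\<^sup>2 \<le> prob (cap x r)"
    using cap_growth by metis
  have N: "(0, 1) \<in> S2" by (simp add: norm_prod_def)
  define E where "E = cap (0, 1) 1"
  have E: "E \<in> sets \<mu>" unfolding E_def by (rule cap_events)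
  have kE: "k \<le> prob E" using k(4)[OF N, of 1] by (simp add: E_def)
  have NE: "(0, 1) \<in> E" using N by (simp add: E_def cap_def)
  have two: "k * (1 / (2 * L)) powr d \<le> 16 * C * K / L\<^sup>2 \<and> k / (4 * L\<^sup>2) \<le> C * (4 / L) powr d" if L: "1 \<le> L" for L
  proof -
    obtain B where B: "det B = 1" "{B, - B} \<in> G" "\<And>y. y \<in> E \<Longrightarrow> L / 4 \<le> stretch B y"
      "\<And>y. y \<in> S2 \<Longrightarrow> stretch B y \<le> 2 * L"
      unfolding E_def using near_dilation[OF L] by metis
    have ES: "y \<in> S2" if "y \<in> E" for y using that E subset_S2 by blast
    define p where "p = moebius_act B (0, 1)"
    have pS: "p \<in> S2" unfolding p_def by (rule moebius_in_S2[OF _ N]) (simp add: B)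
    have "(1 / (2 * L)) powr d / C * prob E \<le> prob (moebius_act B ` E)"
      by (rule measure_image_ge[OF B(1,2) E]) (use B(4) ES in blast)
    also have "\<dots> \<le> prob (cap p (4 / L))"
    proof (rule finite_measure_mono)
      show "moebius_act B ` E \<subseteq> cap p (4 / L)"
      proof (rule image_subsetI)
        fix y assume y: "y \<in> E"
        have "L / 4 * (L / 4) \<le> stretch B (0, 1) * stretch B y"
          using B(3)[OF NE] B(3)[OF y] L by (intro mult_mono) auto
        then have q: "L / 4 \<le> sqrt (stretch B (0, 1) * stretch B y)"
          by (intro real_le_rsqrt) (simp add: power2_eq_square)
        have "dist p (moebius_act B y) = dist (0, 1) y / sqrt (stretch B (0, 1) * stretch B y)"
          unfolding p_def by (rule dist_moebius[OF B(1) N ES[OF y]])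
        also have "\<dots> \<le> 1 / (L / 4)"
          using y q L by (intro frac_le) (auto simp: E_def cap_def)
        finally have "dist p (moebius_act B y) \<le> 4 / L" by simp
        moreover have "moebius_act B y \<in> S2" by (rule moebius_in_S2[OF _ ES[OF y]]) (simp add: B)
        ultimately show "moebius_act B y \<in> cap p (4 / L)" unfolding cap_def by simp
      qed
    qed (rule cap_events)
    also have "\<dots> \<le> K * (4 / L)\<^sup>2" using L by (intro k(3) pS) auto
    finally have 1: "(1 / (2 * L)) powr d / C * prob E \<le> K * (4 / L)\<^sup>2" .
    have "(1 / (2 * L)) powr d / C * k \<le> (1 / (2 * L)) powr d / C * prob E"
      using C kE by (intro mult_left_mono) auto
    with 1 have "(1 / (2 * L)) powr d / C * k \<le> K * (4 / L)\<^sup>2" by simp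
    then have first: "k * (1 / (2 * L)) powr d \<le> 16 * C * K / L\<^sup>2"
      using C by (simp add: field_simps power_divide)
    define P where "P = {y \<in> S2. moebius_act B y \<in> cball p (1 / (2 * L))}"
    have P: "P \<in> sets \<mu>" unfolding P_def sets by (rule closed_S2_sets[OF moebius_preimage_closed[OF B(1)]]) blast
    have PE: "P \<subseteq> E"
    proof
      fix y assume "y \<in> P"
      then have y: "y \<in> S2" "dist p (moebius_act B y) \<le> 1 / (2 * L)" by (auto simp: P_def)
      have pos: "0 < stretch B (0, 1)" "0 < stretch B y" using stretch_pos B(1) N y(1) by auto
      have "stretch B (0, 1) * stretch B y \<le> 2 * L * (2 * L)"
        using B(4)[OF N] B(4)[OF y(1)] pos L by (intro mult_mono) auto
      then have q: "sqrt (stretch B (0, 1) * stretch B y) \<le> 2 * L"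
        using L by (intro real_le_lsqrt) (simp_all add: power2_eq_square)
      have "dist p (moebius_act B y) = dist (0, 1) y / sqrt (stretch B (0, 1) * stretch B y)"
        unfolding p_def by (rule dist_moebius[OF B(1) N y(1)])
      then have "dist (0, 1) y = dist p (moebius_act B y) * sqrt (stretch B (0, 1) * stretch B y)"
        using pos by simp
      also have "\<dots> \<le> 1 / (2 * L) * (2 * L)"
        using y(2) q L pos by (intro mult_mono) auto
      also have "\<dots> = 1" using L by simp
      finally show "y \<in> E" using y(1) by (simp add: E_def cap_def)
    qed
    have "1 / (2 * L) \<le> 1" using L by simp
    then have "k * (1 / (2 * L))\<^sup>2 \<le> prob (cap p (1 / (2 * L)))" using L by (intro k(4) pS) auto
    also have "\<dots> \<le> C * (1 / (L / 4)) powr d * prob P"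
      unfolding moebius_image_preimage[OF B(1), symmetric] P_def[symmetric]
      by (rule measure_image_le[OF B(1,2) P]) (use L B(3) PE in auto)
    also have "\<dots> \<le> C * (1 / (L / 4)) powr d * 1" using C by (intro mult_left_mono) auto
    finally have "k / (4 * L\<^sup>2) \<le> C * (4 / L) powr d" by (simp add: power_divide power_mult_distrib)
    with first show ?thesis by blast
  qed
  have bounded_powr: False if a: "0 < a" and b: "\<And>L. 1 \<le> L \<Longrightarrow> L powr a \<le> M" for a M :: real
  proof -
    \<comment> \<open>chosen so that the power exceeds the bound\<close>
    define L where "L = (max 1 (M + 1)) powr (1 / a)"
    have "1 \<le> L" using a by (simp add: L_def ge_one_powr_ge_zero)
    moreover have "L powr a = max 1 (M + 1)" using a by (simp add: L_def powr_powr)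
    ultimately show False using b[of L] by simp
  qed
  show ?thesis
  proof (rule antisym; rule ccontr)
    assume "\<not> d \<le> 2"
    then have "0 < d - 2" by simp
    then show False
    proof (rule bounded_powr)
      fix L :: real assume L: "1 \<le> L"
      have "k / (4 * L powr 2) \<le> C * (4 powr d / L powr d)"
        using two[OF L] L by (simp add: powr_divide powr_numeral)
      then have "L powr d / L powr 2 \<le> 4 * C * 4 powr d / k"
        using L k(1) by (simp add: field_simps)
      then show "L powr (d - 2) \<le> 4 * C * 4 powr d / k" by (simp add: powr_diff)
    qed
  next
    assume "\<not> 2 \<le> d"
    then have "0 < 2 - d" by simp
    then show False
    proof (rule bounded_powr)
      fix L :: real assume L: "1 \<le> L"
      have "k * (1 / (2 powr d * L powr d)) \<le> 16 * C * K / L powr 2"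
        using two[OF L] L by (simp add: powr_divide powr_numeral powr_mult)
      then have "L powr 2 / L powr d \<le> 16 * C * K * 2 powr d / k"
        using L k(1) by (simp add: field_simps)
      then show "L powr (2 - d) \<le> 16 * C * K * 2 powr d / k" by (simp add: powr_diff)
    qed
  qed
qed

end

section \<open>The rigidity theorem\<close>

theorem mainTheorem1:
  fixes G\<^sub>1 G\<^sub>2 :: "(complex^2^2) set set"
  assumes "countable G\<^sub>1" "dense_subgroup G\<^sub>1"
    and "countable G\<^sub>2" "dense_subgroup G\<^sub>2"
  shows "(\<forall>(d::real) \<mu>. d > 0 \<and> quasiconformal_measure d G\<^sub>1 \<mu> \<longrightarrow>
            absolutely_continuous sphere_area \<mu> \<and> d = 2) \<and>
         (\<forall>h. orbit_equivalence G\<^sub>1 G\<^sub>2 h \<longrightarrow>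
            equivariant G\<^sub>1 G\<^sub>2 h \<and>
            (orientation_preserving h \<longrightarrow>
               (\<exists>g\<in>carrier PSL2C. \<forall>x\<in>S2. h x = PSL_act g x)) \<and>
            (\<not> orientation_preserving h \<longrightarrow>
               (\<exists>g\<in>carrier PSL2C. \<forall>x\<in>S2. h x = PSL_act g (conj_S2 x))))"
proof (rule conjI; intro allI impI)
  fix d :: real and \<mu> :: "(complex \<times> real) measure"
  assume dm: "d > 0 \<and> quasiconformal_measure d G\<^sub>1 \<mu>"
  then obtain C where "1 \<le> C" and dist: "\<forall>g\<in>G\<^sub>1. \<forall>B\<in>sets \<mu>.
      ennreal (1 / C) * (\<integral>\<^sup>+x\<in>B. ennreal (deriv_norm (PSL_act g) x powr d) \<partial>\<mu>) \<le> emeasure \<mu> (PSL_act g ` B) \<and>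
      emeasure \<mu> (PSL_act g ` B) \<le> ennreal C * (\<integral>\<^sup>+x\<in>B. ennreal (deriv_norm (PSL_act g) x powr d) \<partial>\<mu>)"
    unfolding quasiconformal_measure_def by blast
  interpret quasiconformal d C G\<^sub>1 \<mu>
  proof (rule quasiconformal.intro)
    show "prob_space \<mu>" "sets \<mu> = sets borel_S2"
      using dm unfolding quasiconformal_measure_def by blast+
  qed (use dm assms(2) \<open>1 \<le> C\<close> dist in simp_all)
  show "absolutely_continuous sphere_area \<mu> \<and> d = 2"
    using absolutely_continuous dimension ..
next
  fix h assume h: "orbit_equivalence G\<^sub>1 G\<^sub>2 h"
  interpret orbit_equivalent_subgroups G\<^sub>1 G\<^sub>2 h
    using assms(2,4) h by (intro orbit_equivalent_subgroups.intro) (simp_all add: dense_subgroup_def)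
  have "\<exists>A. det A = 1 \<and> ((\<forall>x\<in>S2. h x = moebius_act A x) \<or> (\<forall>x\<in>S2. h x = moebius_act A (conj_S2 x)))"
    by (rule normaliser_moebius[OF h_cont h_image h_inj normalises[OF assms(2,3)]])
  then obtain A where A: "det A = 1"
    and hA: "(\<forall>x\<in>S2. h x = moebius_act A x) \<or> (\<forall>x\<in>S2. h x = moebius_act A (conj_S2 x))"
    by (elim exE conjE)
  have nz: "det A \<noteq> 0" using A by simp
  have g: "{A, - A} \<in> carrier PSL2C" using A by (auto simp: carrier_PSL2C)
  have "(orientation_preserving h \<longrightarrow> (\<exists>g\<in>carrier PSL2C. \<forall>x\<in>S2. h x = PSL_act g x)) \<and>
    (\<not> orientation_preserving h \<longrightarrow> (\<exists>g\<in>carrier PSL2C. \<forall>x\<in>S2. h x = PSL_act g (conj_S2 x)))"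
    using hA
  proof
    assume e: "\<forall>x\<in>S2. h x = moebius_act A x"
    have "orientation_preserving h"
      by (rule orientation_preserving_moebius[OF nz]) (use e in \<open>rule bspec\<close>)
    moreover have "\<forall>x\<in>S2. h x = PSL_act {A, - A} x"
    proof
      fix x assume x: "x \<in> S2"
      show "h x = PSL_act {A, - A} x" unfolding PSL_act_moebius[OF A x] by (rule bspec[OF e x])
    qed
    ultimately show ?thesis using g by (intro conjI impI bexI[OF _ g]) simp_all
  next
    assume e: "\<forall>x\<in>S2. h x = moebius_act A (conj_S2 x)"
    have "\<not> orientation_preserving h"
      by (rule orientation_reversing_moebius_conj[OF nz]) (use e in \<open>rule bspec\<close>)
    moreover have "\<forall>x\<in>S2. h x = PSL_act {A, - A} (conj_S2 x)"
    proof
      fix x assume x: "x \<in> S2"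
      show "h x = PSL_act {A, - A} (conj_S2 x)"
        unfolding PSL_act_moebius[OF A conj_S2_in_S2[OF x]] by (rule bspec[OF e x])
    qed
    ultimately show ?thesis using g by (intro conjI impI bexI[OF _ g]) simp_all
  qed
  then show "equivariant G\<^sub>1 G\<^sub>2 h \<and>
      (orientation_preserving h \<longrightarrow> (\<exists>g\<in>carrier PSL2C. \<forall>x\<in>S2. h x = PSL_act g x)) \<and>
      (\<not> orientation_preserving h \<longrightarrow> (\<exists>g\<in>carrier PSL2C. \<forall>x\<in>S2. h x = PSL_act g (conj_S2 x)))"
    using equivariant[OF assms(1,3)] by (intro conjI) simp_all
qed

end
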